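(* Let $k\ge -\frac12$, let $M=(a,b;c,d)\in SL(2,\mathbb{R})$ with $b\neq 0$, and let $1\le p\le\infty$. For every $f\in\mathcal{S}(\mathbb{R})$ the following limit exists (in $[0,\infty]$) and $$\lim_{n\to\infty}\|\Lambda_{k,M^{-1}}^n f\|_{L^p_k(\mathbb{R})}^{1/n}=\sigma_f,$$ where $$\sigma_f=\sup\left\{\left|\frac{\lambda}{b}\right| : \lambda\in \operatorname{supp}\,(\mathcal{D}_k^M(f))\right\}\in[0,\infty].$$
   Context: $\mathcal{S}(\mathbb{R})$ is the Schwartz space of complex-valued functions on $\mathbb{R}$. $M=(a,b;c,d)$ denotes the $2\times2$ real matrix with rows $(a,b)$ and $(c,d)$, of determinant $1$; its inverse is $M^{-1}=(d,-b;-c,a)$. Measure and norms: $d\mu_k(x)=\frac{|x|^{2k+1}}{2^{k+1}\Gamma(k+1)}\,dx$ on $\mathbb{R}$. For $1\le p<\infty$, $\|f\|_{L^p_k(\mathbb{R})}=\left(\int_{\mathbb{R}}|f|^p\,d\mu_k\right)^{1/p}$; $\|f\|_{L^\infty_k(\mathbb{R})}=\operatorname{ess\,sup}_{x\in\mathbb{R}}|f(x)|$. Dunkl operator: $\Lambda_k f(x)=f'(x)+\frac{2k+1}{x}\cdot\frac{f(x)-f(-x)}{2}$ (extended continuously to $x=0$). Linear canonical Dunkl operator: $\Lambda_{k,M}f(x)=\Lambda_k f(x)-i\frac{d}{b}\,x f(x)$; hence for the matrix $M^{-1}$, $\Lambda_{k,M^{-1}}f(x)=\Lambda_kf(x)+i\frac{a}{b}\,xf(x)$.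 It maps $\mathcal{S}(\mathbb{R})$ into itself, and $\Lambda^n_{k,M^{-1}}$ is its $n$-fold iterate. Dunkl kernel: for $\lambda,x\in\mathbb{R}$, $E_k(i\lambda,x)=j_k(\lambda x)+\frac{i\lambda x}{2(k+1)}j_{k+1}(\lambda x)$, where $j_\alpha(x)=\Gamma(\alpha+1)\sum_{n=0}^\infty\frac{(-1)^n(x/2)^{2n}}{n!\,\Gamma(n+\alpha+1)}$. Linear canonical Dunkl transform: for $f\in L^1_k(\mathbb{R})$, $$\mathcal{D}_k^M(f)(\lambda)=\frac{1}{(ib)^{k+1}}\int_{\mathbb{R}}f(x)\,E_k^M(\lambda,x)\,d\mu_k(x),\qquad E_k^M(\lambda,x)=e^{\frac{i}{2}\left(\frac{d}{b}\lambda^2+\frac{a}{b}x^2\right)}E_k(-i\lambda/b,x),$$ with $(ib)^{k+1}$ the principal power. It maps $\mathcal{S}(\mathbb{R})$ onto $\mathcal{S}(\mathbb{R})$. The support of a continuous function is the closure of the set where it is nonzero. The supremum is taken in $[0,\infty]$, so the supremum of the empty set is $0$. *)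

theory Defs
  imports "HOL-Analysis.Analysis" "HOL-Probability.Essential_Supremum"
begin

abbreviation vderiv :: "(real \<Rightarrow> complex) \<Rightarrow> real \<Rightarrow> complex" where
  "vderiv f \<equiv> \<lambda>x. vector_derivative f (at x)"

definition schwartz_space :: "(real \<Rightarrow> complex) set" where
  "schwartz_space = {f. \<forall>n. (\<forall>x. (vderiv ^^ n) f differentiable (at x)) \<and>
                          (\<forall>m::nat. bounded (range (\<lambda>x. x ^ m *\<^sub>R (vderiv ^^ n) f x)))}"

text \<open>At the single point \<open>x = 0\<close> the density below is \<open>0\<close> even for \<open>k = -1/2\<close>, because
  \<open>0 powr 0 = 0\<close>; this is a null set.\<close>

definition dunkl_measure :: "real \<Rightarrow> real measure" where
  "dunkl_measure k = density lborel
     (\<lambda>x. ennreal (\<bar>x\<bar> powr (2 * k + 1) / (2 powr (k + 1) * Gamma (k + 1))))"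

text \<open>Only meant for exponents \<open>r > 0\<close>.\<close>

definition ennreal_powr :: "ennreal \<Rightarrow> real \<Rightarrow> ennreal" where
  "ennreal_powr x r = (if x = top then top else ennreal (enn2real x powr r))"

text \<open>The measures \<open>dunkl_measure k\<close> and \<open>lborel\<close> have the same null sets for \<open>k > -1\<close>, so the
  essential supremum is the usual one.\<close>

definition Lp_norm :: "real \<Rightarrow> ennreal \<Rightarrow> (real \<Rightarrow> complex) \<Rightarrow> ennreal" where
  "Lp_norm k p f =
     (if p = top then esssup (dunkl_measure k) (\<lambda>x. ennreal (norm (f x)))
      else ennreal_powr (\<integral>\<^sup>+x. ennreal (norm (f x) powr enn2real p) \<partial>dunkl_measure k)
             (1 / enn2real p))"

definition dunkl_quotient :: "real \<Rightarrow> (real \<Rightarrow> complex) \<Rightarrow> real \<Rightarrow> complex" where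
  "dunkl_quotient k f x =
     vderiv f x + of_real ((2 * k + 1) / x) * ((f x - f (- x)) / 2)"

text \<open>For continuously differentiable \<open>f\<close> the limit is \<open>2 (k + 1) f'(0)\<close>.\<close>

definition dunkl_op :: "real \<Rightarrow> (real \<Rightarrow> complex) \<Rightarrow> real \<Rightarrow> complex" where
  "dunkl_op k f x = (if x = 0 then Lim (at 0) (dunkl_quotient k f) else dunkl_quotient k f x)"

text \<open>For \<open>M = (a, b; c, d)\<close> the entries are \<open>a = M $ 1 $ 1\<close>, \<open>b = M $ 1 $ 2\<close>,
  \<open>c = M $ 2 $ 1\<close>, \<open>d = M $ 2 $ 2\<close>.\<close>

definition lc_dunkl_op :: "real \<Rightarrow> real^2^2 \<Rightarrow> (real \<Rightarrow> complex) \<Rightarrow> real \<Rightarrow> complex" where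
  "lc_dunkl_op k M f x =
     dunkl_op k f x - \<i> * of_real (M $ 2 $ 2 / M $ 1 $ 2) * of_real x * f x"

definition bessel_j :: "real \<Rightarrow> real \<Rightarrow> real" where
  "bessel_j \<alpha> x = Gamma (\<alpha> + 1) *
     (\<Sum>n. (-1) ^ n * (x / 2) ^ (2 * n) / (fact n * Gamma (real n + \<alpha> + 1)))"

text \<open>\<open>dunkl_kernel k \<lambda> x\<close> is \<open>E\<^sub>k(i\<lambda>, x)\<close>: the factor \<open>i\<close> is built in.\<close>

definition dunkl_kernel :: "real \<Rightarrow> real \<Rightarrow> real \<Rightarrow> complex" where
  "dunkl_kernel k l x =
     of_real (bessel_j k (l * x))
     + \<i> * of_real (l * x) / of_real (2 * (k + 1)) * of_real (bessel_j (k + 1) (l * x))"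

definition lc_dunkl_kernel :: "real \<Rightarrow> real^2^2 \<Rightarrow> real \<Rightarrow> real \<Rightarrow> complex" where
  "lc_dunkl_kernel k M l x =
     exp (\<i> / 2 * of_real (M $ 2 $ 2 / M $ 1 $ 2 * l\<^sup>2 + M $ 1 $ 1 / M $ 1 $ 2 * x\<^sup>2))
     * dunkl_kernel k (- l / M $ 1 $ 2) x"

definition lc_dunkl_transform ::
  "real \<Rightarrow> real^2^2 \<Rightarrow> (real \<Rightarrow> complex) \<Rightarrow> real \<Rightarrow> complex" where
  "lc_dunkl_transform k M f l =
     1 / ((\<i> * of_real (M $ 1 $ 2)) powr of_real (k + 1))
     * (LINT x|dunkl_measure k. f x * lc_dunkl_kernel k M l x)"

definition supp :: "(real \<Rightarrow> complex) \<Rightarrow> real set" where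
  "supp g = closure {x. g x \<noteq> 0}"

definition sigma_lc :: "real \<Rightarrow> real^2^2 \<Rightarrow> (real \<Rightarrow> complex) \<Rightarrow> ennreal" where
  "sigma_lc k M f =
     (SUP l \<in> supp (lc_dunkl_transform k M f). ennreal \<bar>l / M $ 1 $ 2\<bar>)"

end

theory Submission
  imports Defs "HOL-Probability.Sinc_Integral"
begin

text \<open>Write \<open>\<Lambda>\<close> for the Dunkl operator, \<open>e\<close> for the function of one variable with \<open>E\<^sub>k(i\<lambda>, x) = e(\<lambda>x)\<close>,
  and \<open>F g(y) = \<integral> g(x) e(- y x) d\<mu>\<^sub>k(x)\<close> for the Dunkl transform.

  \<^bold>\<open>Reduction.\<close> Put \<open>c = a / (2b)\<close> and \<open>g(x) = exp(i c x\<^sup>2) f(x)\<close>. The chirp is even,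
  so conjugating with it turns the linear canonical operator for the inverse matrix into \<open>\<Lambda>\<close>
  (\<open>lc_dunkl_iter\<close>), and the linear canonical transform of \<open>f\<close> at \<open>l\<close> is a nonzero multiple of
  \<open>F g(l / b)\<close> (\<open>lc_dunkl_transform_eq\<close>). Since a chirp has modulus one, what has to be shown is a
  real Paley-Wiener theorem for the Dunkl transform (\<open>dunkl_iterate_growth\<close>): the \<open>n\<close>-th root of
  the norm of \<open>\<Lambda>\<^sup>n g\<close> tends to the supremum of \<open>\<bar>y\<bar>\<close> over all \<open>y\<close> with \<open>F g(y) \<noteq> 0\<close>.

  \<^bold>\<open>Two facts about the transform.\<close> Integration by parts gives \<open>F (\<Lambda> g)(y) = i y F g(y)\<close>
  (\<open>dunkl_transform_dunkl_op\<close>), and there is a constant \<open>\<kappa> \<noteq> 0\<close> with \<open>F (F g)(-x) = \<kappa> g(x)\<close>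
  (\<open>dunkl_inversion\<close>), hence a Plancherel formula. The inversion formula comes from Gaussians: the transforms of
  \<open>exp(- t x\<^sup>2)\<close> and \<open>x exp(- t x\<^sup>2)\<close> are found from a first order differential equation, and they
  satisfy the formula with a constant that does not depend on \<open>t\<close>. Because the kernel is symmetric,
  Fubini's theorem then shows that the difference of the two sides is orthogonal to all these
  functions. By the Weierstrass approximation theorem in the variable \<open>exp(- x\<^sup>2)\<close>, a bounded
  continuous function with this property is zero.

  \<^bold>\<open>Lower bound.\<close> Let \<open>F g(y\<^sub>0) \<noteq> 0\<close> and \<open>r < \<bar>y\<^sub>0\<bar>\<close>. Pair \<open>\<Lambda>\<^sup>n g\<close> with \<open>g\<close> or with \<open>\<Lambda> g\<close>, according to the
  parity of \<open>n\<close>. By Plancherel the result has, up to the factor \<open>\<kappa>\<close>, the modulus of the integral of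
  \<open>\<bar>y\<bar>\<^sup>m \<bar>F g(y)\<bar>\<^sup>2\<close> with an even \<open>m \<in> {n, n + 1}\<close>, which is at least a constant times \<open>r\<^sup>n\<close>. On the
  other side the pairing with a fixed Schwartz function is bounded by a multiple of the norm of \<open>\<Lambda>\<^sup>n g\<close>
  for every exponent \<open>p\<close> (\<open>iterate_lower_bound\<close>).

  \<^bold>\<open>Upper bound.\<close> Let \<open>F g\<close> vanish outside \<open>[-s, s]\<close>. Inversion gives \<open>\<bar>\<Lambda>\<^sup>n g\<bar> \<le> C s\<^sup>n\<close> uniformly. For finite
  \<open>p\<close> decay in \<open>x\<close> is needed as well. The transform exchanges multiplication by \<open>x\<close> with the Dunkl
  operator in \<open>y\<close>, so \<open>F (x g)\<close> again vanishes outside \<open>[-s, s]\<close>; and commuting \<open>x\<close> past \<open>\<Lambda>\<^sup>n\<close> produces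
  only \<open>n \<Lambda>\<^sup>n\<^sup>-\<^sup>1 g\<close> and one reflected term (\<open>dunkl_iter_mult_x\<close>). Hence weights that are polynomial in \<open>x\<close>
  cost factors that are polynomial in \<open>n\<close> (\<open>band_limited_iter_decay\<close>), and these disappear in the \<open>n\<close>-th root.\<close>

section \<open>Schwartz functions\<close>

lemma schwartz_derivative:
  assumes "f \<in> schwartz_space"
  shows "(f has_vector_derivative vderiv f x) (at x)"
proof -
  have "f differentiable (at x)"
    using assms unfolding schwartz_space_def by (auto dest!: spec[of _ "0::nat"])
  thus ?thesis by (simp add: vector_derivative_works)
qed

lemma schwartz_vderiv:
  assumes "f \<in> schwartz_space"
  shows "vderiv f \<in> schwartz_space"
proof -
  have eq: "(vderiv ^^ n) (vderiv f) = (vderiv ^^ Suc n) f" for n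
    by (simp only: funpow_Suc_right o_def)
  show ?thesis
    using assms unfolding schwartz_space_def mem_Collect_eq eq by blast
qed

lemma schwartz_decay:
  assumes "f \<in> schwartz_space"
  shows "\<exists>C. \<forall>x. \<bar>x\<bar> ^ m * norm (f x) \<le> C"
proof -
  have "bounded (range (\<lambda>x. x ^ m *\<^sub>R f x))"
    using assms unfolding schwartz_space_def by (auto dest: spec[of _ "0::nat"])
  thus ?thesis by (auto simp: bounded_iff power_abs)
qed

lemma schwartz_bounded:
  assumes "f \<in> schwartz_space"
  shows "\<exists>C. \<forall>x. norm (f x) \<le> C"
  using schwartz_decay[OF assms, of 0] by simp

lemma schwartz_continuous_on: "f \<in> schwartz_space \<Longrightarrow> continuous_on A f"
  by (meson schwartz_derivative has_vector_derivative_continuous continuous_at_imp_continuous_on)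

lemma schwartz_measurable: "f \<in> schwartz_space \<Longrightarrow> f \<in> borel_measurable borel"
  by (rule borel_measurable_continuous_onI) (rule schwartz_continuous_on)

text \<open>A coinduction principle. Membership in the Schwartz space speaks about all iterated
  derivatives; a family \<open>T a\<close> of functions, indexed by a parameter, that is closed under
  differentiation only needs its members themselves to decay. Every closure property below is an
  instance with a suitable family.\<close>

lemma schwartz_coinduct:
  fixes T :: "'a \<Rightarrow> real \<Rightarrow> complex"
  assumes "a \<in> A"
    and deriv: "\<And>a. a \<in> A \<Longrightarrow> \<exists>a'\<in>A. \<forall>x. (T a has_vector_derivative T a' x) (at x)"
    and decay: "\<And>a m. a \<in> A \<Longrightarrow> \<exists>C. \<forall>x. \<bar>x\<bar> ^ m * norm (T a x) \<le> C"
  shows "T a \<in> schwartz_space"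
proof -
  have step: "\<exists>a'\<in>A. vderiv (T a) = T a'" if "a \<in> A" for a
    using deriv[OF that] by (metis ext vector_derivative_at)
  have X: "\<exists>a'\<in>A. (vderiv ^^ n) (T a) = T a'" for n
  proof (induction n)
    case (Suc n)
    then obtain a' where "a' \<in> A" "(vderiv ^^ n) (T a) = T a'" by blast
    thus ?case using step[of a'] by simp
  qed (use assms(1) in auto)
  have "(vderiv ^^ n) (T a) differentiable (at x)" for n x
  proof -
    obtain a' where "a' \<in> A" "(vderiv ^^ n) (T a) = T a'" using X[of n] by blast
    thus ?thesis using deriv[of a'] by (metis differentiableI_vector)
  qed
  moreover have "bounded (range (\<lambda>x. x ^ m *\<^sub>R (vderiv ^^ n) (T a) x))" for n m
  proof -
    obtain a' where a': "a' \<in> A" "(vderiv ^^ n) (T a) = T a'" using X[of n] by blast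
    show ?thesis unfolding a'(2) using decay[OF a'(1), of m] by (auto simp: bounded_iff power_abs)
  qed
  ultimately show ?thesis unfolding schwartz_space_def by blast
qed

lemma schwartz_add:
  assumes "f \<in> schwartz_space" "g \<in> schwartz_space"
  shows "(\<lambda>x. f x + g x) \<in> schwartz_space"
proof -
  let ?T = "\<lambda>p x. fst p x + snd p x :: complex"
  have "?T (f, g) \<in> schwartz_space"
  proof (rule schwartz_coinduct[where T = ?T and A = "schwartz_space \<times> schwartz_space"])
    fix p :: "(real \<Rightarrow> complex) \<times> (real \<Rightarrow> complex)"
    assume "p \<in> schwartz_space \<times> schwartz_space"
    hence f: "fst p \<in> schwartz_space" and g: "snd p \<in> schwartz_space" by auto
    have "(?T p has_vector_derivative ?T (vderiv (fst p), vderiv (snd p)) x) (at x)" for x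
      by (auto intro!: has_vector_derivative_add schwartz_derivative f g)
    thus "\<exists>q\<in>schwartz_space \<times> schwartz_space. \<forall>x. (?T p has_vector_derivative ?T q x) (at x)"
      using schwartz_vderiv[OF f] schwartz_vderiv[OF g]
      by (intro bexI[of _ "(vderiv (fst p), vderiv (snd p))"]) auto
    fix m
    obtain C D where C: "\<And>x. \<bar>x\<bar> ^ m * norm (fst p x) \<le> C" and D: "\<And>x. \<bar>x\<bar> ^ m * norm (snd p x) \<le> D"
      using schwartz_decay[OF f, of m] schwartz_decay[OF g, of m] by blast
    have "\<bar>x\<bar> ^ m * norm (?T p x) \<le> C + D" for x
    proof -
      have "\<bar>x\<bar> ^ m * norm (?T p x) \<le> \<bar>x\<bar> ^ m * (norm (fst p x) + norm (snd p x))"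
        by (intro mult_left_mono norm_triangle_ineq) simp
      thus ?thesis using C[of x] D[of x] by (simp add: distrib_left)
    qed
    thus "\<exists>C. \<forall>x. \<bar>x\<bar> ^ m * norm (?T p x) \<le> C" by blast
  qed (use assms in auto)
  thus ?thesis by simp
qed

lemma schwartz_mult_const:
  assumes "f \<in> schwartz_space"
  shows "(\<lambda>x. c * f x) \<in> schwartz_space"
proof (rule schwartz_coinduct[where T = "\<lambda>f x. c * f x", OF assms])
  fix f :: "real \<Rightarrow> complex" assume f: "f \<in> schwartz_space"
  have D: "((\<lambda>x. c * f x) has_vector_derivative c * vderiv f x) (at x)" for x
    by (intro has_vector_derivative_mult_right schwartz_derivative f)
  thus "\<exists>f'\<in>schwartz_space. \<forall>x. ((\<lambda>x. c * f x) has_vector_derivative c * f' x) (at x)"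
    by (intro bexI[of _ "vderiv f"] allI D schwartz_vderiv f)
  fix m
  obtain C where C: "\<And>x. \<bar>x\<bar> ^ m * norm (f x) \<le> C" using schwartz_decay[OF f, of m] by blast
  have "\<bar>x\<bar> ^ m * norm (c * f x) \<le> norm c * C" for x
    using mult_left_mono[OF C[of x], of "norm c"] by (simp add: norm_mult mult_ac)
  thus "\<exists>C. \<forall>x. \<bar>x\<bar> ^ m * norm (c * f x) \<le> C" by blast
qed

lemma schwartz_diff:
  assumes "f \<in> schwartz_space" "g \<in> schwartz_space"
  shows "(\<lambda>x. f x - g x) \<in> schwartz_space"
  using schwartz_add[OF assms(1) schwartz_mult_const[OF assms(2), of "-1"]] by simp

lemma schwartz_reflect:
  assumes "f \<in> schwartz_space"
  shows "(\<lambda>x. f (- x)) \<in> schwartz_space"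
proof (rule schwartz_coinduct[where T = "\<lambda>f x. f (- x)", OF assms])
  fix f :: "real \<Rightarrow> complex" assume f: "f \<in> schwartz_space"
  have "((f \<circ> uminus) has_vector_derivative (-1) *\<^sub>R vderiv f (- x)) (at x)" for x
    by (intro vector_diff_chain_at schwartz_derivative[OF f]) (auto intro!: derivative_eq_intros)
  hence D: "((\<lambda>x. f (- x)) has_vector_derivative - 1 * vderiv f (- x)) (at x)" for x
    by (simp add: o_def)
  thus "\<exists>f'\<in>schwartz_space. \<forall>x. ((\<lambda>x. f (- x)) has_vector_derivative f' (- x)) (at x)"
    by (intro bexI[of _ "\<lambda>x. - 1 * vderiv f x"] allI D schwartz_mult_const schwartz_vderiv f)
  fix m
  obtain C where C: "\<And>x. \<bar>x\<bar> ^ m * norm (f x) \<le> C" using schwartz_decay[OF f, of m] by blast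
  have "\<bar>x\<bar> ^ m * norm (f (- x)) \<le> C" for x using C[of "- x"] by simp
  thus "\<exists>C. \<forall>x. \<bar>x\<bar> ^ m * norm (f (- x)) \<le> C" by blast
qed

lemma schwartz_mult_x:
  assumes "f \<in> schwartz_space"
  shows "(\<lambda>x. of_real x * f x) \<in> schwartz_space"
proof -
  \<comment> \<open>\<open>x f\<close> alone is not closed under differentiation, but the functions \<open>x f + g\<close> are.\<close>
  let ?T = "\<lambda>p x. of_real x * fst p x + snd p x :: complex"
  have "?T (f, \<lambda>x. 0 * f x) \<in> schwartz_space"
  proof (rule schwartz_coinduct[where T = ?T and A = "schwartz_space \<times> schwartz_space"])
    show "(f, \<lambda>x. 0 * f x) \<in> schwartz_space \<times> schwartz_space"
      using assms schwartz_mult_const[OF assms, of 0] by blast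
    fix p :: "(real \<Rightarrow> complex) \<times> (real \<Rightarrow> complex)"
    assume "p \<in> schwartz_space \<times> schwartz_space"
    hence f: "fst p \<in> schwartz_space" and g: "snd p \<in> schwartz_space" by auto
    have "(?T p has_vector_derivative of_real x * vderiv (fst p) x + (fst p x + vderiv (snd p) x)) (at x)" for x
      by (auto intro!: derivative_eq_intros schwartz_derivative f g)
    thus "\<exists>q\<in>schwartz_space \<times> schwartz_space. \<forall>x. (?T p has_vector_derivative ?T q x) (at x)"
      using schwartz_vderiv[OF f] schwartz_add[OF f schwartz_vderiv[OF g]]
      by (intro bexI[of _ "(vderiv (fst p), \<lambda>x. fst p x + vderiv (snd p) x)"]) auto
    fix m
    obtain C D where C: "\<And>x. \<bar>x\<bar> ^ Suc m * norm (fst p x) \<le> C" and D: "\<And>x. \<bar>x\<bar> ^ m * norm (snd p x) \<le> D"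
      using schwartz_decay[OF f, of "Suc m"] schwartz_decay[OF g, of m] by blast
    have "\<bar>x\<bar> ^ m * norm (?T p x) \<le> C + D" for x
    proof -
      have "\<bar>x\<bar> ^ m * norm (?T p x) \<le> \<bar>x\<bar> ^ m * (norm (of_real x * fst p x) + norm (snd p x))"
        by (intro mult_left_mono norm_triangle_ineq) simp
      thus ?thesis using C[of x] D[of x] by (simp add: distrib_left norm_mult mult_ac)
    qed
    thus "\<exists>C. \<forall>x. \<bar>x\<bar> ^ m * norm (?T p x) \<le> C" by blast
  qed
  thus ?thesis by simp
qed

lemma schwartz_cnj:
  assumes "f \<in> schwartz_space"
  shows "(\<lambda>x. cnj (f x)) \<in> schwartz_space"
proof (rule schwartz_coinduct[where T = "\<lambda>f x. cnj (f x)", OF assms])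
  fix f :: "real \<Rightarrow> complex" assume f: "f \<in> schwartz_space"
  have D: "((\<lambda>x. cnj (f x)) has_vector_derivative cnj (vderiv f x)) (at x)" for x
    by (rule bounded_linear.has_vector_derivative[OF bounded_linear_cnj schwartz_derivative[OF f]])
  thus "\<exists>f'\<in>schwartz_space. \<forall>x. ((\<lambda>x. cnj (f x)) has_vector_derivative cnj (f' x)) (at x)"
    by (intro bexI[of _ "vderiv f"] allI D schwartz_vderiv f)
  show "\<exists>C. \<forall>x. \<bar>x\<bar> ^ m * norm (cnj (f x)) \<le> C" for m
    using schwartz_decay[OF f, of m] by simp
qed

definition chirp :: "real \<Rightarrow> real \<Rightarrow> complex" where
  "chirp c x = exp (\<i> * of_real (c * x\<^sup>2))"

lemma chirp_add: "chirp c x * chirp d x = chirp (c + d) x"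
  by (simp add: chirp_def distrib_right distrib_left exp_add)

lemma chirp_0 [simp]: "chirp c 0 = 1" and chirp_minus [simp]: "chirp c (- x) = chirp c x"
  by (simp_all add: chirp_def)

lemma norm_chirp [simp]: "norm (chirp c x) = 1"
  unfolding chirp_def by (rule norm_exp_i_times)

lemma chirp_deriv: "(chirp c has_vector_derivative chirp c x * (\<i> * of_real (2 * c * x))) (at x)"
proof -
  have "((\<lambda>z. exp (\<i> * (of_real c * z\<^sup>2))) has_field_derivative
            exp (\<i> * (of_real c * (of_real x)\<^sup>2)) * (\<i> * (of_real c * (2 * of_real x)))) (at (of_real x))"
    by (auto intro!: derivative_eq_intros)
  from has_vector_derivative_real_field[OF this] show ?thesis by (simp add: chirp_def [abs_def] mult_ac)
qed

lemma schwartz_chirp: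
  assumes "f \<in> schwartz_space"
  shows "(\<lambda>x. chirp c x * f x) \<in> schwartz_space"
proof (rule schwartz_coinduct[where T = "\<lambda>f x. chirp c x * f x", OF assms])
  fix f :: "real \<Rightarrow> complex" assume f: "f \<in> schwartz_space"
  let ?f' = "\<lambda>x. vderiv f x + (2 * \<i> * of_real c) * (of_real x * f x)"
  have D: "((\<lambda>x. chirp c x * f x) has_vector_derivative chirp c x * ?f' x) (at x)" for x
    by (rule has_vector_derivative_eq_rhs, rule has_vector_derivative_mult[OF chirp_deriv schwartz_derivative[OF f]])
       (simp add: algebra_simps)
  have "?f' \<in> schwartz_space"
    by (intro schwartz_add schwartz_vderiv f schwartz_mult_const schwartz_mult_x)
  thus "\<exists>f'\<in>schwartz_space. \<forall>x. ((\<lambda>x. chirp c x * f x) has_vector_derivative chirp c x * f' x) (at x)"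
    by (intro bexI[of _ ?f'] allI D)
  show "\<exists>C. \<forall>x. \<bar>x\<bar> ^ m * norm (chirp c x * f x) \<le> C" for m
    using schwartz_decay[OF f, of m] by (simp add: norm_mult)
qed

definition gaussian :: "real \<Rightarrow> real \<Rightarrow> real" where
  "gaussian t x = exp (- (t * x\<^sup>2))"

lemma gaussian_decay:
  assumes "t > 0"
  shows "\<exists>C. \<forall>x. \<bar>x\<bar> ^ m * gaussian t x \<le> C"
proof -
  have *: "\<bar>x\<bar> ^ m * gaussian t x \<le> 1 + fact m / t ^ m" for x
  proof -
    \<comment> \<open>One term of the exponential series beats any power of \<open>x\<close>.\<close>
    have "(t * x\<^sup>2) ^ m / fact m \<le> exp (t * x\<^sup>2)"
    proof -
      have "(\<Sum>n\<in>{m}. (t * x\<^sup>2) ^ n / fact n) \<le> (\<Sum>n. (t * x\<^sup>2) ^ n / fact n)"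
        using assms by (intro sum_le_suminf summable_exp) (auto simp: summable_exp_generic divide_inverse mult.commute intro: summable_exp)
      thus ?thesis by (simp add: exp_def divide_inverse mult.commute)
    qed
    hence "(x\<^sup>2) ^ m * gaussian t x \<le> fact m / t ^ m"
      using assms by (simp add: gaussian_def exp_minus field_simps)
    moreover have "\<bar>x\<bar> ^ m \<le> 1 + (x\<^sup>2) ^ m"
    proof (cases "\<bar>x\<bar> \<le> 1")
      case True
      thus ?thesis using power_le_one[of "\<bar>x\<bar>" m] by (smt (verit) zero_le_power abs_ge_zero zero_le_power2)
    next
      case False
      have "\<bar>x\<bar> ^ m \<le> \<bar>x\<bar> ^ (2 * m)" using False by (intro power_increasing) auto
      thus ?thesis by (simp add: power_mult)
    qed
    moreover have "0 \<le> gaussian t x" "gaussian t x \<le> 1" using assms by (auto simp: gaussian_def)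
    ultimately have "\<bar>x\<bar> ^ m * gaussian t x \<le> (1 + (x\<^sup>2) ^ m) * gaussian t x"
      and "(1 + (x\<^sup>2) ^ m) * gaussian t x \<le> 1 + fact m / t ^ m"
      by (blast intro: mult_right_mono, simp add: distrib_right)
    thus ?thesis by linarith
  qed
  thus ?thesis by blast
qed

lemma gaussian_deriv:
  "((\<lambda>x. complex_of_real (gaussian t x)) has_vector_derivative of_real (- (2 * t * x) * gaussian t x)) (at x)"
proof -
  have "(gaussian t has_real_derivative - (2 * t * x) * gaussian t x) (at x)"
    unfolding gaussian_def by (auto intro!: derivative_eq_intros)
  from has_vector_derivative_of_real[OF this]
  show ?thesis by simp
qed

text \<open>Polynomial multiples are included because the derivative of a Gaussian is one of them.\<close>

lemma gaussian_poly_schwartz: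
  assumes "t > 0"
  shows "(\<lambda>x. poly p (of_real x) * of_real (gaussian t x)) \<in> schwartz_space"
proof (rule schwartz_coinduct[where T = "\<lambda>p x. poly p (of_real x) * of_real (gaussian t x)", OF UNIV_I])
  fix p :: "complex poly"
  define q where "q = pderiv p - [:0, 2 * of_real t:] * p"
  have P: "((\<lambda>x. poly p (of_real x)) has_vector_derivative poly (pderiv p) (of_real x)) (at x)" for x
    by (rule has_vector_derivative_real_field) (rule poly_DERIV)
  have "((\<lambda>x. poly p (of_real x) * of_real (gaussian t x)) has_vector_derivative
          poly q (of_real x) * of_real (gaussian t x)) (at x)" for x
    by (rule has_vector_derivative_eq_rhs, rule has_vector_derivative_mult[OF P gaussian_deriv])
       (simp add: q_def algebra_simps)
  thus "\<exists>q\<in>UNIV. \<forall>x. ((\<lambda>x. poly p (of_real x) * of_real (gaussian t x)) has_vector_derivative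
          poly q (of_real x) * of_real (gaussian t x)) (at x)"
    by blast
  show "\<exists>C. \<forall>x. \<bar>x\<bar> ^ m * norm (poly p (of_real x) * complex_of_real (gaussian t x)) \<le> C" for m
  proof (induction p arbitrary: m)
    case 0
    show ?case by auto
  next
    case (pCons a p)
    obtain C where C: "\<And>x. \<bar>x\<bar> ^ m * gaussian t x \<le> C" using gaussian_decay[OF assms] by blast
    obtain D where D: "\<And>x. \<bar>x\<bar> ^ Suc m * norm (poly p (of_real x) * complex_of_real (gaussian t x)) \<le> D"
      using pCons.IH[of "Suc m"] by blast
    have "\<bar>x\<bar> ^ m * norm (poly (pCons a p) (of_real x) * complex_of_real (gaussian t x)) \<le> norm a * C + D" for x
    proof -
      have g0: "gaussian t x \<ge> 0" by (simp add: gaussian_def)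
      have "norm (poly (pCons a p) (of_real x)) \<le> norm a + \<bar>x\<bar> * norm (poly p (of_real x))"
        by simp (metis norm_triangle_ineq norm_mult norm_of_real real_norm_def)
      hence "\<bar>x\<bar> ^ m * (norm (poly (pCons a p) (of_real x)) * gaussian t x) \<le> \<bar>x\<bar> ^ m * ((norm a + \<bar>x\<bar> * norm (poly p (of_real x))) * gaussian t x)"
        using g0 by (intro mult_left_mono mult_right_mono) auto
      also have "\<dots> = norm a * (\<bar>x\<bar> ^ m * gaussian t x) + \<bar>x\<bar> ^ Suc m * norm (poly p (of_real x) * complex_of_real (gaussian t x))"
        using g0 by (simp add: norm_mult algebra_simps)
      also have "\<dots> \<le> norm a * C + D"
        by (intro add_mono mult_left_mono C D) simp
      finally show ?thesis using g0 by (simp only: norm_mult norm_of_real abs_of_nonneg)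
    qed
    thus ?case by blast
  qed
qed

lemma gaussian_schwartz: "t > 0 \<Longrightarrow> (\<lambda>x. complex_of_real (gaussian t x)) \<in> schwartz_space"
  using gaussian_poly_schwartz[of t 1] by simp

section \<open>The odd difference quotient and the Dunkl operator\<close>

text \<open>The singular term of the Dunkl operator is the quotient \<open>(f(x) - f(-x)) / (2x)\<close>. Writing it as
  the average of \<open>f'(tx)\<close> over \<open>t \<in> [-1, 1]\<close> shows that it is smooth at the origin. Differentiating under the
  integral sign brings down powers of \<open>t\<close>, hence the moments.\<close>

definition moment_average :: "nat \<Rightarrow> (real \<Rightarrow> complex) \<Rightarrow> real \<Rightarrow> complex" where
  "moment_average n u x = integral {-1..1} (\<lambda>t. t ^ n *\<^sub>R u (t * x))"

lemma moment_average_deriv: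
  assumes u: "u \<in> schwartz_space"
  shows "(moment_average n u has_vector_derivative moment_average (Suc n) (vderiv u) x) (at x)"
proof -
  have cont: "continuous_on UNIV u" "continuous_on UNIV (vderiv u)"
    using u by (auto intro: schwartz_continuous_on schwartz_vderiv)
  have "((\<lambda>x. integral (cbox (-1) 1) (\<lambda>t. t ^ n *\<^sub>R u (t * x))) has_vector_derivative
           integral (cbox (-1) 1) (\<lambda>t. t ^ Suc n *\<^sub>R vderiv u (t * x))) (at x within UNIV)"
  proof (rule leibniz_rule_vector_derivative[where fx = "\<lambda>x t. t ^ Suc n *\<^sub>R vderiv u (t * x)"])
    fix x t :: real
    have "((u \<circ> (\<lambda>x. t * x)) has_vector_derivative t *\<^sub>R vderiv u (t * x)) (at x)"
      by (intro vector_diff_chain_at schwartz_derivative[OF u]) (auto intro!: derivative_eq_intros)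
    hence "((\<lambda>x. t ^ n *\<^sub>R u (t * x)) has_vector_derivative t ^ n *\<^sub>R (t *\<^sub>R vderiv u (t * x))) (at x)"
      by (intro bounded_linear.has_vector_derivative[OF bounded_linear_scaleR_right]) (simp add: o_def)
    thus "((\<lambda>x. t ^ n *\<^sub>R u (t * x)) has_vector_derivative t ^ Suc n *\<^sub>R vderiv u (t * x)) (at x within UNIV)"
      by (simp add: mult.commute)
  next
    fix x :: real
    show "(\<lambda>t. t ^ n *\<^sub>R u (t * x)) integrable_on cbox (- 1) 1"
      by (intro integrable_continuous continuous_intros continuous_on_compose2[OF cont(1)]) auto
  next
    show "continuous_on (UNIV \<times> cbox (- 1) 1) (\<lambda>(x, t). t ^ Suc n *\<^sub>R vderiv u (t * x))"
      unfolding split_beta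
      by (intro continuous_intros continuous_on_compose2[OF cont(2)]) auto
  qed auto
  thus ?thesis by (simp add: moment_average_def [abs_def])
qed

lemma moment_average_bounded:
  assumes u: "u \<in> schwartz_space"
  shows "\<exists>C. \<forall>x. norm (moment_average n u x) \<le> C"
proof -
  have cont: "continuous_on UNIV u" using u by (rule schwartz_continuous_on)
  obtain C where C: "\<And>x. norm (u x) \<le> C" using schwartz_bounded[OF u] by blast
  have C0: "C \<ge> 0" using order_trans[OF norm_ge_zero C[of 0]] .
  have "norm (moment_average n u x) \<le> C * (1 - (-1))" for x
    unfolding moment_average_def
  proof (rule integral_bound)
    show "continuous_on {-1..1} (\<lambda>t. t ^ n *\<^sub>R u (t * x))"
      by (intro continuous_intros continuous_on_compose2[OF cont]) auto
    fix t :: real assume "t \<in> {-1..1}"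
    hence "\<bar>t\<bar> ^ n \<le> 1" by (intro power_le_one) auto
    thus "norm (t ^ n *\<^sub>R u (t * x)) \<le> C"
      using mult_mono[OF _ C[of "t * x"], of "\<bar>t\<bar> ^ n" 1] by (simp add: power_abs)
  qed simp
  thus ?thesis by blast
qed

text \<open>Averages over \<open>[-1, 1]\<close> need not decay: the Schwartz property has to be imported from one
  product with a power of \<open>x\<close>. That hypothesis survives differentiation at the price of one more
  power, because \<open>x\<^sup>m\<^sup>+\<^sup>1 h' = x (x\<^sup>m h)' - m x\<^sup>m h\<close>.\<close>

lemma moment_average_schwartz:
  assumes "u \<in> schwartz_space" and "(\<lambda>x. of_real x ^ m * moment_average n u x) \<in> schwartz_space"
  shows "moment_average n u \<in> schwartz_space"
proof -
  let ?T = "\<lambda>p. moment_average (fst p) (snd p)"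
  let ?A = "{p. snd p \<in> schwartz_space \<and> (\<exists>m. (\<lambda>x. of_real x ^ m * ?T p x) \<in> schwartz_space)}"
  have "?T (n, u) \<in> schwartz_space"
  proof (rule schwartz_coinduct[where T = ?T and A = ?A])
    show "(n, u) \<in> ?A" using assms by auto
  next
    fix p assume "p \<in> ?A"
    then obtain m where u: "snd p \<in> schwartz_space"
      and m: "(\<lambda>x. of_real x ^ m * ?T p x) \<in> schwartz_space" by blast
    define h where "h = ?T p"
    define h' where "h' = ?T (Suc (fst p), vderiv (snd p))"
    note m = m[folded h_def]
    have D: "(h has_vector_derivative h' x) (at x)" for x
      unfolding h_def h'_def using moment_average_deriv[OF u] by simp
    have P: "((\<lambda>x. of_real x ^ m) has_vector_derivative complex_of_real (real m * x ^ (m - 1))) (at x)" for x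
    proof -
      have "((\<lambda>x. x ^ m) has_real_derivative real m * x ^ (m - 1)) (at x)"
        by (auto intro!: derivative_eq_intros)
      from has_vector_derivative_of_real[OF this]
      show ?thesis by simp
    qed
    have D2: "vderiv (\<lambda>x. of_real x ^ m * h x) x = of_real x ^ m * h' x + complex_of_real (real m * x ^ (m - 1)) * h x" for x
      by (intro vector_derivative_at has_vector_derivative_mult P D)
    have "of_real x ^ Suc m * h' x = of_real x * vderiv (\<lambda>x. of_real x ^ m * h x) x - of_nat m * (of_real x ^ m * h x)" for x
      unfolding D2 by (cases m) (simp_all add: algebra_simps)
    moreover have "(\<lambda>x. of_real x * vderiv (\<lambda>x. of_real x ^ m * h x) x - of_nat m * (of_real x ^ m * h x)) \<in> schwartz_space"
      by (intro schwartz_diff schwartz_mult_const schwartz_mult_x schwartz_vderiv m)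
    ultimately have "(\<lambda>x. of_real x ^ Suc m * h' x) \<in> schwartz_space" by simp
    hence "\<exists>m. (\<lambda>x. of_real x ^ m * ?T (Suc (fst p), vderiv (snd p)) x) \<in> schwartz_space"
      unfolding h'_def by blast
    hence "(Suc (fst p), vderiv (snd p)) \<in> ?A"
      using schwartz_vderiv[OF u] by simp
    moreover have "\<forall>x. (?T p has_vector_derivative ?T (Suc (fst p), vderiv (snd p)) x) (at x)"
      using D unfolding h_def h'_def by blast
    ultimately show "\<exists>q\<in>?A. \<forall>x. (?T p has_vector_derivative ?T q x) (at x)" by (rule bexI[rotated])
    fix j
    obtain B where B: "\<And>x. norm (h x) \<le> B" unfolding h_def using moment_average_bounded[OF u] by blast
    obtain C where C: "\<And>x. \<bar>x\<bar> ^ j * norm (of_real x ^ m * h x) \<le> C" using schwartz_decay[OF m] by blast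
    have "\<bar>x\<bar> ^ j * norm (h x) \<le> B + C" for x
    proof (cases "\<bar>x\<bar> \<le> 1")
      case True
      hence "\<bar>x\<bar> ^ j * norm (h x) \<le> 1 * B" by (intro mult_mono power_le_one B) auto
      moreover have "C \<ge> 0" using C[of x] by (smt (verit) norm_ge_zero mult_nonneg_nonneg zero_le_power abs_ge_zero)
      ultimately show ?thesis by simp
    next
      case False
      hence "1 * norm (h x) \<le> \<bar>x\<bar> ^ m * norm (h x)" by (intro mult_right_mono one_le_power) auto
      hence "\<bar>x\<bar> ^ j * norm (h x) \<le> \<bar>x\<bar> ^ j * norm (of_real x ^ m * h x)"
        by (intro mult_left_mono) (auto simp: norm_mult norm_power)
      moreover have "B \<ge> 0" using order_trans[OF norm_ge_zero B[of 0]] .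
      ultimately show ?thesis using C[of x] by simp
    qed
    thus "\<exists>C. \<forall>x. \<bar>x\<bar> ^ j * norm (?T p x) \<le> C" unfolding h_def by blast
  qed
  thus ?thesis by simp
qed

definition odd_quotient :: "(real \<Rightarrow> complex) \<Rightarrow> real \<Rightarrow> complex" where
  "odd_quotient f x = (if x = 0 then vderiv f 0 else (f x - f (- x)) / (2 * of_real x))"

lemma odd_quotient_eq_average:
  assumes f: "f \<in> schwartz_space"
  shows "odd_quotient f x = 1 / 2 * moment_average 0 (vderiv f) x"
proof (cases "x = 0")
  case True
  thus ?thesis by (simp add: odd_quotient_def moment_average_def scaleR_conv_of_real)
next
  case False
  have "((\<lambda>t. x *\<^sub>R vderiv f (t * x)) has_integral (f (1 * x) - f ((-1) * x))) {-1..1}"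
  proof (rule fundamental_theorem_of_calculus)
    fix t :: real
    have "((f \<circ> (\<lambda>t. t * x)) has_vector_derivative x *\<^sub>R vderiv f (t * x)) (at t)"
      by (intro vector_diff_chain_at schwartz_derivative[OF f]) (auto intro!: derivative_eq_intros)
    thus "((\<lambda>t. f (t * x)) has_vector_derivative x *\<^sub>R vderiv f (t * x)) (at t within {-1..1})"
      by (simp add: o_def has_vector_derivative_at_within)
  qed simp
  hence "integral {-1..1} (\<lambda>t. x *\<^sub>R vderiv f (t * x)) = f x - f (- x)"
    by (rule integral_unique[THEN trans]) simp
  hence "x *\<^sub>R moment_average 0 (vderiv f) x = f x - f (- x)"
    by (simp add: moment_average_def)
  hence "f x - f (- x) = of_real x * moment_average 0 (vderiv f) x"
    by (simp add: scaleR_conv_of_real)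
  thus ?thesis using False by (simp add: odd_quotient_def)
qed

lemma odd_quotient_schwartz:
  assumes f: "f \<in> schwartz_space"
  shows "odd_quotient f \<in> schwartz_space"
proof -
  have "(\<lambda>x. of_real x * moment_average 0 (vderiv f) x) = (\<lambda>x. f x - f (- x))"
    by (rule ext, subst odd_quotient_eq_average[OF f, symmetric, THEN arg_cong[where f = "\<lambda>z. 2 * z"], simplified])
       (auto simp: odd_quotient_def)
  moreover have "(\<lambda>x. f x - f (- x)) \<in> schwartz_space"
    by (intro schwartz_diff schwartz_reflect f)
  ultimately have "(\<lambda>x. of_real x ^ 1 * moment_average 0 (vderiv f) x) \<in> schwartz_space" by simp
  hence "moment_average 0 (vderiv f) \<in> schwartz_space"
    by (intro moment_average_schwartz schwartz_vderiv f)
  from schwartz_mult_const[OF this, of "1 / 2"] show ?thesis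
    by (simp add: odd_quotient_eq_average[OF f, abs_def])
qed

text \<open>On Schwartz functions the case distinction at the origin disappears: the limit there is the value
  of the smooth function on the right.\<close>

lemma dunkl_op_eq:
  assumes f: "f \<in> schwartz_space"
  shows "dunkl_op k f x = vderiv f x + of_real (2 * k + 1) * odd_quotient f x"
proof (cases "x = 0")
  case False
  thus ?thesis by (simp add: dunkl_op_def dunkl_quotient_def odd_quotient_def)
next
  case True
  have "continuous_on UNIV (\<lambda>x. vderiv f x + of_real (2 * k + 1) * odd_quotient f x)"
    by (intro continuous_intros schwartz_continuous_on schwartz_vderiv odd_quotient_schwartz f)
  hence "((\<lambda>x. vderiv f x + of_real (2 * k + 1) * odd_quotient f x) \<longlongrightarrow>
           vderiv f 0 + of_real (2 * k + 1) * odd_quotient f 0) (at 0)"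
    by (simp add: continuous_on_eq_continuous_at isCont_def)
  hence "(dunkl_quotient k f \<longlongrightarrow> vderiv f 0 + of_real (2 * k + 1) * odd_quotient f 0) (at 0)"
    by (rule Lim_transform_eventually)
       (auto simp: eventually_at_filter dunkl_quotient_def odd_quotient_def)
  thus ?thesis using True by (simp add: dunkl_op_def tendsto_Lim)
qed

lemma dunkl_op_schwartz:
  assumes f: "f \<in> schwartz_space"
  shows "dunkl_op k f \<in> schwartz_space"
  unfolding dunkl_op_eq[OF f, abs_def]
  by (intro schwartz_add schwartz_mult_const schwartz_vderiv odd_quotient_schwartz f)

section \<open>The Dunkl exponential\<close>

text \<open>The normalised Bessel function is an entire function of \<open>x\<^sup>2\<close>; working with the series in the
  variable \<open>s = x\<^sup>2\<close> makes differentiation a shift of \<open>\<alpha>\<close>.\<close>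

definition bessel_coeff :: "real \<Rightarrow> nat \<Rightarrow> real" where
  "bessel_coeff \<alpha> n = (- 1 / 4) ^ n / (fact n * pochhammer (\<alpha> + 1) n)"

definition bessel_series :: "real \<Rightarrow> real \<Rightarrow> real" where
  "bessel_series \<alpha> s = (\<Sum>n. bessel_coeff \<alpha> n * s ^ n)"

lemma pochhammer_half_le:
  assumes "a \<ge> 1 / (2::real)"
  shows "(1 / 2) ^ n \<le> pochhammer a n"
proof (induction n)
  case (Suc n)
  have "(1 / 2) ^ n * (1 / 2) \<le> pochhammer a n * (a + real n)"
    using assms Suc by (intro mult_mono) (auto intro!: pochhammer_nonneg)
  thus ?case by (simp add: pochhammer_Suc mult.commute)
qed simp

lemma bessel_coeff_summable:
  assumes "\<alpha> \<ge> - 1 / 2"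
  shows "summable (\<lambda>n. bessel_coeff \<alpha> n * s ^ n)"
proof (rule summable_comparison_test')
  show "summable (\<lambda>n. \<bar>s\<bar> ^ n / fact n)"
    using summable_exp[of "\<bar>s\<bar>"] by (simp add: divide_inverse mult.commute)
  fix n
  have p: "(1 / 2) ^ n \<le> pochhammer (\<alpha> + 1) n" using assms by (intro pochhammer_half_le) auto
  hence "0 < pochhammer (\<alpha> + 1) n" by (smt (verit) zero_less_power divide_pos_pos)
  moreover have "(1 / 4) ^ n \<le> (1 / 2 :: real) ^ n" by (intro power_mono) auto
  ultimately have "(1 / 4) ^ n / pochhammer (\<alpha> + 1) n \<le> 1" using p by simp
  hence "\<bar>s\<bar> ^ n / fact n * ((1 / 4) ^ n / pochhammer (\<alpha> + 1) n) \<le> \<bar>s\<bar> ^ n / fact n * 1"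
    by (intro mult_left_mono) auto
  moreover have "norm (bessel_coeff \<alpha> n * s ^ n) = \<bar>s\<bar> ^ n / fact n * ((1 / 4) ^ n / pochhammer (\<alpha> + 1) n)"
    using \<open>0 < pochhammer (\<alpha> + 1) n\<close>
    by (simp add: bessel_coeff_def abs_mult power_abs abs_divide)
  ultimately show "norm (bessel_coeff \<alpha> n * s ^ n) \<le> \<bar>s\<bar> ^ n / fact n" by simp
qed

lemma bessel_j_eq_series:
  assumes "\<alpha> \<ge> - 1 / 2"
  shows "bessel_j \<alpha> x = bessel_series \<alpha> (x\<^sup>2)"
proof -
  have G: "Gamma (\<alpha> + 1) > 0" using assms by (intro Gamma_real_pos) auto
  have "Gamma (\<alpha> + 1) * ((-1) ^ n * (x / 2) ^ (2 * n) / (fact n * Gamma (real n + \<alpha> + 1)))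
          = bessel_coeff \<alpha> n * (x\<^sup>2) ^ n" for n
  proof -
    have "\<alpha> + 1 \<notin> \<int>\<^sub>\<le>\<^sub>0" using assms by (auto elim!: nonpos_Ints_cases)
    hence "pochhammer (\<alpha> + 1) n = Gamma (\<alpha> + 1 + real n) / Gamma (\<alpha> + 1)"
      by (rule pochhammer_Gamma)
    moreover have "(x / 2) ^ (2 * n) = (1 / 4) ^ n * (x\<^sup>2) ^ n"
      by (simp add: power_mult power_divide)
    moreover have "(-1::real) ^ n * (1 / 4) ^ n = (- 1 / 4) ^ n"
      by (simp flip: power_mult_distrib)
    ultimately show ?thesis using G by (simp add: bessel_coeff_def add_ac)
  qed
  moreover have "bessel_j \<alpha> x = (\<Sum>n. Gamma (\<alpha> + 1) * ((-1) ^ n * (x / 2) ^ (2 * n) / (fact n * Gamma (real n + \<alpha> + 1))))"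
  proof -
    have "summable (\<lambda>n. Gamma (\<alpha> + 1) * ((-1) ^ n * (x / 2) ^ (2 * n) / (fact n * Gamma (real n + \<alpha> + 1))))"
      unfolding calculation by (rule bessel_coeff_summable[OF assms])
    hence "summable (\<lambda>n. (-1) ^ n * (x / 2) ^ (2 * n) / (fact n * Gamma (real n + \<alpha> + 1)))"
      using G by (subst (asm) summable_cmult_iff) auto
    thus ?thesis unfolding bessel_j_def by (rule suminf_mult[symmetric])
  qed
  ultimately show ?thesis by (simp add: bessel_series_def)
qed

lemma diffs_bessel_coeff:
  "diffs (bessel_coeff \<alpha>) n = - 1 / (4 * (\<alpha> + 1)) * bessel_coeff (\<alpha> + 1) n"
  by (simp add: diffs_def bessel_coeff_def pochhammer_rec fact_Suc add_ac del: of_nat_Suc)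

lemma bessel_series_deriv:
  assumes "\<alpha> \<ge> - 1 / 2"
  shows "(bessel_series \<alpha> has_real_derivative - 1 / (4 * (\<alpha> + 1)) * bessel_series (\<alpha> + 1) s) (at s)"
proof -
  have "(bessel_series \<alpha> has_real_derivative (\<Sum>n. diffs (bessel_coeff \<alpha>) n * s ^ n)) (at s)"
    unfolding bessel_series_def
    by (rule termdiffs_strong_converges_everywhere) (rule bessel_coeff_summable[OF assms])
  moreover have "(\<Sum>n. diffs (bessel_coeff \<alpha>) n * s ^ n) = - 1 / (4 * (\<alpha> + 1)) * bessel_series (\<alpha> + 1) s"
    unfolding diffs_bessel_coeff bessel_series_def mult.assoc
    using assms by (intro suminf_mult bessel_coeff_summable) auto
  ultimately show ?thesis by simp
qed

text \<open>Comparison of coefficients in \<open>s \<phi>' = (\<alpha> + 1) (\<phi>\<^sub>\<alpha> - \<phi>)\<close>, where \<open>\<phi>\<close> is the series for \<open>\<alpha> + 1\<close> and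
  \<open>\<phi>\<^sub>\<alpha>\<close> the one for \<open>\<alpha>\<close>. Together with the derivative formula this is Bessel's differential equation.\<close>

lemma bessel_series_recurrence:
  assumes "\<alpha> \<ge> - 1 / 2"
  shows "s * bessel_series (\<alpha> + 2) s = 4 * (\<alpha> + 1) * (\<alpha> + 2) * (bessel_series (\<alpha> + 1) s - bessel_series \<alpha> s)"
proof -
  let ?b = "bessel_coeff (\<alpha> + 1)"
  have "summable (\<lambda>n. diffs ?b n * s ^ n)"
    unfolding diffs_bessel_coeff mult.assoc using assms by (intro summable_mult bessel_coeff_summable) auto
  hence "(\<lambda>n. real n * ?b n * s ^ n) sums (s * (\<Sum>n. diffs ?b n * s ^ n))"
  proof -
    have "s * (real n * ?b n * s ^ (n - Suc 0)) = real n * ?b n * s ^ n" for n by (cases n) auto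
    thus ?thesis using sums_mult[OF diffs_equiv[OF \<open>summable (\<lambda>n. diffs ?b n * s ^ n)\<close>], of s] by (simp only:)
  qed
  moreover have "(\<Sum>n. diffs ?b n * s ^ n) = - 1 / (4 * (\<alpha> + 2)) * bessel_series (\<alpha> + 2) s"
    unfolding diffs_bessel_coeff bessel_series_def mult.assoc
    using assms by (subst suminf_mult[symmetric]) (auto intro: bessel_coeff_summable simp: add_ac)
  ultimately have 1: "(\<lambda>n. real n * ?b n * s ^ n) sums (s * (- 1 / (4 * (\<alpha> + 2)) * bessel_series (\<alpha> + 2) s))" by simp
  have "(\<lambda>n. bessel_coeff \<alpha> n * s ^ n) sums bessel_series \<alpha> s" "(\<lambda>n. ?b n * s ^ n) sums bessel_series (\<alpha> + 1) s"
    unfolding bessel_series_def using assms by (auto intro!: summable_sums bessel_coeff_summable)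
  from sums_mult[OF sums_diff[OF this], of "\<alpha> + 1"]
  have 2: "(\<lambda>n. (\<alpha> + 1) * (bessel_coeff \<alpha> n * s ^ n - ?b n * s ^ n)) sums ((\<alpha> + 1) * (bessel_series \<alpha> s - bessel_series (\<alpha> + 1) s))" .
  have eq: "real n * ?b n * s ^ n = (\<alpha> + 1) * (bessel_coeff \<alpha> n * s ^ n - ?b n * s ^ n)" for n
  proof -
    have 0: "(\<alpha> + 1) * pochhammer (\<alpha> + 2) n = pochhammer (\<alpha> + 1) n * (\<alpha> + 1 + real n)"
      using pochhammer_rec[of "\<alpha> + 1" n] pochhammer_Suc[of "\<alpha> + 1" n] by (simp add: add_ac)
    have nz: "pochhammer (\<alpha> + 1) n > 0" "pochhammer (\<alpha> + 2) n > 0"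
      using assms by (auto intro!: pochhammer_pos)
    have "(\<alpha> + 1) * bessel_coeff \<alpha> n = (\<alpha> + 1 + real n) * ?b n"
      using nz 0 unfolding bessel_coeff_def by (simp add: frac_eq_eq add_ac)
    hence "real n * ?b n = (\<alpha> + 1) * (bessel_coeff \<alpha> n - ?b n)" by (simp add: algebra_simps)
    thus ?thesis by (simp add: left_diff_distrib mult.assoc)
  qed
  have "s * (- 1 / (4 * (\<alpha> + 2)) * bessel_series (\<alpha> + 2) s) = (\<alpha> + 1) * (bessel_series \<alpha> s - bessel_series (\<alpha> + 1) s)"
    using 1 2 unfolding eq by (rule sums_unique2)
  thus ?thesis using assms by (simp add: field_simps)
qed

lemma bessel_j_deriv:
  assumes "\<alpha> \<ge> - 1 / 2"
  shows "(bessel_j \<alpha> has_real_derivative - (x / (2 * (\<alpha> + 1)) * bessel_j (\<alpha> + 1) x)) (at x)"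
proof -
  have "((\<lambda>x. bessel_series \<alpha> (x\<^sup>2)) has_real_derivative - 1 / (4 * (\<alpha> + 1)) * bessel_series (\<alpha> + 1) (x\<^sup>2) * (2 * x)) (at x)"
    by (rule DERIV_chain2[OF bessel_series_deriv[OF assms]]) (auto intro!: derivative_eq_intros)
  moreover have "bessel_j \<alpha> = (\<lambda>x. bessel_series \<alpha> (x\<^sup>2))" using bessel_j_eq_series[OF assms] by auto
  moreover have "- 1 / (4 * (\<alpha> + 1)) * bessel_series (\<alpha> + 1) (x\<^sup>2) * (2 * x) = - (x / (2 * (\<alpha> + 1)) * bessel_j (\<alpha> + 1) x)"
    using assms by (simp add: bessel_j_eq_series) (simp add: field_simps)
  ultimately show ?thesis by simp
qed

lemma bessel_j_recurrence:
  assumes "\<alpha> \<ge> - 1 / 2"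
  shows "x\<^sup>2 * bessel_j (\<alpha> + 2) x = 4 * (\<alpha> + 1) * (\<alpha> + 2) * (bessel_j (\<alpha> + 1) x - bessel_j \<alpha> x)"
  using bessel_series_recurrence[OF assms, of "x\<^sup>2"] assms by (simp add: bessel_j_eq_series)

lemma bessel_j_minus [simp]: "bessel_j \<alpha> (- x) = bessel_j \<alpha> x"
  by (simp add: bessel_j_def power_mult)

lemma bessel_j_0: "\<alpha> \<ge> - 1 / 2 \<Longrightarrow> bessel_j \<alpha> 0 = 1"
  using bessel_j_eq_series[of \<alpha> 0] powser_zero[of "bessel_coeff \<alpha>"]
  by (simp add: bessel_series_def) (simp add: bessel_coeff_def)

text \<open>The Dunkl kernel depends on the product of its arguments only. As a function of that product it
  plays the role of \<open>exp(i z)\<close>, and equals it for \<open>k = -1/2\<close>; its imaginary part is the negative of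
  the derivative of its real part.\<close>

definition dunkl_exp :: "real \<Rightarrow> real \<Rightarrow> complex" where
  "dunkl_exp k z = of_real (bessel_j k z) + \<i> * of_real (z / (2 * (k + 1)) * bessel_j (k + 1) z)"

text \<open>The derivative of \<open>dunkl_exp\<close>, in a form without the removable singularity at \<open>0\<close>.\<close>

definition dunkl_exp' :: "real \<Rightarrow> real \<Rightarrow> complex" where
  "dunkl_exp' k z = \<i> * dunkl_exp k z - \<i> * of_real ((2 * k + 1) / (2 * (k + 1)) * bessel_j (k + 1) z)"

lemma dunkl_kernel_eq: "dunkl_kernel k l x = dunkl_exp k (l * x)"
  by (simp add: dunkl_kernel_def dunkl_exp_def)

lemma bessel_sin_deriv:
  assumes "k \<ge> - 1 / 2"
  shows "((\<lambda>z. z / (2 * (k + 1)) * bessel_j (k + 1) z) has_real_derivative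
            bessel_j k z - (2 * k + 1) / (2 * (k + 1)) * bessel_j (k + 1) z) (at z)"
proof -
  have j: "(bessel_j (k + 1) has_real_derivative - (z / (2 * (k + 1 + 1)) * bessel_j (k + 1 + 1) z)) (at z)"
    using assms by (intro bessel_j_deriv) auto
  have "((\<lambda>z. z / (2 * (k + 1))) has_real_derivative 1 / (2 * (k + 1))) (at z)"
    using assms by (auto intro!: derivative_eq_intros)
  from DERIV_mult[OF this j]
  have "((\<lambda>z. z / (2 * (k + 1)) * bessel_j (k + 1) z) has_real_derivative
          (1 / (2 * (k + 1)) * bessel_j (k + 1) z - z / (2 * (k + 1)) * (z / (2 * (k + 1 + 1)) * bessel_j (k + 1 + 1) z))) (at z)"
    by (rule DERIV_cong) (simp only: diff_conv_add_uminus mult_minus_left mult.commute[of _ "z / (2 * (k + 1))"])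
  moreover have "1 / (2 * (k + 1)) * bessel_j (k + 1) z - z / (2 * (k + 1)) * (z / (2 * (k + 1 + 1)) * bessel_j (k + 1 + 1) z)
      = 1 / (2 * (k + 1)) * bessel_j (k + 1) z - (z\<^sup>2 * bessel_j (k + 2) z) / (4 * (k + 1) * (k + 2))"
  proof -
    have e1: "4 * (k + 1) * (k + 2) = (2 * (k + 1)) * (2 * (k + 1 + 1))" by (simp add: algebra_simps)
    have e2: "k + 2 = k + 1 + 1" by simp
    have "1 / A * j - z / A * (z / B * j') = 1 / A * j - (z\<^sup>2 * j') / (A * B)" for A B j j' :: real
      by (simp add: power2_eq_square)
    thus ?thesis unfolding e1 unfolding e2 .
  qed
  moreover have "\<dots> = bessel_j k z - (2 * k + 1) / (2 * (k + 1)) * bessel_j (k + 1) z"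
    unfolding bessel_j_recurrence[OF assms] using assms by (simp add: divide_simps) (simp add: algebra_simps)
  ultimately show ?thesis by simp
qed

lemma dunkl_exp_deriv:
  assumes "k \<ge> - 1 / 2"
  shows "(dunkl_exp k has_vector_derivative dunkl_exp' k z) (at z)"
proof -
  have "((\<lambda>z. of_real (bessel_j k z) + \<i> * of_real (z / (2 * (k + 1)) * bessel_j (k + 1) z)) has_vector_derivative
     of_real (- (z / (2 * (k + 1)) * bessel_j (k + 1) z)) + \<i> * of_real (bessel_j k z - (2 * k + 1) / (2 * (k + 1)) * bessel_j (k + 1) z)) (at z)"
    by (intro has_vector_derivative_add has_vector_derivative_mult_right has_vector_derivative_of_real bessel_j_deriv bessel_sin_deriv assms)
  thus ?thesis unfolding dunkl_exp'_def dunkl_exp_def [abs_def]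
    by (rule has_vector_derivative_eq_rhs) (simp add: algebra_simps)
qed

text \<open>An energy argument: with \<open>w = - j'\<close>, Bessel's equation gives
  \<open>(j\<^sup>2 + w\<^sup>2)' = - 2 (2k + 1) w\<^sup>2 / z\<close>, which is not positive for \<open>z > 0\<close> because \<open>k \<ge> - 1/2\<close>. So the
  squared modulus never exceeds its value \<open>1\<close> at the origin.\<close>

lemma dunkl_exp_norm_le:
  assumes k: "k \<ge> - 1 / 2"
  shows "norm (dunkl_exp k z) \<le> 1"
proof -
  define w where "w = (\<lambda>z. z / (2 * (k + 1)) * bessel_j (k + 1) z)"
  define V where "V = (\<lambda>z. (bessel_j k z)\<^sup>2 + (w z)\<^sup>2)"
  have V': "(V has_real_derivative - (2 * (2 * k + 1) * z / (2 * (k + 1))\<^sup>2 * (bessel_j (k + 1) z)\<^sup>2)) (at z)" for z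
  proof -
    have "(V has_real_derivative 2 * bessel_j k z * - (z / (2 * (k + 1)) * bessel_j (k + 1) z)
            + 2 * w z * (bessel_j k z - (2 * k + 1) / (2 * (k + 1)) * bessel_j (k + 1) z)) (at z)"
      unfolding V_def using bessel_sin_deriv[OF k, of z, folded w_def]
      by (auto intro!: derivative_eq_intros bessel_j_deriv[OF k])
    moreover have "2 * bessel_j k z * - (z / (2 * (k + 1)) * bessel_j (k + 1) z)
            + 2 * w z * (bessel_j k z - (2 * k + 1) / (2 * (k + 1)) * bessel_j (k + 1) z)
            = - (2 * (2 * k + 1) * z / (2 * (k + 1))\<^sup>2 * (bessel_j (k + 1) z)\<^sup>2)"
      unfolding w_def by (simp add: algebra_simps power2_eq_square diff_divide_distrib add_divide_distrib)
    ultimately show ?thesis by simp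
  qed
  have le: "V x \<le> 1" if "x \<ge> 0" for x
  proof -
    have "V x \<le> V 0"
      by (rule DERIV_nonpos_imp_nonincreasing[OF that]) (use V' k in \<open>force intro!: mult_nonneg_nonneg divide_nonneg_nonneg\<close>)
    thus ?thesis using k by (simp add: V_def w_def bessel_j_0)
  qed
  have "V (- z) = V z" by (simp add: V_def w_def)
  hence "V z \<le> 1" using le[of z] le[of "- z"] by (cases "z \<ge> 0") auto
  moreover have "(norm (dunkl_exp k z))\<^sup>2 = V z"
    by (simp add: cmod_power2 dunkl_exp_def V_def w_def)
  ultimately have "(norm (dunkl_exp k z))\<^sup>2 \<le> 1\<^sup>2" by simp
  thus ?thesis by (rule power2_le_imp_le) simp
qed

lemma bessel_j_abs_le:
  assumes "k \<ge> - 1 / 2"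
  shows "\<bar>bessel_j k z\<bar> \<le> 1"
proof -
  have "\<bar>Re (dunkl_exp k z)\<bar> \<le> 1" using abs_Re_le_cmod dunkl_exp_norm_le[OF assms] by (rule order_trans)
  thus ?thesis by (simp add: dunkl_exp_def)
qed

lemma dunkl_exp'_norm_le:
  assumes k: "k \<ge> - 1 / 2"
  shows "norm (dunkl_exp' k z) \<le> 2"
proof -
  have "norm (dunkl_exp' k z) \<le> norm (\<i> * dunkl_exp k z) + norm (\<i> * complex_of_real ((2 * k + 1) / (2 * (k + 1)) * bessel_j (k + 1) z))"
    unfolding dunkl_exp'_def by (rule norm_triangle_ineq4)
  also have "norm (\<i> * complex_of_real ((2 * k + 1) / (2 * (k + 1)) * bessel_j (k + 1) z)) = \<bar>(2 * k + 1) / (2 * (k + 1))\<bar> * \<bar>bessel_j (k + 1) z\<bar>"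
    by (simp only: norm_mult norm_of_real abs_mult norm_ii mult_1)
  also have "\<dots> \<le> 1 * 1" using k by (intro mult_mono bessel_j_abs_le) auto
  also have "norm (\<i> * dunkl_exp k z) \<le> 1" using dunkl_exp_norm_le[OF k] by (simp add: norm_mult)
  finally show ?thesis by simp
qed

text \<open>The eigenvalue equation: the Dunkl operator maps \<open>e\<close> to \<open>i e\<close>.\<close>

lemma dunkl_exp'_eq:
  assumes "z \<noteq> 0"
  shows "dunkl_exp' k z = \<i> * dunkl_exp k z - of_real ((2 * k + 1) / z) * ((dunkl_exp k z - dunkl_exp k (- z)) / 2)"
  using assms by (simp add: dunkl_exp'_def) (simp add: dunkl_exp_def)

lemma cnj_dunkl_exp: "cnj (dunkl_exp k z) = dunkl_exp k (- z)"
  by (simp add: dunkl_exp_def)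

lemma dunkl_exp_0: "k \<ge> - 1 / 2 \<Longrightarrow> dunkl_exp k 0 = 1"
  by (simp add: dunkl_exp_def bessel_j_0)

lemma continuous_on_dunkl_exp [continuous_intros]:
  assumes "k \<ge> - 1 / 2" "continuous_on A f"
  shows "continuous_on A (\<lambda>x. dunkl_exp k (f x))"
proof (rule continuous_on_compose2[OF _ assms(2)])
  show "continuous_on UNIV (dunkl_exp k)"
    by (meson dunkl_exp_deriv[OF assms(1)] has_vector_derivative_continuous continuous_at_imp_continuous_on)
qed auto

lemma dunkl_exp_measurable [measurable (raw)]:
  assumes "k \<ge> - 1 / 2" "f \<in> borel_measurable M"
  shows "(\<lambda>x. dunkl_exp k (f x)) \<in> borel_measurable M"
proof -
  have "dunkl_exp k \<in> borel_measurable borel"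
    using continuous_on_dunkl_exp[OF assms(1) continuous_on_id] by (rule borel_measurable_continuous_onI)
  with assms(2) show ?thesis by measurable
qed

section \<open>The weighted measure\<close>

definition dunkl_density :: "real \<Rightarrow> real \<Rightarrow> real" where
  "dunkl_density k x = \<bar>x\<bar> powr (2 * k + 1) / (2 powr (k + 1) * Gamma (k + 1))"

lemma dunkl_density_measurable [measurable]: "dunkl_density k \<in> borel_measurable borel"
  unfolding dunkl_density_def [abs_def] by measurable

lemma dunkl_density_nonneg: "k \<ge> - 1 / 2 \<Longrightarrow> 0 \<le> dunkl_density k x"
  unfolding dunkl_density_def by (intro divide_nonneg_nonneg mult_nonneg_nonneg powr_ge_zero less_imp_le[OF Gamma_real_pos]) auto

lemma dunkl_density_pos: "k \<ge> - 1 / 2 \<Longrightarrow> x \<noteq> 0 \<Longrightarrow> 0 < dunkl_density k x"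
  unfolding dunkl_density_def by (intro divide_pos_pos mult_pos_pos Gamma_real_pos) auto

lemma dunkl_density_minus [simp]: "dunkl_density k (- x) = dunkl_density k x"
  by (simp add: dunkl_density_def)

lemma dunkl_measure_eq: "dunkl_measure k = density lborel (\<lambda>x. ennreal (dunkl_density k x))"
  by (simp add: dunkl_measure_def dunkl_density_def)

lemma sets_dunkl_measure [measurable_cong, simp]: "sets (dunkl_measure k) = sets borel"
  by (simp add: dunkl_measure_def)

lemma space_dunkl_measure [simp]: "space (dunkl_measure k) = UNIV"
  by (simp add: dunkl_measure_def)

lemma sigma_finite_dunkl_measure: "sigma_finite_measure (dunkl_measure k)"
  unfolding dunkl_measure_eq by (subst sigma_finite_measure.sigma_finite_iff_density_finite[OF sigma_finite_lborel]) auto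

lemma integral_dunkl_measure:
  fixes f :: "real \<Rightarrow> 'a :: {banach, second_countable_topology}"
  assumes "k \<ge> - 1 / 2" and [measurable]: "f \<in> borel_measurable borel"
  shows "(LINT x|dunkl_measure k. f x) = (LINT x|lborel. dunkl_density k x *\<^sub>R f x)"
  unfolding dunkl_measure_eq using dunkl_density_nonneg[OF assms(1)] by (subst integral_density) auto

lemma integrable_dunkl_measure:
  fixes f :: "real \<Rightarrow> 'a :: {banach, second_countable_topology}"
  assumes "k \<ge> - 1 / 2" and [measurable]: "f \<in> borel_measurable borel"
  shows "integrable (dunkl_measure k) f \<longleftrightarrow> integrable lborel (\<lambda>x. dunkl_density k x *\<^sub>R f x)"
  unfolding dunkl_measure_eq using dunkl_density_nonneg[OF assms(1)] by (subst integrable_density) auto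

lemma integral_dunkl_reflect:
  fixes f :: "real \<Rightarrow> 'a :: {banach, second_countable_topology}"
  assumes "k \<ge> - 1 / 2" and [measurable]: "f \<in> borel_measurable borel"
  shows "(LINT x|dunkl_measure k. f (- x)) = (LINT x|dunkl_measure k. f x)"
  using lborel_integral_real_affine[of "-1" "\<lambda>x. dunkl_density k x *\<^sub>R f x" 0]
  by (simp add: integral_dunkl_measure[OF assms(1)])

lemma integrable_dunkl_reflect:
  fixes f :: "real \<Rightarrow> 'a :: {banach, second_countable_topology}"
  assumes "k \<ge> - 1 / 2" and [measurable]: "f \<in> borel_measurable borel"
  shows "integrable (dunkl_measure k) (\<lambda>x. f (- x)) \<longleftrightarrow> integrable (dunkl_measure k) f"
  using lborel_integrable_real_affine_iff[of "-1" "\<lambda>x. dunkl_density k x *\<^sub>R f x" 0]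
  by (simp add: integrable_dunkl_measure[OF assms(1)])

text \<open>The density grows like \<open>\<bar>x\<bar>\<^sup>2\<^sup>k\<^sup>+\<^sup>1\<close>, so this power of \<open>1 + x\<^sup>2\<close> makes up for the density and leaves a
  factor \<open>1 / (1 + x\<^sup>2)\<close>.\<close>

definition decay_order :: "real \<Rightarrow> nat" where
  "decay_order k = nat \<lceil>k\<rceil> + 2"

lemma density_le_decay:
  fixes k x :: real
  assumes k: "k \<ge> - 1 / 2"
  shows "\<bar>x\<bar> powr (2 * k + 1) \<le> (1 + x\<^sup>2) ^ (nat \<lceil>k\<rceil> + 1)"
proof (cases "\<bar>x\<bar> \<le> 1")
  case True
  have "\<bar>x\<bar> powr (2 * k + 1) \<le> 1 powr (2 * k + 1)" using True k by (intro powr_mono2) auto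
  also have "\<dots> \<le> (1 + x\<^sup>2) ^ (nat \<lceil>k\<rceil> + 1)" by (simp del: power_Suc add: one_le_power)
  finally show ?thesis .
next
  case False
  have "k \<le> real (nat \<lceil>k\<rceil>)" by linarith
  hence "\<bar>x\<bar> powr (2 * k + 1) \<le> \<bar>x\<bar> powr (real (2 * (nat \<lceil>k\<rceil> + 1)))"
    using False by (intro powr_mono) auto
  also have "\<dots> = (x\<^sup>2) ^ (nat \<lceil>k\<rceil> + 1)"
  proof -
    have "\<bar>x\<bar> > 0" using False by linarith
    thus ?thesis by (simp only: powr_realpow power_mult power2_abs)
  qed
  also have "\<dots> \<le> (1 + x\<^sup>2) ^ (nat \<lceil>k\<rceil> + 1)" by (intro power_mono) auto
  finally show ?thesis .
qed

lemma integrable_decay: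
  assumes k: "k \<ge> - 1 / 2"
  shows "integrable (dunkl_measure k) (\<lambda>x. inverse ((1 + x\<^sup>2) ^ decay_order k))"
proof -
  define K where "K = 2 powr (k + 1) * Gamma (k + 1)"
  have K: "K > 0" using k unfolding K_def by (intro mult_pos_pos Gamma_real_pos) auto
  have 1: "integrable lborel (\<lambda>x::real. inverse (1 + x\<^sup>2))"
    using integrable_inverse_1_plus_square by (simp add: set_integrable_def)
  have "integrable lborel (\<lambda>x. dunkl_density k x *\<^sub>R inverse ((1 + x\<^sup>2) ^ decay_order k))"
  proof (rule Bochner_Integration.integrable_bound[OF integrable_mult_right[OF 1, of "1 / K"]])
    show "AE x in lborel. norm (dunkl_density k x *\<^sub>R inverse ((1 + x\<^sup>2) ^ decay_order k)) \<le> norm (1 / K * inverse (1 + x\<^sup>2))"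
    proof (rule AE_I2)
      fix x :: real
      note p = density_le_decay[OF k, of x]
      have pos: "(1 + x\<^sup>2) > 0" by (simp add: add_pos_nonneg)
      have "\<bar>x\<bar> powr (2 * k + 1) * inverse ((1 + x\<^sup>2) ^ decay_order k) \<le> inverse (1 + x\<^sup>2)"
        using p pos by (simp add: decay_order_def divide_simps)
      hence "1 / K * (\<bar>x\<bar> powr (2 * k + 1) * inverse ((1 + x\<^sup>2) ^ decay_order k)) \<le> 1 / K * inverse (1 + x\<^sup>2)"
        using K by (intro mult_left_mono) auto
      moreover have "0 \<le> dunkl_density k x" by (rule dunkl_density_nonneg[OF k])
      ultimately show "norm (dunkl_density k x *\<^sub>R inverse ((1 + x\<^sup>2) ^ decay_order k)) \<le> norm (1 / K * inverse (1 + x\<^sup>2))"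
        using pos K by (simp add: dunkl_density_def K_def[symmetric] abs_mult)
    qed
  qed measurable
  thus ?thesis by (subst integrable_dunkl_measure[OF k]) auto
qed

lemma integrable_of_decay:
  fixes f :: "real \<Rightarrow> 'a :: {banach, second_countable_topology}"
  assumes k: "k \<ge> - 1 / 2" and m: "f \<in> borel_measurable borel"
    and le: "\<And>x. (1 + x\<^sup>2) ^ decay_order k * norm (f x) \<le> C"
  shows "integrable (dunkl_measure k) f"
proof (rule Bochner_Integration.integrable_bound[OF integrable_mult_right[OF integrable_decay[OF k], of C]])
  show "f \<in> borel_measurable (dunkl_measure k)" using m by simp
  show "AE x in dunkl_measure k. norm (f x) \<le> norm (C * inverse ((1 + x\<^sup>2) ^ decay_order k))"
  proof (rule AE_I2)
    fix x :: real
    have "(1 + x\<^sup>2) ^ decay_order k > 0" by (simp add: add_pos_nonneg)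
    hence "norm (f x) \<le> C * inverse ((1 + x\<^sup>2) ^ decay_order k)" using le[of x] by (simp add: field_simps)
    thus "norm (f x) \<le> norm (C * inverse ((1 + x\<^sup>2) ^ decay_order k))" by simp
  qed
qed

lemma schwartz_mult_decay:
  assumes "f \<in> schwartz_space"
  shows "(\<lambda>x. of_real ((1 + x\<^sup>2) ^ n) * f x) \<in> schwartz_space"
proof (induction n)
  case (Suc n)
  have "(\<lambda>x. of_real ((1 + x\<^sup>2) ^ n) * f x + of_real x * (of_real x * (of_real ((1 + x\<^sup>2) ^ n) * f x))) \<in> schwartz_space"
    by (intro schwartz_add schwartz_mult_x Suc)
  thus ?case by (simp add: algebra_simps power2_eq_square)
qed (use assms in simp)

lemma schwartz_weighted_bounded:
  assumes "f \<in> schwartz_space"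
  shows "\<exists>C. \<forall>x. (1 + x\<^sup>2) ^ n * norm (f x) \<le> C"
proof -
  obtain C where C: "\<And>x. norm (of_real ((1 + x\<^sup>2) ^ n) * f x) \<le> C"
    using schwartz_bounded[OF schwartz_mult_decay[OF assms]] by blast
  have "(1 + x\<^sup>2) ^ n * norm (f x) \<le> C" for x
  proof -
    have "(0::real) \<le> (1 + x\<^sup>2) ^ n" by simp
    thus ?thesis using C[of x] by (simp only: norm_mult norm_of_real abs_of_nonneg)
  qed
  thus ?thesis by blast
qed

lemma schwartz_integrable:
  assumes k: "k \<ge> - 1 / 2" and f: "f \<in> schwartz_space"
  shows "integrable (dunkl_measure k) f"
  using schwartz_weighted_bounded[OF f, of "decay_order k"]
    integrable_of_decay[OF k schwartz_measurable[OF f]] by blast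

lemma integrable_mult_bounded:
  fixes f w :: "'a \<Rightarrow> 'b :: {real_normed_field, banach, second_countable_topology}"
  assumes f: "integrable M f" and w: "w \<in> borel_measurable M" and B: "\<And>x. norm (w x) \<le> B"
  shows "integrable M (\<lambda>x. f x * w x)" "integrable M (\<lambda>x. w x * f x)"
proof -
  show 1: "integrable M (\<lambda>x. f x * w x)"
  proof (rule Bochner_Integration.integrable_bound[OF integrable_mult_right[OF integrable_norm[OF f], of B]])
    show "(\<lambda>x. f x * w x) \<in> borel_measurable M" using f w by measurable
    show "AE x in M. norm (f x * w x) \<le> norm (B * norm (f x))"
    proof (rule AE_I2)
      fix x
      have "0 \<le> B" using B[of x] norm_ge_zero[of "w x"] by linarith
      thus "norm (f x * w x) \<le> norm (B * norm (f x))"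
        using B[of x] by (simp add: norm_mult mult.commute[of B] mult_left_mono)
    qed
  qed
  thus "integrable M (\<lambda>x. w x * f x)" by (simp add: mult.commute)
qed

section \<open>The Dunkl transform\<close>

lemma has_vector_derivative_iff_quotient:
  fixes f :: "real \<Rightarrow> 'a :: real_normed_vector"
  shows "(f has_vector_derivative D) (at y) \<longleftrightarrow> ((\<lambda>h. (f (y + h) - f y) /\<^sub>R h) \<longlongrightarrow> D) (at 0)"
proof -
  have "norm (f (y + h) - f y - h *\<^sub>R D) / norm h = norm ((f (y + h) - f y) /\<^sub>R h - D)" if "h \<noteq> 0" for h
  proof -
    have "(f (y + h) - f y) /\<^sub>R h - D = (f (y + h) - f y - h *\<^sub>R D) /\<^sub>R h"
      using that by (simp add: scaleR_diff_right)
    thus ?thesis by (simp add: divide_inverse)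
  qed
  hence "((\<lambda>h. norm (f (y + h) - f y - h *\<^sub>R D) / norm h) \<longlongrightarrow> 0) (at 0) \<longleftrightarrow>
      ((\<lambda>h. norm ((f (y + h) - f y) /\<^sub>R h - D)) \<longlongrightarrow> 0) (at 0)"
    by (intro filterlim_cong) (auto simp: eventually_at_filter)
  also have "\<dots> \<longleftrightarrow> ((\<lambda>h. (f (y + h) - f y) /\<^sub>R h) \<longlongrightarrow> D) (at 0)"
    by (simp add: tendsto_norm_zero_iff LIM_zero_iff)
  finally show ?thesis
    by (simp add: has_vector_derivative_def has_derivative_at bounded_linear_scaleR_left)
qed

text \<open>Differentiation under the integral sign by dominated convergence: the mean value inequality bounds
  the difference quotients by the bound for the derivative.\<close>

lemma has_vector_derivative_integral:
  fixes f :: "real \<Rightarrow> 'b \<Rightarrow> 'a :: {banach, second_countable_topology}"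
  assumes deriv: "\<And>y x. ((\<lambda>y. f y x) has_vector_derivative f' y x) (at y)"
    and int: "\<And>y. integrable M (f y)"
    and bound: "\<And>y x. norm (f' y x) \<le> B x" and B: "integrable M B"
    and meas: "f' y \<in> borel_measurable M"
  shows "((\<lambda>y. integral\<^sup>L M (f y)) has_vector_derivative integral\<^sup>L M (f' y)) (at y)"
  unfolding has_vector_derivative_iff_quotient tendsto_at_iff_sequentially o_def
proof (intro allI impI)
  fix h :: "nat \<Rightarrow> real" assume h: "\<forall>i. h i \<in> UNIV - {0}" "h \<longlonglongrightarrow> 0"
  have "(\<lambda>i. integral\<^sup>L M (\<lambda>x. (f (y + h i) x - f y x) /\<^sub>R h i)) \<longlonglongrightarrow> integral\<^sup>L M (f' y)"
  proof (rule integral_dominated_convergence[where w = B])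
    show "AE x in M. (\<lambda>i. (f (y + h i) x - f y x) /\<^sub>R h i) \<longlonglongrightarrow> f' y x"
      using deriv[of _ y] h unfolding has_vector_derivative_iff_quotient tendsto_at_iff_sequentially o_def
      by auto
    fix i
    show "(\<lambda>x. (f (y + h i) x - f y x) /\<^sub>R h i) \<in> borel_measurable M"
      using int[of "y + h i"] int[of y] by measurable
    show "AE x in M. norm ((f (y + h i) x - f y x) /\<^sub>R h i) \<le> B x"
    proof (rule AE_I2)
      fix x
      have "norm (f (y + h i) x - f y x) \<le> B x * norm (y + h i - y)"
      proof (rule differentiable_bound[where S = UNIV and f' = "\<lambda>y h. h *\<^sub>R f' y x"])
        show "((\<lambda>y. f y x) has_derivative (\<lambda>h. h *\<^sub>R f' z x)) (at z within UNIV)" for z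
          using deriv[of x z] by (simp add: has_vector_derivative_def)
        show "onorm (\<lambda>h. h *\<^sub>R f' z x) \<le> B x" for z
          using bound[of z x] by (intro onorm_le) (simp add: mult.commute[of "B x"] mult_left_mono)
      qed auto
      moreover have "norm ((f (y + h i) x - f y x) /\<^sub>R h i) = norm (f (y + h i) x - f y x) / \<bar>h i\<bar>"
        by (simp only: norm_scaleR norm_inverse real_norm_def divide_inverse mult.commute abs_inverse)
      ultimately show "norm ((f (y + h i) x - f y x) /\<^sub>R h i) \<le> B x"
        using h(1)[rule_format, of i] by (simp add: pos_divide_le_eq)
    qed
  qed (use meas B in auto)
  moreover have "integral\<^sup>L M (\<lambda>x. (f (y + h i) x - f y x) /\<^sub>R h i) = (integral\<^sup>L M (f (y + h i)) - integral\<^sup>L M (f y)) /\<^sub>R h i" for i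
    using int by (simp add: Bochner_Integration.integral_diff)
  ultimately show "(\<lambda>i. (integral\<^sup>L M (f (y + h i)) - integral\<^sup>L M (f y)) /\<^sub>R h i) \<longlonglongrightarrow> integral\<^sup>L M (f' y)"
    by (simp only:)
qed

text \<open>The inverse transform is, up to a constant, the reflection \<open>y \<mapsto> F g(- y)\<close>, so it is
  expressed through the transform itself.\<close>

definition dunkl_transform :: "real \<Rightarrow> (real \<Rightarrow> complex) \<Rightarrow> real \<Rightarrow> complex" where
  "dunkl_transform k g y = (LINT x|dunkl_measure k. g x * dunkl_exp k (- (y * x)))"

lemma integrable_mult_dunkl_exp:
  assumes k: "k \<ge> - 1 / 2" and g: "integrable (dunkl_measure k) g"
  shows "integrable (dunkl_measure k) (\<lambda>x. g x * dunkl_exp k (- (y * x)))"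
proof (rule integrable_mult_bounded(1)[OF g])
  show "(\<lambda>x. dunkl_exp k (- (y * x))) \<in> borel_measurable (dunkl_measure k)"
    using k by measurable
qed (rule dunkl_exp_norm_le[OF k])

lemma dunkl_transform_diff:
  assumes k: "k \<ge> - 1 / 2" and f: "integrable (dunkl_measure k) f" and g: "integrable (dunkl_measure k) g"
  shows "dunkl_transform k (\<lambda>x. f x - g x) y = dunkl_transform k f y - dunkl_transform k g y"
  unfolding dunkl_transform_def left_diff_distrib
  by (intro Bochner_Integration.integral_diff integrable_mult_dunkl_exp assms)

lemma dunkl_transform_cmult: "dunkl_transform k (\<lambda>x. c * f x) y = c * dunkl_transform k f y"
  unfolding dunkl_transform_def mult.assoc by simp

lemma dunkl_transform_reflect:
  assumes k: "k \<ge> - 1 / 2" and g: "g \<in> borel_measurable borel"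
  shows "dunkl_transform k (\<lambda>x. g (- x)) y = dunkl_transform k g (- y)"
proof -
  have "(\<lambda>x. g x * dunkl_exp k (y * x)) \<in> borel_measurable borel" using k g by measurable
  from integral_dunkl_reflect[OF k this] show ?thesis by (simp add: dunkl_transform_def)
qed

lemma cnj_dunkl_transform: "cnj (dunkl_transform k g y) = dunkl_transform k (\<lambda>x. cnj (g x)) (- y)"
  unfolding dunkl_transform_def by (subst Bochner_Integration.integral_cnj[symmetric]) (simp add: cnj_dunkl_exp)

lemma dunkl_transform_norm_le:
  assumes k: "k \<ge> - 1 / 2" and g: "integrable (dunkl_measure k) g"
  shows "norm (dunkl_transform k g y) \<le> (LINT x|dunkl_measure k. norm (g x))"
  unfolding dunkl_transform_def
  by (rule Bochner_Integration.integral_norm_bound_integral)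
     (use dunkl_exp_norm_le[OF k] g in \<open>auto simp: norm_mult mult_left_le intro!: integrable_mult_dunkl_exp k\<close>)

lemma continuous_on_dunkl_transform:
  assumes k: "k \<ge> - 1 / 2" and f: "integrable (dunkl_measure k) f"
  shows "continuous_on A (dunkl_transform k f)"
proof -
  have "isCont (dunkl_transform k f) y" for y
    unfolding continuous_at_sequentially o_def dunkl_transform_def
  proof (intro allI impI)
    fix u :: "nat \<Rightarrow> real" assume u: "u \<longlonglongrightarrow> y"
    show "(\<lambda>n. LINT x|dunkl_measure k. f x * dunkl_exp k (- (u n * x))) \<longlonglongrightarrow> (LINT x|dunkl_measure k. f x * dunkl_exp k (- (y * x)))"
    proof (rule integral_dominated_convergence[where w = "\<lambda>x. norm (f x)"])
      show "AE x in dunkl_measure k. (\<lambda>n. f x * dunkl_exp k (- (u n * x))) \<longlonglongrightarrow> f x * dunkl_exp k (- (y * x))"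
      proof (intro AE_I2 tendsto_mult tendsto_const)
        fix x
        have "continuous_on UNIV (dunkl_exp k)" using continuous_on_dunkl_exp[OF k continuous_on_id] .
        hence "isCont (dunkl_exp k) (- (y * x))" by (simp add: continuous_on_eq_continuous_at)
        moreover have "(\<lambda>n. - (u n * x)) \<longlonglongrightarrow> - (y * x)" using u by (intro tendsto_intros)
        ultimately show "(\<lambda>n. dunkl_exp k (- (u n * x))) \<longlonglongrightarrow> dunkl_exp k (- (y * x))"
          by (rule isCont_tendsto_compose)
      qed
      show "AE x in dunkl_measure k. norm (f x * dunkl_exp k (- (u n * x))) \<le> norm (f x)" for n
        using dunkl_exp_norm_le[OF k] by (intro AE_I2) (simp add: norm_mult mult_left_le)
      show "(\<lambda>x. f x * dunkl_exp k (- (y * x))) \<in> borel_measurable (dunkl_measure k)" for y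
        using integrable_mult_dunkl_exp[OF k f] by simp
      show "(\<lambda>x. f x * dunkl_exp k (- (u n * x))) \<in> borel_measurable (dunkl_measure k)" for n
        using integrable_mult_dunkl_exp[OF k f] by simp
    qed (use f in simp)
  qed
  thus ?thesis by (simp add: continuous_at_imp_continuous_on)
qed

lemma dunkl_exp_scaled_deriv:
  assumes k: "k \<ge> - 1 / 2"
  shows "((\<lambda>y. dunkl_exp k (- (y * x))) has_vector_derivative - of_real x * dunkl_exp' k (- (y * x))) (at y)"
proof -
  have "((dunkl_exp k \<circ> (\<lambda>y. - (y * x))) has_vector_derivative (- x) *\<^sub>R dunkl_exp' k (- (y * x))) (at y)"
    by (intro vector_diff_chain_at dunkl_exp_deriv[OF k]) (auto intro!: derivative_eq_intros)
  thus ?thesis by (simp add: o_def scaleR_conv_of_real)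
qed

lemma continuous_on_bessel_j: "\<alpha> \<ge> - 1 / 2 \<Longrightarrow> continuous_on A (bessel_j \<alpha>)"
  by (rule DERIV_continuous_on[OF has_field_derivative_at_within[OF bessel_j_deriv]])

lemma continuous_on_dunkl_exp':
  assumes "k \<ge> - 1 / 2"
  shows "continuous_on A (dunkl_exp' k)"
  unfolding dunkl_exp'_def using assms
  by (intro continuous_intros continuous_on_bessel_j) auto

lemma dunkl_transform_deriv:
  assumes k: "k \<ge> - 1 / 2" and g: "g \<in> schwartz_space"
  shows "(dunkl_transform k g has_vector_derivative
           (LINT x|dunkl_measure k. g x * (- of_real x * dunkl_exp' k (- (y * x))))) (at y)"
  unfolding dunkl_transform_def [abs_def]
proof (rule has_vector_derivative_integral)
  show "((\<lambda>y. g x * dunkl_exp k (- (y * x))) has_vector_derivative g x * (- of_real x * dunkl_exp' k (- (y * x)))) (at y)" for x y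
    by (intro has_vector_derivative_mult_right dunkl_exp_scaled_deriv k)
  show "integrable (dunkl_measure k) (\<lambda>x. g x * dunkl_exp k (- (y * x)))" for y
    by (intro integrable_mult_dunkl_exp k schwartz_integrable g)
  show "integrable (dunkl_measure k) (\<lambda>x. 2 * norm (of_real x * g x))"
    by (intro integrable_mult_right integrable_norm schwartz_integrable schwartz_mult_x k g)
  show "norm (g x * (- of_real x * dunkl_exp' k (- (y * x)))) \<le> 2 * norm (of_real x * g x)" for x y
    using mult_left_mono[OF dunkl_exp'_norm_le[OF k, of "- (y * x)"], of "norm (of_real x * g x)"]
    by (simp add: norm_mult mult_ac)
  have [measurable]: "g \<in> borel_measurable borel" by (rule schwartz_measurable[OF g])
  have "bessel_j (k + 1) \<in> borel_measurable borel"
    using k by (intro borel_measurable_continuous_onI continuous_on_bessel_j) auto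
  note [measurable] = this
  show "(\<lambda>x. g x * (- of_real x * dunkl_exp' k (- (y * x)))) \<in> borel_measurable (dunkl_measure k)"
    using k unfolding dunkl_exp'_def by measurable
qed

text \<open>The transform turns multiplication by \<open>-i x\<close> into the Dunkl operator in \<open>y\<close>. This is the eigenvalue
  equation of the kernel in \<open>y\<close>, integrated against \<open>g\<close>.\<close>

lemma dunkl_transform_mult_x:
  assumes k: "k \<ge> - 1 / 2" and g: "g \<in> schwartz_space" and y: "y \<noteq> 0"
  shows "(- \<i>) * dunkl_transform k (\<lambda>x. of_real x * g x) y =
           vderiv (dunkl_transform k g) y
           + of_real ((2 * k + 1) / y) * ((dunkl_transform k g y - dunkl_transform k g (- y)) / 2)"
proof -
  let ?c = "complex_of_real ((2 * k + 1) / (2 * y))"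
  let ?M = "dunkl_measure k"
  have int: "integrable ?M (\<lambda>x. g x * dunkl_exp k (- (y * x)))" for y
    by (intro integrable_mult_dunkl_exp k schwartz_integrable g)
  have intx: "integrable ?M (\<lambda>x. of_real x * g x * dunkl_exp k (- (y * x)))"
    by (intro integrable_mult_dunkl_exp k schwartz_integrable schwartz_mult_x g)
  have pw: "g x * (- of_real x * dunkl_exp' k (- (y * x))) =
      (- \<i>) * (of_real x * g x * dunkl_exp k (- (y * x))) - ?c * (g x * dunkl_exp k (- (y * x)) - g x * dunkl_exp k (- ((- y) * x)))" for x
  proof (cases "x = 0")
    case False
    hence z: "- (y * x) \<noteq> 0" using y by simp
    have c: "complex_of_real x * of_real ((2 * k + 1) / (- (y * x))) = - of_real ((2 * k + 1) / y)"
    proof -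
      have "x * ((2 * k + 1) / (- (y * x))) = - ((2 * k + 1) / y)" using False y by (simp add: divide_simps)
      thus ?thesis by (metis of_real_mult of_real_minus)
    qed
    have e: "- of_real x * dunkl_exp' k (- (y * x)) = (- \<i>) * (of_real x * dunkl_exp k (- (y * x)))
        - of_real ((2 * k + 1) / y) * ((dunkl_exp k (- (y * x)) - dunkl_exp k (y * x)) / 2)"
    proof -
      have "- X * (\<i> * E - A * D) = (- \<i>) * (X * E) - B * D" if "X * A = - B" for X A B D E :: complex
      proof -
        have "- X * (\<i> * E - A * D) = (- \<i>) * (X * E) + (X * A) * D" by (simp add: algebra_simps)
        thus ?thesis by (simp add: that)
      qed
      from this[OF c] show ?thesis unfolding dunkl_exp'_eq[OF z] minus_minus .
    qed
    have "G * ((- \<i>) * (X * E) - B * ((E - E') / 2)) = (- \<i>) * (X * G * E) - B / 2 * (G * E - G * E')" for G X E E' B :: complex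
      by (simp add: algebra_simps diff_divide_distrib)
    moreover have "?c = of_real ((2 * k + 1) / y) / 2" by simp
    ultimately show ?thesis unfolding e by (simp only: mult_minus_left minus_minus)
  qed auto
  have "vderiv (dunkl_transform k g) y = (LINT x|?M. g x * (- of_real x * dunkl_exp' k (- (y * x))))"
    by (rule vector_derivative_at[OF dunkl_transform_deriv[OF k g]])
  also have "\<dots> = (- \<i>) * (LINT x|?M. of_real x * g x * dunkl_exp k (- (y * x)))
       - ?c * ((LINT x|?M. g x * dunkl_exp k (- (y * x))) - (LINT x|?M. g x * dunkl_exp k (- ((- y) * x))))"
    unfolding pw
    by (simp only: Bochner_Integration.integral_diff integrable_mult_right Bochner_Integration.integrable_diff int intx integral_mult_right_zero)
  also have "\<dots> = (- \<i>) * dunkl_transform k (\<lambda>x. of_real x * g x) y - ?c * (dunkl_transform k g y - dunkl_transform k g (- y))"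
    by (simp only: dunkl_transform_def)
  finally show ?thesis by simp
qed

text \<open>The integrand is the derivative of \<open>x\<^sup>2\<^sup>k\<^sup>+\<^sup>1 u(x)\<close>, which vanishes at both ends of the half line; at \<open>0\<close>
  this uses \<open>u(0) = 0\<close> when \<open>k = -1/2\<close>.\<close>

lemma integral_half_line_parts:
  fixes u :: "real \<Rightarrow> complex"
  assumes k: "k \<ge> - 1 / 2"
    and deriv: "\<And>x. (u has_vector_derivative u' x) (at x)" and cont: "continuous_on UNIV u'"
    and u0: "u 0 = 0"
    and decay: "\<And>x. (1 + x\<^sup>2) ^ decay_order k * norm (u x) \<le> C"
    and int: "set_integrable lborel {0<..} (\<lambda>x. x powr (2 * k + 1) *\<^sub>R (u' x + of_real ((2 * k + 1) / x) * u x))"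
  shows "(LINT x:{0<..}|lborel. x powr (2 * k + 1) *\<^sub>R (u' x + of_real ((2 * k + 1) / x) * u x)) = 0"
proof -
  have contu: "continuous_on UNIV u"
    by (meson deriv has_vector_derivative_continuous continuous_at_imp_continuous_on)
  have "(LBINT x=ereal 0..\<infinity>. x powr (2 * k + 1) *\<^sub>R (u' x + of_real ((2 * k + 1) / x) * u x)) = 0 - 0"
  proof (rule interval_integral_FTC_integrable[where F = "\<lambda>x. x powr (2 * k + 1) *\<^sub>R u x"])
    fix x assume "ereal 0 < ereal x"
    hence x: "x > 0" by simp
    have "((\<lambda>x. x powr (2 * k + 1)) has_real_derivative (2 * k + 1) * x powr (2 * k + 1 - 1)) (at x)"
      using x by (rule has_real_derivative_powr)
    from has_vector_derivative_scaleR[OF this deriv]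
    have "((\<lambda>x. x powr (2 * k + 1) *\<^sub>R u x) has_vector_derivative
       x powr (2 * k + 1) *\<^sub>R u' x + ((2 * k + 1) * x powr (2 * k + 1 - 1)) *\<^sub>R u x) (at x)" .
    moreover have "((2 * k + 1) * x powr (2 * k + 1 - 1)) = x powr (2 * k + 1) * ((2 * k + 1) / x)"
      using x by (subst powr_diff) simp
    ultimately show "((\<lambda>x. x powr (2 * k + 1) *\<^sub>R u x) has_vector_derivative
       x powr (2 * k + 1) *\<^sub>R (u' x + of_real ((2 * k + 1) / x) * u x)) (at x)"
      by (simp only: scaleR_conv_of_real of_real_mult mult.assoc distrib_left)
    have "isCont u x" "isCont u' x"
      using cont contu by (auto simp: continuous_on_eq_continuous_at)
    thus "isCont (\<lambda>x. x powr (2 * k + 1) *\<^sub>R (u' x + of_real ((2 * k + 1) / x) * u x)) x"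
      using x by (intro continuous_intros) auto
  next
    show "set_integrable lborel (einterval (ereal 0) \<infinity>) (\<lambda>x. x powr (2 * k + 1) *\<^sub>R (u' x + of_real ((2 * k + 1) / x) * u x))"
      using int by (simp add: einterval_eq_Ici)
  next
    have "(u \<longlongrightarrow> u 0) (at 0)" using contu by (simp add: continuous_on_eq_continuous_at isCont_def)
    hence "(u \<longlongrightarrow> 0) (at_right 0)" using u0 filterlim_at_split by auto
    hence "((\<lambda>x. norm (u x)) \<longlongrightarrow> 0) (at_right 0)" by (rule tendsto_norm_zero)
    hence "((\<lambda>x. x powr (2 * k + 1) *\<^sub>R u x) \<longlongrightarrow> 0) (at_right 0)"
    proof (rule Lim_null_comparison[rotated])
      show "\<forall>\<^sub>F x in at_right 0. norm (x powr (2 * k + 1) *\<^sub>R u x) \<le> norm (u x)"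
      proof (rule eventually_at_rightI[of 0 1])
        fix x :: real assume "x \<in> {0<..<1}"
        hence "x powr (2 * k + 1) \<le> 1 powr (2 * k + 1)" using k by (intro powr_mono2) auto
        thus "norm (x powr (2 * k + 1) *\<^sub>R u x) \<le> norm (u x)" by (simp add: mult_left_le_one_le)
      qed simp
    qed
    thus "(((\<lambda>x. x powr (2 * k + 1) *\<^sub>R u x) \<circ> real_of_ereal) \<longlongrightarrow> 0) (at_right (ereal 0))"
      by (simp add: ereal_tendsto_simps1)
  next
    have "((\<lambda>x. C * inverse (1 + x\<^sup>2)) \<longlongrightarrow> 0) at_top"
    proof -
      have "filterlim (\<lambda>x::real. 1 + x\<^sup>2) at_infinity at_top"
        by (intro filterlim_at_top_imp_at_infinity filterlim_tendsto_add_at_top[OF tendsto_const] filterlim_pow_at_top filterlim_ident) auto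
      from tendsto_mult[OF tendsto_const[of C] filterlim_compose[OF tendsto_inverse_0 this]] show ?thesis
        by simp
    qed
    hence "((\<lambda>x. x powr (2 * k + 1) *\<^sub>R u x) \<longlongrightarrow> 0) at_top"
    proof (rule Lim_null_comparison[rotated])
      show "\<forall>\<^sub>F x in at_top. norm (x powr (2 * k + 1) *\<^sub>R u x) \<le> C * inverse (1 + x\<^sup>2)"
      proof (rule eventually_mono[OF eventually_gt_at_top[of 0]])
        fix x :: real assume "x > 0"
        have pos: "1 + x\<^sup>2 > 0" by (simp add: add_pos_nonneg)
        have "x powr (2 * k + 1) * norm (u x) \<le> (1 + x\<^sup>2) ^ (nat \<lceil>k\<rceil> + 1) * norm (u x)"
          using density_le_decay[OF k, of x] \<open>x > 0\<close> by (intro mult_right_mono) auto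
        moreover have "(1 + x\<^sup>2) * ((1 + x\<^sup>2) ^ (nat \<lceil>k\<rceil> + 1) * norm (u x)) \<le> C"
          using decay[of x] by (simp add: decay_order_def mult_ac)
        ultimately have "(1 + x\<^sup>2) * (x powr (2 * k + 1) * norm (u x)) \<le> C"
          using pos by (meson mult_left_mono order_trans less_imp_le)
        thus "norm (x powr (2 * k + 1) *\<^sub>R u x) \<le> C * inverse (1 + x\<^sup>2)"
          using pos by (simp add: field_simps)
      qed
    qed
    thus "(((\<lambda>x. x powr (2 * k + 1) *\<^sub>R u x) \<circ> real_of_ereal) \<longlongrightarrow> 0) (at_left \<infinity>)"
      by (simp add: ereal_tendsto_simps1)
  qed simp
  thus ?thesis by (simp add: interval_integral_to_infinity_eq)
qed

text \<open>With \<open>\<phi>(x) = e(- y x)\<close> the claim says that \<open>G = \<Lambda>g \<phi> - i y g \<phi>\<close>, which is \<open>\<Lambda>g \<phi> + g \<Lambda>\<phi>\<close>, has integral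
  zero. It is not a total derivative itself, because \<open>\<Lambda>\<close> is not a derivation; but the measure is
  symmetric, so only the even part of \<open>G\<close> counts. Twice that part is
  \<open>U' + (2k + 1) U / x\<close>, where \<open>U\<close> is twice the odd part of \<open>g \<phi>\<close>, and this is
  a total derivative for the weight on the half line.\<close>

lemma dunkl_transform_dunkl_op:
  assumes k: "k \<ge> - 1 / 2" and g: "g \<in> schwartz_space"
  shows "dunkl_transform k (dunkl_op k g) y = \<i> * of_real y * dunkl_transform k g y"
proof -
  let ?M = "dunkl_measure k"
  define \<phi> where "\<phi> = (\<lambda>x. dunkl_exp k (- (y * x)))"
  define \<phi>' where "\<phi>' = (\<lambda>x. - of_real y * dunkl_exp' k (- (y * x)))"
  define G where "G = (\<lambda>x. dunkl_op k g x * \<phi> x - \<i> * of_real y * (g x * \<phi> x))"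
  define U where "U = (\<lambda>x. g x * \<phi> x - g (- x) * \<phi> (- x))"
  define V where "V = (\<lambda>x. vderiv g x * \<phi> x + g x * \<phi>' x)"
  have [measurable]: "g \<in> borel_measurable borel" "dunkl_op k g \<in> borel_measurable borel"
    using g by (auto intro: schwartz_measurable dunkl_op_schwartz)
  have [measurable]: "\<phi> \<in> borel_measurable borel"
    unfolding \<phi>_def using k by measurable
  have d\<phi>: "(\<phi> has_vector_derivative \<phi>' x) (at x)" for x
    using dunkl_exp_scaled_deriv[OF k, of y x] unfolding \<phi>_def \<phi>'_def by (simp add: mult.commute)
  have dg: "((\<lambda>x. g x * \<phi> x) has_vector_derivative V x) (at x)" for x
    unfolding V_def by (rule has_vector_derivative_eq_rhs[OF has_vector_derivative_mult[OF schwartz_derivative[OF g] d\<phi>]]) (simp add: add.commute)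
  have dgm: "((\<lambda>x. g (- x) * \<phi> (- x)) has_vector_derivative - V (- x)) (at x)" for x
  proof -
    have "(((\<lambda>x. g x * \<phi> x) \<circ> uminus) has_vector_derivative (- 1) *\<^sub>R V (- x)) (at x)"
      by (intro vector_diff_chain_at dg) (auto intro!: derivative_eq_intros)
    thus ?thesis by (simp add: o_def)
  qed
  have dU: "(U has_vector_derivative V x + V (- x)) (at x)" for x
    unfolding U_def using has_vector_derivative_diff[OF dg dgm] by simp
  have even_part: "G x + G (- x) = (V x + V (- x)) + of_real ((2 * k + 1) / x) * U x" if x: "x > 0" for x
  proof -
    have *: "- (\<i> * of_real y * \<phi> x) = \<phi>' x + of_real ((2 * k + 1) / x) * ((\<phi> x - \<phi> (- x)) / 2)" if "x \<noteq> 0" for x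
    proof (cases "y = 0")
      case True
      thus ?thesis by (simp add: \<phi>_def \<phi>'_def)
    next
      case False
      have z: "- (y * x) \<noteq> 0" using False that by simp
      have "y * ((2 * k + 1) / (- (y * x))) = - ((2 * k + 1) / x)" using False that by (simp add: divide_simps)
      hence c: "complex_of_real y * of_real ((2 * k + 1) / (- (y * x))) = - of_real ((2 * k + 1) / x)"
        by (metis of_real_mult of_real_minus)
      have "- (\<i> * Y * E) = - Y * (\<i> * E - A * D) + B * D" if "Y * A = - B" for Y A B D E :: complex
      proof -
        have "- Y * (\<i> * E - A * D) = - (\<i> * Y * E) + (Y * A) * D" by (simp add: algebra_simps)
        thus ?thesis by (simp add: that)
      qed
      from this[OF c] show ?thesis unfolding \<phi>_def \<phi>'_def dunkl_exp'_eq[OF z] minus_minus mult_minus_right .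
    qed
    have oq: "odd_quotient g z = (g z - g (- z)) / (2 * of_real z)" if "z \<noteq> 0" for z
      using that by (simp add: odd_quotient_def)
    have Gx: "G z = V z + of_real ((2 * k + 1) / z) * ((2 * g z * \<phi> z - g (- z) * \<phi> z - g z * \<phi> (- z)) / 2)" if z: "z \<noteq> 0" for z
    proof -
      have "G z = (vderiv g z + of_real ((2 * k + 1) / z) * ((g z - g (- z)) / 2)) * \<phi> z + g z * (- (\<i> * of_real y * \<phi> z))"
        unfolding G_def dunkl_op_eq[OF g] oq[OF z] by (simp add: algebra_simps)
      also have "\<dots> = V z + of_real ((2 * k + 1) / z) * ((2 * g z * \<phi> z - g (- z) * \<phi> z - g z * \<phi> (- z)) / 2)"
        unfolding *[OF z] V_def by (simp add: algebra_simps add_divide_distrib diff_divide_distrib)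
      finally show ?thesis .
    qed
    have m: "complex_of_real ((2 * k + 1) / (- x)) = - of_real ((2 * k + 1) / x)" by simp
    have sum: "A + c * (P / 2) + (B + (- c) * (Q / 2)) = A + B + c * ((P - Q) / 2)" for A B c P Q :: complex
      by (simp add: algebra_simps diff_divide_distrib)
    have nz: "x \<noteq> 0" "- x \<noteq> 0" using x by auto
    have U: "((2 * g x * \<phi> x - g (- x) * \<phi> x - g x * \<phi> (- x)) - (2 * g (- x) * \<phi> (- x) - g (- (- x)) * \<phi> (- x) - g (- x) * \<phi> (- (- x)))) / 2 = U x"
      by (simp add: U_def field_simps)
    show ?thesis
      unfolding U[symmetric] Gx[OF nz(1)] Gx[OF nz(2)] m by (rule sum)
  qed
  have intG: "integrable ?M G"
    unfolding G_def \<phi>_def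
    by (intro Bochner_Integration.integrable_diff integrable_mult_right integrable_mult_dunkl_exp schwartz_integrable dunkl_op_schwartz k g)
  have [measurable]: "G \<in> borel_measurable borel" unfolding G_def by measurable
  let ?W = "\<lambda>x. dunkl_density k x *\<^sub>R G x"
  have intW: "integrable lborel ?W"
    using intG by (simp add: integrable_dunkl_measure[OF k])
  have intW': "integrable lborel (\<lambda>x. dunkl_density k x *\<^sub>R G (- x))"
    using intG by (subst integrable_dunkl_measure[OF k, symmetric]) (auto simp: integrable_dunkl_reflect[OF k])
  define K where "K = 2 powr (k + 1) * Gamma (k + 1)"
  have K: "K > 0" using k unfolding K_def by (intro mult_pos_pos Gamma_real_pos) auto
  have half_line: "dunkl_density k x *\<^sub>R G x + dunkl_density k x *\<^sub>R G (- x) =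
      (1 / K) *\<^sub>R (x powr (2 * k + 1) *\<^sub>R ((V x + V (- x)) + of_real ((2 * k + 1) / x) * U x))" if "x > 0" for x
  proof -
    have d: "dunkl_density k x = 1 / K * x powr (2 * k + 1)" using that by (simp add: dunkl_density_def K_def)
    show ?thesis
      unfolding scaleR_add_right[symmetric] even_part[OF that] d by (simp only: scaleR_scaleR)
  qed
  \<comment> \<open>This includes \<open>k = -1/2\<close>, because \<open>0 powr 0 = 0\<close>; so the open half lines carry the whole integral.\<close>
  have D0: "dunkl_density k 0 = 0" by (simp add: dunkl_density_def)
  have "(LINT x|?M. G x) = (LINT x|lborel. ?W x)"
    by (rule integral_dunkl_measure[OF k]) measurable
  also have "\<dots> = (LINT x|lborel. indicator {0<..} x *\<^sub>R ?W x + indicator {..<0} x *\<^sub>R ?W x)"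
  proof (rule Bochner_Integration.integral_cong[OF refl])
    fix x :: real
    show "?W x = indicator {0<..} x *\<^sub>R ?W x + indicator {..<0} x *\<^sub>R ?W x"
      by (cases x "0 :: real" rule: linorder_cases) (simp_all add: D0)
  qed
  also have "\<dots> = (LINT x|lborel. indicator {0<..} x *\<^sub>R ?W x) + (LINT x|lborel. indicator {..<0} x *\<^sub>R ?W x)"
    by (intro Bochner_Integration.integral_add integrable_mult_indicator intW) auto
  also have "(LINT x|lborel. indicator {..<0} x *\<^sub>R ?W x) = (LINT x|lborel. indicator {0<..} x *\<^sub>R (dunkl_density k x *\<^sub>R G (- x)))"
    using lborel_integral_real_affine[of "-1" "\<lambda>x. indicator {..<0} x *\<^sub>R ?W x" 0]
    by (simp add: indicator_def)
  also have "(LINT x|lborel. indicator {0<..} x *\<^sub>R ?W x) + \<dots> = (LINT x|lborel. indicator {0<..} x *\<^sub>R ?W x + indicator {0<..} x *\<^sub>R (dunkl_density k x *\<^sub>R G (- x)))"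
    by (intro Bochner_Integration.integral_add[symmetric] integrable_mult_indicator intW intW') auto
  also have "\<dots> = (LINT x:{0<..}|lborel. (1 / K) *\<^sub>R (x powr (2 * k + 1) *\<^sub>R ((V x + V (- x)) + of_real ((2 * k + 1) / x) * U x)))"
    unfolding set_lebesgue_integral_def
  proof (rule Bochner_Integration.integral_cong[OF refl])
    fix x :: real
    show "indicator {0<..} x *\<^sub>R ?W x + indicator {0<..} x *\<^sub>R (dunkl_density k x *\<^sub>R G (- x)) =
      indicator {0<..} x *\<^sub>R ((1 / K) *\<^sub>R (x powr (2 * k + 1) *\<^sub>R ((V x + V (- x)) + of_real ((2 * k + 1) / x) * U x)))"
    proof (cases "x > 0")
      case True
      hence i: "indicator {0<..} x = (1::real)" by simp
      show ?thesis unfolding i scaleR_one by (rule half_line[OF True])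
    next
      case False
      hence i: "indicator {0<..} x = (0::real)" by simp
      show ?thesis unfolding i scaleR_zero_left by (rule add_0_left)
    qed
  qed
  also have "\<dots> = (1 / K) *\<^sub>R (LINT x:{0<..}|lborel. x powr (2 * k + 1) *\<^sub>R ((V x + V (- x)) + of_real ((2 * k + 1) / x) * U x))"
    by (rule set_integral_scaleR_right)
  also have "(LINT x:{0<..}|lborel. x powr (2 * k + 1) *\<^sub>R ((V x + V (- x)) + of_real ((2 * k + 1) / x) * U x)) = 0"
  proof -
    have "continuous_on UNIV \<phi>'"
      unfolding \<phi>'_def
      by (intro continuous_intros continuous_on_compose2[OF continuous_on_dunkl_exp'[OF k, of UNIV]]) auto
    hence "continuous_on UNIV V" unfolding V_def \<phi>_def
      by (intro continuous_intros k schwartz_continuous_on[OF g] schwartz_continuous_on[OF schwartz_vderiv[OF g]])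
    hence cont: "continuous_on UNIV (\<lambda>x. V x + V (- x))"
      by (rule continuous_on_add) (rule continuous_on_compose2[OF \<open>continuous_on UNIV V\<close>], auto intro!: continuous_intros)
    obtain C where Cg: "\<And>x. (1 + x\<^sup>2) ^ decay_order k * norm (g x) \<le> C"
      using schwartz_weighted_bounded[OF g] by blast
    have "(1 + x\<^sup>2) ^ decay_order k * norm (U x) \<le> 2 * C" for x
    proof -
      have "norm (U x) \<le> norm (g x * \<phi> x) + norm (g (- x) * \<phi> (- x))"
        unfolding U_def by (rule norm_triangle_ineq4)
      also have "\<dots> \<le> norm (g x) + norm (g (- x))"
        unfolding norm_mult \<phi>_def by (intro add_mono mult_left_le dunkl_exp_norm_le k) auto
      finally have "(1 + x\<^sup>2) ^ decay_order k * norm (U x) \<le> (1 + x\<^sup>2) ^ decay_order k * (norm (g x) + norm (g (- x)))"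
        by (intro mult_left_mono) auto
      thus ?thesis using Cg[of x] Cg[of "- x"] by (simp add: distrib_left)
    qed
    moreover have "set_integrable lborel {0<..} (\<lambda>x. x powr (2 * k + 1) *\<^sub>R ((V x + V (- x)) + of_real ((2 * k + 1) / x) * U x))"
    proof -
      have "integrable lborel (\<lambda>x. K *\<^sub>R (indicator {0<..} x *\<^sub>R ?W x + indicator {0<..} x *\<^sub>R (dunkl_density k x *\<^sub>R G (- x))))"
        by (intro integrable_scaleR_right Bochner_Integration.integrable_add integrable_mult_indicator intW intW') auto
      moreover have "K *\<^sub>R (indicator {0<..} x *\<^sub>R ?W x + indicator {0<..} x *\<^sub>R (dunkl_density k x *\<^sub>R G (- x)))
          = indicator {0<..} x *\<^sub>R (x powr (2 * k + 1) *\<^sub>R ((V x + V (- x)) + of_real ((2 * k + 1) / x) * U x))" for x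
      proof (cases "x > 0")
        case True
        hence i: "indicator {0<..} x = (1::real)" by simp
        have "K *\<^sub>R (1 / K) *\<^sub>R Z = Z" for Z :: complex using K by simp
        thus ?thesis unfolding i scaleR_one half_line[OF True] .
      qed simp
      ultimately show ?thesis unfolding set_integrable_def by (simp only:)
    qed
    ultimately show ?thesis
      by (intro integral_half_line_parts[OF k dU cont]) (auto simp: U_def)
  qed
  finally have "(LINT x|?M. G x) = 0" by simp
  moreover have "(LINT x|?M. G x) = dunkl_transform k (dunkl_op k g) y - \<i> * of_real y * dunkl_transform k g y"
  proof -
    have i: "integrable ?M (\<lambda>x. dunkl_op k g x * dunkl_exp k (- (y * x)))" "integrable ?M (\<lambda>x. g x * dunkl_exp k (- (y * x)))"
      using integrable_mult_dunkl_exp[OF k schwartz_integrable[OF k dunkl_op_schwartz[OF g]]]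
        integrable_mult_dunkl_exp[OF k schwartz_integrable[OF k g]] by blast+
    show ?thesis
      unfolding G_def \<phi>_def dunkl_transform_def
      by (simp only: Bochner_Integration.integral_diff[OF i(1) integrable_mult_right[OF i(2)]] integral_mult_right_zero)
  qed
  ultimately show ?thesis by simp
qed

text \<open>Multiplying the transform by \<open>1 + y\<^sup>2\<close> amounts to applying \<open>1 - \<Lambda>\<^sup>2\<close> to \<open>g\<close>, and transforms are bounded.\<close>

lemma dunkl_transform_decay:
  assumes k: "k \<ge> - 1 / 2" and g: "g \<in> schwartz_space"
  shows "\<exists>C. \<forall>y. (1 + y\<^sup>2) ^ n * norm (dunkl_transform k g y) \<le> C"
  using g
proof (induction n arbitrary: g)
  case 0
  show ?case
    using dunkl_transform_norm_le[OF k schwartz_integrable[OF k 0]]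
    by (intro exI[of _ "LINT x|dunkl_measure k. norm (g x)"]) simp
next
  case (Suc n)
  define h where "h = (\<lambda>x. g x - dunkl_op k (dunkl_op k g) x)"
  have h: "h \<in> schwartz_space"
    unfolding h_def by (intro schwartz_diff dunkl_op_schwartz Suc.prems)
  obtain C where C: "\<And>y. (1 + y\<^sup>2) ^ n * norm (dunkl_transform k h y) \<le> C"
    using Suc.IH[OF h] by blast
  have "dunkl_transform k h y = of_real (1 + y\<^sup>2) * dunkl_transform k g y" for y
  proof -
    have "dunkl_transform k h y = dunkl_transform k g y - dunkl_transform k (dunkl_op k (dunkl_op k g)) y"
      unfolding h_def by (intro dunkl_transform_diff k schwartz_integrable dunkl_op_schwartz Suc.prems)
    also have "dunkl_transform k (dunkl_op k (dunkl_op k g)) y = \<i> * of_real y * (\<i> * of_real y * dunkl_transform k g y)"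
      by (simp only: dunkl_transform_dunkl_op[OF k] Suc.prems dunkl_op_schwartz)
    finally show ?thesis by (simp add: algebra_simps power2_eq_square)
  qed
  moreover have "norm (complex_of_real (1 + y\<^sup>2)) = 1 + y\<^sup>2" for y
    by (subst norm_of_real) (simp add: abs_of_nonneg)
  ultimately have "norm (dunkl_transform k h y) = (1 + y\<^sup>2) * norm (dunkl_transform k g y)" for y
    by (simp only: norm_mult)
  hence "(1 + y\<^sup>2) ^ Suc n * norm (dunkl_transform k g y) \<le> C" for y
    using C[of y] by (simp add: mult_ac)
  thus ?case by blast
qed

lemma dunkl_transform_measurable:
  assumes k: "k \<ge> - 1 / 2" and g: "g \<in> schwartz_space"
  shows "dunkl_transform k g \<in> borel_measurable borel"
  by (intro borel_measurable_continuous_onI continuous_on_dunkl_transform schwartz_integrable k g)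

lemma dunkl_transform_integrable:
  assumes k: "k \<ge> - 1 / 2" and g: "g \<in> schwartz_space"
  shows "integrable (dunkl_measure k) (dunkl_transform k g)"
proof -
  obtain C where "\<And>y. (1 + y\<^sup>2) ^ decay_order k * norm (dunkl_transform k g y) \<le> C"
    using dunkl_transform_decay[OF k g] by blast
  thus ?thesis by (intro integrable_of_decay[OF k dunkl_transform_measurable[OF k g]])
qed

text \<open>Fubini's theorem; the kernel is symmetric in its two arguments.\<close>

lemma dunkl_transform_swap:
  assumes k: "k \<ge> - 1 / 2"
    and f: "integrable (dunkl_measure k) f" and h: "integrable (dunkl_measure k) h"
  shows "(LINT y|dunkl_measure k. dunkl_transform k f y * h y) = (LINT x|dunkl_measure k. f x * dunkl_transform k h x)"
proof -
  let ?M = "dunkl_measure k"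
  interpret sigma_finite_measure ?M by (rule sigma_finite_dunkl_measure)
  interpret P: pair_sigma_finite ?M ?M by unfold_locales
  define \<Phi> where "\<Phi> = (\<lambda>x y. f x * h y * dunkl_exp k (- (y * x)))"
  have fm [measurable]: "f \<in> borel_measurable ?M" and hm [measurable]: "h \<in> borel_measurable ?M"
    using f h by auto
  have [measurable]: "dunkl_exp k \<in> borel_measurable borel"
    using dunkl_exp_measurable[OF k measurable_ident] by simp
  have \<Phi>m: "case_prod \<Phi> \<in> borel_measurable (?M \<Otimes>\<^sub>M ?M)"
    unfolding \<Phi>_def split_beta by measurable
  have "integrable (?M \<Otimes>\<^sub>M ?M) (\<lambda>p. f (fst p) * h (snd p))"
  proof (rule P.Fubini_integrable)
    show "(\<lambda>p. f (fst p) * h (snd p)) \<in> borel_measurable (?M \<Otimes>\<^sub>M ?M)" by measurable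
    show "integrable ?M (\<lambda>x. LINT y|?M. norm (f (fst (x, y)) * h (snd (x, y))))"
      using f by (simp add: norm_mult integrable_mult_left)
    show "AE x in ?M. integrable ?M (\<lambda>y. f (fst (x, y)) * h (snd (x, y)))"
      using h by (simp add: integrable_mult_right)
  qed
  hence int: "integrable (?M \<Otimes>\<^sub>M ?M) (case_prod \<Phi>)"
    by (rule Bochner_Integration.integrable_bound[OF _ \<Phi>m])
       (use dunkl_exp_norm_le[OF k] in \<open>auto simp: \<Phi>_def norm_mult intro!: AE_I2 mult_left_le\<close>)
  have "(LINT y|?M. dunkl_transform k f y * h y) = (LINT y|?M. LINT x|?M. \<Phi> x y)"
  proof (rule Bochner_Integration.integral_cong[OF refl])
    fix y
    show "dunkl_transform k f y * h y = (LINT x|?M. \<Phi> x y)"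
      unfolding dunkl_transform_def \<Phi>_def by (subst integral_mult_left_zero[symmetric]) (simp add: mult_ac)
  qed
  also have "\<dots> = (LINT x|?M. LINT y|?M. \<Phi> x y)"
    by (rule P.Fubini_integral[OF int])
  also have "\<dots> = (LINT x|?M. f x * dunkl_transform k h x)"
    unfolding dunkl_transform_def \<Phi>_def mult.assoc by (simp add: mult.commute)
  finally show ?thesis .
qed

section \<open>Gaussians\<close>

lemma gaussian_minus [simp]: "gaussian t (- x) = gaussian t x"
  by (simp add: gaussian_def)

lemma gaussian_0 [simp]: "gaussian t 0 = 1"
  by (simp add: gaussian_def)

lemma gaussian_pos: "gaussian t x > 0" by (simp add: gaussian_def)

lemma gaussian_measurable [measurable]: "gaussian t \<in> borel_measurable borel"
  unfolding gaussian_def [abs_def] by measurable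

lemma gaussian_integrable:
  assumes k: "k \<ge> - 1 / 2" and t: "t > 0"
  shows "integrable (dunkl_measure k) (gaussian t)"
  using integrable_Re[OF schwartz_integrable[OF k gaussian_schwartz[OF t]]] by simp

lemma dunkl_op_gaussian:
  assumes t: "t > 0"
  shows "dunkl_op k (\<lambda>x. of_real (gaussian t x)) = (\<lambda>x. of_real (- 2 * t) * (of_real x * of_real (gaussian t x)))"
proof
  fix x
  have v: "vderiv (\<lambda>x. of_real (gaussian t x)) x = of_real (- (2 * t * x) * gaussian t x)" for x
    by (rule vector_derivative_at[OF gaussian_deriv])
  show "dunkl_op k (\<lambda>x. of_real (gaussian t x)) x = of_real (- 2 * t) * (of_real x * of_real (gaussian t x))"
    by (simp add: dunkl_op_eq[OF gaussian_schwartz[OF t]] odd_quotient_def v)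
qed

definition gaussian_mass :: "real \<Rightarrow> real \<Rightarrow> real" where
  "gaussian_mass k t = (LINT x|dunkl_measure k. gaussian t x)"

lemma dunkl_transform_x_gaussian:
  assumes k: "k \<ge> - 1 / 2" and t: "t > 0"
  shows "dunkl_transform k (\<lambda>x. of_real x * of_real (gaussian t x)) y =
           - (\<i> * of_real (y / (2 * t))) * dunkl_transform k (\<lambda>x. of_real (gaussian t x)) y"
proof -
  let ?g = "\<lambda>x. complex_of_real (gaussian t x)"
  have "\<i> * of_real y * dunkl_transform k ?g y = of_real (- 2 * t) * dunkl_transform k (\<lambda>x. of_real x * ?g x) y"
    using dunkl_transform_dunkl_op[OF k gaussian_schwartz[OF t], of y]
    unfolding dunkl_op_gaussian[OF t] dunkl_transform_cmult by simp
  thus ?thesis using t by (simp add: field_simps)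
qed

text \<open>The Gaussian \<open>\<gamma>\<close> satisfies \<open>\<Lambda>\<gamma> = - 2 t x \<gamma>\<close>. Transforming both sides gives
  \<open>(F\<gamma>)' = - y / (2t) F\<gamma>\<close>, where the reflection term is absent because \<open>F\<gamma>\<close> is even.\<close>

lemma dunkl_transform_gaussian:
  assumes k: "k \<ge> - 1 / 2" and t: "t > 0"
  shows "dunkl_transform k (\<lambda>x. of_real (gaussian t x)) y = of_real (gaussian_mass k t) * of_real (gaussian (1 / (4 * t)) y)"
proof -
  let ?g = "\<lambda>x. complex_of_real (gaussian t x)"
  let ?F = "dunkl_transform k ?g"
  let ?s = "1 / (4 * t)"
  have gS: "?g \<in> schwartz_space" by (rule gaussian_schwartz[OF t])
  \<comment> \<open>the quotient of the two sides, which is shown to be constant; a Gaussian with a negative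
    parameter is the reciprocal of a Gaussian\<close>
  define h where "h = (\<lambda>y. ?F y * of_real (gaussian (- ?s) y))"
  have F': "vderiv ?F y = - (of_real (y / (2 * t)) * ?F y)" if y: "y \<noteq> 0" for y
  proof -
    have "?F (- y) = ?F y"
      using dunkl_transform_reflect[OF k schwartz_measurable[OF gS], of y] by simp
    hence "vderiv ?F y = - \<i> * dunkl_transform k (\<lambda>x. of_real x * ?g x) y"
      using dunkl_transform_mult_x[OF k gS y] by simp
    also have "\<dots> = - (of_real (y / (2 * t)) * ?F y)"
      unfolding dunkl_transform_x_gaussian[OF k t] by (simp flip: mult.assoc)
    finally show ?thesis .
  qed
  have h': "(h has_vector_derivative 0) (at y)" if y: "y \<noteq> 0" for y
  proof -
    have F: "(?F has_vector_derivative - (of_real (y / (2 * t)) * ?F y)) (at y)"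
      using dunkl_transform_deriv[OF k gS, of y] vector_derivative_at[OF dunkl_transform_deriv[OF k gS, of y]] F'[OF y]
      by simp
    show ?thesis unfolding h_def
    proof (rule has_vector_derivative_eq_rhs[OF has_vector_derivative_mult[OF F gaussian_deriv]])
      have "- (2 * (- ?s) * y) = y / (2 * t)" using t by (simp add: field_simps)
      thus "?F y * of_real (- (2 * (- ?s) * y) * gaussian (- ?s) y) + - (of_real (y / (2 * t)) * ?F y) * of_real (gaussian (- ?s) y) = 0"
        by simp
    qed
  qed
  have conth: "continuous_on UNIV h"
    unfolding h_def
    by (intro continuous_on_mult continuous_on_dunkl_transform schwartz_integrable k gS) (use t in \<open>auto simp: gaussian_def intro!: continuous_intros\<close>)
  have "h y = h 0"
    by (rule has_derivative_zero_unique_strong_convex[of UNIV "{0}" h 0 "h 0"])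
       (use h' conth in \<open>auto simp: has_vector_derivative_def\<close>)
  moreover have "h 0 = of_real (gaussian_mass k t)"
    by (simp add: h_def dunkl_transform_def dunkl_exp_0[OF k] gaussian_mass_def)
  moreover have "gaussian (- ?s) y * gaussian ?s y = 1"
    by (simp add: gaussian_def flip: exp_add)
  ultimately show ?thesis
    by (metis h_def mult.assoc mult.right_neutral of_real_1 of_real_mult)
qed

lemma gaussian_mass_scale:
  assumes k: "k \<ge> - 1 / 2" and t: "t > 0"
  shows "gaussian_mass k 1 = t powr (k + 1) * gaussian_mass k t"
proof -
  have "gaussian_mass k 1 = (LINT x|lborel. dunkl_density k x * gaussian 1 x)"
    unfolding gaussian_mass_def by (subst integral_dunkl_measure[OF k]) auto
  also have "\<dots> = sqrt t * (LINT x|lborel. dunkl_density k (sqrt t * x) * gaussian 1 (sqrt t * x))"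
    using lborel_integral_real_affine[of "sqrt t" "\<lambda>x. dunkl_density k x * gaussian 1 x" 0] t by simp
  also have "(\<lambda>x. dunkl_density k (sqrt t * x) * gaussian 1 (sqrt t * x)) = (\<lambda>x. sqrt t powr (2 * k + 1) * (dunkl_density k x * gaussian t x))"
    using t by (auto simp: dunkl_density_def gaussian_def abs_mult powr_mult power_mult_distrib)
  also have "sqrt t * (LINT x|lborel. sqrt t powr (2 * k + 1) * (dunkl_density k x * gaussian t x))
      = (sqrt t * sqrt t powr (2 * k + 1)) * (LINT x|lborel. dunkl_density k x * gaussian t x)"
    by simp
  also have "sqrt t * sqrt t powr (2 * k + 1) = t powr (k + 1)"
  proof -
    have "sqrt t * sqrt t powr (2 * k + 1) = sqrt t powr (2 * (k + 1))"
      using t powr_add[of "sqrt t" 1 "2 * k + 1"] by (simp add: algebra_simps)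
    also have "\<dots> = t powr (k + 1)" using t by (simp add: powr_half_sqrt[symmetric] powr_powr add_divide_distrib)
    finally show ?thesis .
  qed
  also have "(LINT x|lborel. dunkl_density k x * gaussian t x) = gaussian_mass k t"
    unfolding gaussian_mass_def by (subst integral_dunkl_measure[OF k]) auto
  finally show ?thesis .
qed

text \<open>The density is positive outside the origin, so the measure has the null sets of Lebesgue measure and
  every nonempty open set has positive measure.\<close>

lemma continuous_nonneg_integral_zero:
  fixes h :: "real \<Rightarrow> real"
  assumes k: "k \<ge> - 1 / 2" and cont: "continuous_on UNIV h" and nonneg: "\<And>x. 0 \<le> h x"
    and int: "integrable (dunkl_measure k) h" and zero: "(LINT x|dunkl_measure k. h x) = 0"
  shows "h x = 0"
proof (rule ccontr)
  assume "h x \<noteq> 0"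
  have [measurable]: "h \<in> borel_measurable borel" using cont by (rule borel_measurable_continuous_onI)
  have "AE x in dunkl_measure k. h x = 0"
    using integral_nonneg_eq_0_iff_AE[OF int] nonneg zero by simp
  hence "AE x in lborel. 0 < dunkl_density k x \<longrightarrow> h x = 0"
    unfolding dunkl_measure_eq by (subst (asm) AE_density) auto
  moreover have "AE x in lborel. x \<noteq> (0 :: real)" by (rule AE_lborel_singleton)
  ultimately have "AE x in lborel. h x = 0"
    by eventually_elim (use dunkl_density_pos[OF k] in auto)
  hence "{x \<in> space lborel. h x \<noteq> 0} \<in> null_sets lborel"
    by (rule AE_iff_null[THEN iffD1, rotated]) auto
  hence "negligible {x. h x \<noteq> 0}"
    by (simp add: negligible_iff_null_sets null_sets_completionI)
  moreover have "open {x. h x \<noteq> 0}"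
    using cont by (intro open_Collect_neq) auto
  ultimately show False using open_not_negligible[of "{x. h x \<noteq> 0}"] \<open>h x \<noteq> 0\<close> by blast
qed

lemma gaussian_mass_neq_0:
  assumes k: "k \<ge> - 1 / 2" and t: "t > 0"
  shows "gaussian_mass k t \<noteq> 0"
proof
  assume "gaussian_mass k t = 0"
  have "continuous_on UNIV (gaussian t)" unfolding gaussian_def by (intro continuous_intros)
  from continuous_nonneg_integral_zero[OF k this less_imp_le[OF gaussian_pos] gaussian_integrable[OF k t]]
  have "(LINT x|dunkl_measure k. gaussian t x) = 0 \<Longrightarrow> gaussian t 0 = 0" .
  thus False using \<open>gaussian_mass k t = 0\<close> by (simp add: gaussian_mass_def)
qed

text \<open>The constant \<open>\<kappa>\<close> of the inversion formula. Its value is \<open>1\<close> for the given normalisation of the measure.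
  This formula avoids evaluating the Gamma integral and is what the scaling argument below produces.\<close>

definition inversion_const :: "real \<Rightarrow> complex" where
  "inversion_const k = of_real (4 powr (k + 1) * (gaussian_mass k 1)\<^sup>2)"

lemma inversion_const_neq_0: "k \<ge> - 1 / 2 \<Longrightarrow> inversion_const k \<noteq> 0"
  using gaussian_mass_neq_0[of k 1] by (simp add: inversion_const_def)

text \<open>The Gaussian with parameter \<open>t\<close> is transformed to a multiple of the one with parameter \<open>1 / (4t)\<close>,
  and back. By scaling, the mass is proportional to \<open>t\<^sup>-\<^sup>(\<^sup>k\<^sup>+\<^sup>1\<^sup>)\<close>, so the product of the two factors is the same
  for all \<open>t\<close>; this is what makes one inversion constant work for all Gaussians.\<close>

lemma gaussian_mass_dual:
  assumes k: "k \<ge> - 1 / 2" and t: "t > 0"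
  shows "of_real (gaussian_mass k t) * of_real (gaussian_mass k (1 / (4 * t))) = inversion_const k"
proof -
  define s where "s = 1 / (4 * t)"
  have s: "s > 0" using t by (simp add: s_def)
  have "(gaussian_mass k 1)\<^sup>2 = (t powr (k + 1) * gaussian_mass k t) * (s powr (k + 1) * gaussian_mass k s)"
    using gaussian_mass_scale[OF k t] gaussian_mass_scale[OF k s] by (simp add: power2_eq_square)
  also have "\<dots> = (t * s) powr (k + 1) * (gaussian_mass k t * gaussian_mass k s)"
    using t s by (simp add: powr_mult)
  also have "t * s = 1 / 4" using t by (simp add: s_def)
  finally have "4 powr (k + 1) * (gaussian_mass k 1)\<^sup>2 = (4 powr (k + 1) * (1 / 4) powr (k + 1)) * (gaussian_mass k t * gaussian_mass k s)"
    by simp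
  also have "4 powr (k + 1) * (1 / 4) powr (k + 1) = (1::real)" by (simp flip: powr_mult)
  finally show ?thesis unfolding inversion_const_def s_def by simp
qed

lemma dunkl_transform_twice_gaussian:
  assumes k: "k \<ge> - 1 / 2" and t: "t > 0"
  shows "dunkl_transform k (dunkl_transform k (\<lambda>x. of_real (gaussian t x))) x = inversion_const k * of_real (gaussian t x)"
proof -
  have s: "1 / (4 * t) > 0" using t by simp
  have "dunkl_transform k (\<lambda>x. of_real (gaussian t x)) = (\<lambda>y. of_real (gaussian_mass k t) * of_real (gaussian (1 / (4 * t)) y))"
    by (rule ext) (rule dunkl_transform_gaussian[OF k t])
  thus ?thesis
    unfolding gaussian_mass_dual[OF k t, symmetric] using t
    by (simp add: dunkl_transform_cmult dunkl_transform_gaussian[OF k s] mult.assoc)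
qed

lemma dunkl_transform_twice_x_gaussian:
  assumes k: "k \<ge> - 1 / 2" and t: "t > 0"
  shows "dunkl_transform k (dunkl_transform k (\<lambda>x. of_real x * of_real (gaussian t x))) x = - (inversion_const k * (of_real x * of_real (gaussian t x)))"
proof -
  have s: "1 / (4 * t) > 0" using t by simp
  have "dunkl_transform k (\<lambda>x. of_real x * of_real (gaussian t x)) =
     (\<lambda>y. (- \<i> / of_real (2 * t) * of_real (gaussian_mass k t)) * (of_real y * of_real (gaussian (1 / (4 * t)) y)))"
    by (rule ext) (simp add: dunkl_transform_x_gaussian[OF k t] dunkl_transform_gaussian[OF k t])
  hence "dunkl_transform k (dunkl_transform k (\<lambda>x. of_real x * of_real (gaussian t x))) x =
     (- \<i> / of_real (2 * t) * of_real (gaussian_mass k t)) * (- (\<i> * of_real (x / (2 * (1 / (4 * t))))) * (of_real (gaussian_mass k (1 / (4 * t))) * of_real (gaussian (1 / (4 * (1 / (4 * t)))) x)))"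
    by (simp only: dunkl_transform_cmult dunkl_transform_x_gaussian[OF k s] dunkl_transform_gaussian[OF k s])
  also have "\<dots> = - ((of_real (gaussian_mass k t) * of_real (gaussian_mass k (1 / (4 * t)))) * (of_real x * of_real (gaussian t x)))"
    using t by (simp add: field_simps)
  finally show ?thesis unfolding gaussian_mass_dual[OF k t] .
qed

section \<open>Inversion and Plancherel\<close>

lemma gaussian_le_1: "t \<ge> 0 \<Longrightarrow> gaussian t x \<le> 1"
  by (simp add: gaussian_def)

lemma gaussian_power: "gaussian 1 x ^ n = gaussian (real n) x"
  by (simp add: gaussian_def flip: exp_of_nat_mult)

lemma gaussian_mult: "gaussian s x * gaussian t x = gaussian (s + t) x"
  by (simp add: gaussian_def algebra_simps flip: exp_add)

lemma integrable_bounded_mult_gaussian: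
  fixes h :: "real \<Rightarrow> real"
  assumes k: "k \<ge> - 1 / 2" and h: "h \<in> borel_measurable borel" and B: "\<And>x. \<bar>h x\<bar> \<le> B" and t: "t > 0"
  shows "integrable (dunkl_measure k) (\<lambda>x. h x * gaussian t x)"
  by (rule integrable_mult_bounded(2)[OF gaussian_integrable[OF k t]]) (use h B in auto)

text \<open>With \<open>s = exp(- x\<^sup>2)\<close> the hypothesis says that \<open>h s\<close> is orthogonal to every polynomial in \<open>s\<close>, hence,
  by Weierstrass approximation on \<open>[0, 1]\<close>, to every continuous function of \<open>s\<close>. An even bounded \<open>h\<close>
  makes \<open>s h\<close> such a function, since \<open>x\<^sup>2 = - ln s\<close>; so the integral of \<open>(h s)\<^sup>2\<close> is zero. The factor \<open>s\<close> makes
  the function continuous at \<open>s = 0\<close>, which corresponds to \<open>x = \<plusminus>\<infinity>\<close>.\<close>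

lemma even_eq_0_of_gaussian_moments:
  fixes h :: "real \<Rightarrow> real"
  assumes k: "k \<ge> - 1 / 2" and cont: "continuous_on UNIV h" and B: "\<And>x. \<bar>h x\<bar> \<le> B"
    and even: "\<And>x. h (- x) = h x"
    and orth: "\<And>n. n > 0 \<Longrightarrow> (LINT x|dunkl_measure k. h x * gaussian (real n) x) = 0"
  shows "h x = 0"
proof -
  let ?M = "dunkl_measure k"
  have hm [measurable]: "h \<in> borel_measurable borel" using cont by (rule borel_measurable_continuous_onI)
  note intG = integrable_bounded_mult_gaussian[OF k hm B]
  define s where "s = gaussian 1"
  have [measurable]: "s \<in> borel_measurable borel" unfolding s_def by measurable
  have s01: "0 < s x" "s x \<le> 1" for x by (auto simp: s_def gaussian_pos gaussian_le_1)
  have int_hs: "integrable ?M (\<lambda>x. h x * s x)" using intG[of 1] by (simp add: s_def)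
  have intS: "integrable ?M (\<lambda>x. (h x * s x) * q x)"
    if "q \<in> borel_measurable borel" and "\<And>x. \<bar>q x\<bar> \<le> C" for q C
    by (rule integrable_mult_bounded(1)[OF int_hs]) (use that in auto)
  have q01: "\<bar>s x ^ i * (1 - s x) ^ j\<bar> \<le> 1" for x i j
    using s01[of x] by (auto simp: abs_mult power_abs intro!: mult_le_one power_le_one)
  have intP: "integrable ?M (\<lambda>x. (h x * s x) * (s x ^ i * (1 - s x) ^ j))" for i j
    by (rule intS[OF _ q01]) measurable
  have mono: "(LINT x|?M. (h x * s x) * (s x ^ i * (1 - s x) ^ j)) = 0" for i j
  proof (induction j arbitrary: i)
    case 0
    have "s x * s x ^ i = gaussian (real (Suc i)) x" for x
      unfolding s_def gaussian_power gaussian_mult by simp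
    thus ?case using orth[of "Suc i"] by (simp add: mult.assoc)
  next
    case (Suc j)
    have "(LINT x|?M. (h x * s x) * (s x ^ i * (1 - s x) ^ Suc j)) =
          (LINT x|?M. (h x * s x) * (s x ^ i * (1 - s x) ^ j) - (h x * s x) * (s x ^ Suc i * (1 - s x) ^ j))"
      by (intro Bochner_Integration.integral_cong) (auto simp: algebra_simps)
    also have "\<dots> = 0"
      by (simp only: Bochner_Integration.integral_diff[OF intP intP] Suc.IH diff_self)
    finally show ?case .
  qed
  \<comment> \<open>\<open>w\<close> expresses \<open>s h\<close> as a function of \<open>s\<close>.\<close>
  define w where "w = (\<lambda>r. if r \<le> 0 then 0 else r * h (sqrt (- ln r)))"
  have chis: "w (s x) = s x * h x" for x
  proof -
    have "h \<bar>x\<bar> = h x" using even by (cases "x \<ge> 0") auto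
    thus ?thesis using s01[of x] by (simp add: w_def s_def gaussian_def not_le)
  qed
  have B0: "B \<ge> 0" using B[of 0] by linarith
  have chiB: "\<bar>w r\<bar> \<le> B * \<bar>r\<bar>" for r
    using B[of "sqrt (- ln r)"] B0 by (auto simp: w_def abs_mult mult.commute mult_left_mono mult_nonneg_nonpos)
  have contw: "continuous_on {0..1} w"
    unfolding continuous_on_eq_continuous_within
  proof
    fix r :: real assume "r \<in> {0..1}"
    have "isCont w r"
    proof (cases "r = 0")
      case True
      have "(w \<longlongrightarrow> 0) (at 0)"
      proof (rule Lim_null_comparison)
        show "\<forall>\<^sub>F r in at 0. norm (w r) \<le> B * \<bar>r\<bar>" using chiB by simp
        show "((\<lambda>r. B * \<bar>r\<bar>) \<longlongrightarrow> 0) (at 0)" by (auto intro!: tendsto_eq_intros)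
      qed
      thus ?thesis using True by (simp add: isCont_def w_def)
    next
      case False
      hence "r > 0" using \<open>r \<in> {0..1}\<close> by auto
      have "isCont (\<lambda>r. sqrt (- ln r)) r" using \<open>r > 0\<close> by (intro continuous_intros) auto
      moreover have "isCont h (sqrt (- ln r))" using cont by (simp add: continuous_on_eq_continuous_at)
      ultimately have "isCont (\<lambda>r. h (sqrt (- ln r))) r" by (rule isCont_o2)
      hence "isCont (\<lambda>r. r * h (sqrt (- ln r))) r" by (intro continuous_intros)
      moreover have "\<forall>\<^sub>F r in nhds r. w r = r * h (sqrt (- ln r))"
        using eventually_nhds_in_open[of "{0<..}" r] \<open>r > 0\<close> by (auto elim!: eventually_mono simp: w_def)
      ultimately show ?thesis by (simp add: isCont_cong)
    qed
    thus "continuous (at r within {0..1}) w" by (rule continuous_at_imp_continuous_at_within)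
  qed
  have chim: "(\<lambda>x. w (s x)) \<in> borel_measurable borel" unfolding chis by measurable
  have chisB: "\<bar>w (s x)\<bar> \<le> B" for x
    using chiB[of "s x"] s01[of x] B0 mult_left_le[of "s x" B] by (simp add: abs_of_pos)
  define I where "I = (LINT x|?M. \<bar>h x * s x\<bar>)"
  have intI: "integrable ?M (\<lambda>x. \<bar>h x * s x\<bar>)" using int_hs by simp
  have small: "\<bar>LINT x|?M. (h x * s x) * w (s x)\<bar> \<le> e * I" if e: "e > 0" for e
  proof -
    obtain N where N: "\<forall>n x. N \<le> n \<and> x \<in> {0..1} \<longrightarrow> \<bar>w x - (\<Sum>j\<le>n. w (j/n) * Bernstein n j x)\<bar> < e"
      using Bernstein_Weierstrass[OF contw e] by blast
    define Q where "Q = (\<lambda>x. \<Sum>j\<le>N. w (real j / real N) * Bernstein N j x)"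
    have Q: "\<bar>w (s x) - Q (s x)\<bar> \<le> e" for x
      using N[rule_format, of N "s x"] s01[of x] by (auto simp: Q_def less_imp_le)
    have Qeq: "(h x * s x) * Q (s x) = (\<Sum>j\<le>N. (w (real j / real N) * real (N choose j)) * ((h x * s x) * (s x ^ j * (1 - s x) ^ (N - j))))" for x
      by (simp add: Q_def Bernstein_def sum_distrib_left mult_ac)
    have intQ: "integrable ?M (\<lambda>x. (h x * s x) * Q (s x))"
      unfolding Qeq by (intro Bochner_Integration.integrable_sum integrable_mult_right intP)
    have "(LINT x|?M. (h x * s x) * Q (s x)) = 0"
      unfolding Qeq
      by (subst Bochner_Integration.integral_sum)
         (simp_all only: integral_mult_right_zero mono integrable_mult_right intP mult_zero_right sum.neutral_const)
    hence "(LINT x|?M. (h x * s x) * w (s x)) = (LINT x|?M. (h x * s x) * w (s x) - (h x * s x) * Q (s x))"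
      using intQ intS[OF chim chisB] by (subst Bochner_Integration.integral_diff) auto
    also have "\<bar>\<dots>\<bar> \<le> (LINT x|?M. e * \<bar>h x * s x\<bar>)"
    proof -
      have "norm (LINT x|?M. (h x * s x) * w (s x) - (h x * s x) * Q (s x)) \<le> (LINT x|?M. e * \<bar>h x * s x\<bar>)"
      proof (rule Bochner_Integration.integral_norm_bound_integral)
        show "integrable ?M (\<lambda>x. (h x * s x) * w (s x) - (h x * s x) * Q (s x))"
          by (intro Bochner_Integration.integrable_diff intQ intS[OF chim chisB])
        show "integrable ?M (\<lambda>x. e * \<bar>h x * s x\<bar>)" by (intro integrable_mult_right intI)
        fix x
        have "norm ((h x * s x) * w (s x) - (h x * s x) * Q (s x)) = \<bar>h x * s x\<bar> * \<bar>w (s x) - Q (s x)\<bar>"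
          by (simp only: real_norm_def abs_mult[symmetric] right_diff_distrib)
        also have "\<dots> \<le> \<bar>h x * s x\<bar> * e" by (intro mult_left_mono Q) auto
        finally show "norm ((h x * s x) * w (s x) - (h x * s x) * Q (s x)) \<le> e * \<bar>h x * s x\<bar>" by (simp only: mult.commute)
      qed
      thus ?thesis by simp
    qed
    finally show ?thesis by (simp add: I_def)
  qed
  have I0: "I \<ge> 0" unfolding I_def by (intro Bochner_Integration.integral_nonneg) auto
  have "(LINT x|?M. (h x * s x) * w (s x)) = 0"
  proof (rule ccontr)
    assume "(LINT x|?M. (h x * s x) * w (s x)) \<noteq> 0"
    hence p: "\<bar>LINT x|?M. (h x * s x) * w (s x)\<bar> > 0" by simp
    define J where "J = \<bar>LINT x|?M. (h x * s x) * w (s x)\<bar>"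
    have "J \<le> J / (2 * (I + 1)) * I" unfolding J_def using p I0 by (intro small) auto
    also have "\<dots> \<le> J / 2"
      using p[folded J_def] I0 by (simp add: field_simps)
    finally show False using p by (simp add: J_def)
  qed
  hence zero: "(LINT x|?M. (h x * s x)\<^sup>2) = 0" by (simp add: chis power2_eq_square mult_ac)
  have "(h x * s x)\<^sup>2 = 0"
  proof (rule continuous_nonneg_integral_zero[OF k _ _ _ zero])
    show "continuous_on UNIV (\<lambda>x. (h x * s x)\<^sup>2)" unfolding s_def gaussian_def by (intro continuous_intros cont)
    show "integrable ?M (\<lambda>x. (h x * s x)\<^sup>2)" using intS[OF chim chisB] by (simp add: chis power2_eq_square mult_ac)
  qed simp
  thus ?thesis using s01[of x] by simp
qed

text \<open>The even part of \<open>h\<close> is covered by the previous lemma directly, the odd part after multiplication by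
  \<open>x exp(- x\<^sup>2)\<close>, which makes it even and keeps it bounded.\<close>

lemma eq_0_of_gaussian_moments_real:
  fixes h :: "real \<Rightarrow> real"
  assumes k: "k \<ge> - 1 / 2" and cont: "continuous_on UNIV h" and B: "\<And>x. \<bar>h x\<bar> \<le> B"
    and even: "\<And>n. n > 0 \<Longrightarrow> (LINT x|dunkl_measure k. h x * gaussian (real n) x) = 0"
    and odd: "\<And>n. n > 0 \<Longrightarrow> (LINT x|dunkl_measure k. h x * (x * gaussian (real n) x)) = 0"
  shows "h x = 0"
proof -
  let ?M = "dunkl_measure k"
  have hm [measurable]: "h \<in> borel_measurable borel" using cont by (rule borel_measurable_continuous_onI)
  have contm: "continuous_on UNIV (\<lambda>x. h (- x))"
    by (rule continuous_on_compose2[OF cont]) (auto intro!: continuous_intros)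
  have e: "h x + h (- x) = 0" for x
  proof (rule even_eq_0_of_gaussian_moments[where h = "\<lambda>x. h x + h (- x)", OF k])
    show "continuous_on UNIV (\<lambda>x. h x + h (- x))" by (intro continuous_intros cont contm)
    show "\<bar>h x + h (- x)\<bar> \<le> 2 * B" for x using B[of x] B[of "- x"] by linarith
    fix n :: nat assume n: "n > 0"
    have "(LINT x|?M. (h x + h (- x)) * gaussian (real n) x) = (LINT x|?M. h x * gaussian (real n) x) + (LINT x|?M. h (- x) * gaussian (real n) x)"
      unfolding distrib_right using n B
      by (intro Bochner_Integration.integral_add integrable_bounded_mult_gaussian[OF k, of _ B]) auto
    also have "(LINT x|?M. h (- x) * gaussian (real n) x) = (LINT x|?M. h x * gaussian (real n) x)"
      using integral_dunkl_reflect[OF k, of "\<lambda>x. h x * gaussian (real n) x"] by simp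
    finally show "(LINT x|?M. (h x + h (- x)) * gaussian (real n) x) = 0" using even[OF n] by simp
  qed simp
  have o: "(h x - h (- x)) * (x * gaussian 1 x) = 0" for x
  proof -
    obtain C where "\<forall>x. \<bar>x\<bar> ^ 1 * gaussian 1 x \<le> C" using gaussian_decay[of 1 1] by auto
    hence C: "\<bar>x * gaussian 1 x\<bar> \<le> C" for x using gaussian_pos[of 1 x] by (simp add: abs_mult)
    have B0: "B \<ge> 0" using B[of 0] by linarith
    have bnd: "\<bar>u * (x * gaussian 1 x)\<bar> \<le> D * C" if "\<bar>u\<bar> \<le> D" for u x D
      unfolding abs_mult[of u] using that C[of x] by (intro mult_mono) auto
    show ?thesis
    proof (rule even_eq_0_of_gaussian_moments[where h = "\<lambda>x. (h x - h (- x)) * (x * gaussian 1 x)", OF k])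
      show "continuous_on UNIV (\<lambda>x. (h x - h (- x)) * (x * gaussian 1 x))"
        unfolding gaussian_def by (intro continuous_intros cont contm)
      show "\<bar>(h x - h (- x)) * (x * gaussian 1 x)\<bar> \<le> (2 * B) * C" for x
        using B[of x] B[of "- x"] by (intro bnd) linarith
      show "(h (- x) - h (- (- x))) * (- x * gaussian 1 (- x)) = (h x - h (- x)) * (x * gaussian 1 x)" for x
        by (simp add: algebra_simps)
      fix n :: nat assume n: "n > 0"
      have "(LINT x|?M. (h x - h (- x)) * (x * gaussian 1 x) * gaussian (real n) x) =
         (LINT x|?M. (h x * (x * gaussian 1 x)) * gaussian (real n) x - (h (- x) * (x * gaussian 1 x)) * gaussian (real n) x)"
        by (simp add: left_diff_distrib)
      also have "\<dots> = (LINT x|?M. (h x * (x * gaussian 1 x)) * gaussian (real n) x) - (LINT x|?M. (h (- x) * (x * gaussian 1 x)) * gaussian (real n) x)"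
        using n B by (intro Bochner_Integration.integral_diff integrable_bounded_mult_gaussian[OF k, of _ "B * C"] bnd) auto
      also have "(LINT x|?M. (h (- x) * (x * gaussian 1 x)) * gaussian (real n) x) = - (LINT x|?M. (h x * (x * gaussian 1 x)) * gaussian (real n) x)"
        using integral_dunkl_reflect[OF k, of "\<lambda>x. (h x * (x * gaussian 1 x)) * gaussian (real n) x"] by simp
      also have "(\<lambda>x. (h x * (x * gaussian 1 x)) * gaussian (real n) x) = (\<lambda>x. h x * (x * gaussian (real (Suc n)) x))"
        using gaussian_mult[of 1 _ "real n"] by (simp add: mult.assoc)
      finally show "(LINT x|?M. (h x - h (- x)) * (x * gaussian 1 x) * gaussian (real n) x) = 0"
        using odd[of "Suc n"] by simp
    qed
  qed
  show ?thesis using o[of x] e[of x] e[of 0] gaussian_pos[of 1 x] by (cases "x = 0") auto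
qed

lemma eq_0_of_gaussian_moments:
  fixes u :: "real \<Rightarrow> complex"
  assumes k: "k \<ge> - 1 / 2" and cont: "continuous_on UNIV u" and B: "\<And>x. norm (u x) \<le> B"
    and even: "\<And>n. n > 0 \<Longrightarrow> (LINT x|dunkl_measure k. u x * of_real (gaussian (real n) x)) = 0"
    and odd: "\<And>n. n > 0 \<Longrightarrow> (LINT x|dunkl_measure k. u x * (of_real x * of_real (gaussian (real n) x))) = 0"
  shows "u x = 0"
proof -
  let ?M = "dunkl_measure k"
  have um [measurable]: "u \<in> borel_measurable borel" using cont by (rule borel_measurable_continuous_onI)
  have int: "integrable ?M (\<lambda>x. u x * g x)" if g: "g \<in> schwartz_space" for g
    by (rule integrable_mult_bounded(2)[OF schwartz_integrable[OF k g] _ B]) measurable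
  have g: "(\<lambda>x. of_real (gaussian (real n) x)) \<in> schwartz_space" "(\<lambda>x. of_real x * of_real (gaussian (real n) x)) \<in> schwartz_space" if "n > 0" for n
    using that by (auto intro!: schwartz_mult_x gaussian_schwartz)
  have "Re (u x) = 0"
  proof (rule eq_0_of_gaussian_moments_real[where h = "\<lambda>x. Re (u x)", OF k])
    show "continuous_on UNIV (\<lambda>x. Re (u x))" by (intro continuous_intros cont)
    show "\<bar>Re (u x)\<bar> \<le> B" for x using abs_Re_le_cmod[of "u x"] B[of x] by linarith
    fix n :: nat assume n: "n > 0"
    show "(LINT x|?M. Re (u x) * gaussian (real n) x) = 0"
      using integral_Re[OF int[OF g(1)[OF n]]] even[OF n] by simp
    show "(LINT x|?M. Re (u x) * (x * gaussian (real n) x)) = 0"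
      using integral_Re[OF int[OF g(2)[OF n]]] odd[OF n] by simp
  qed
  moreover have "Im (u x) = 0"
  proof (rule eq_0_of_gaussian_moments_real[where h = "\<lambda>x. Im (u x)", OF k])
    show "continuous_on UNIV (\<lambda>x. Im (u x))" by (intro continuous_intros cont)
    show "\<bar>Im (u x)\<bar> \<le> B" for x using abs_Im_le_cmod[of "u x"] B[of x] by linarith
    fix n :: nat assume n: "n > 0"
    show "(LINT x|?M. Im (u x) * gaussian (real n) x) = 0"
      using integral_Im[OF int[OF g(1)[OF n]]] even[OF n] by simp
    show "(LINT x|?M. Im (u x) * (x * gaussian (real n) x)) = 0"
      using integral_Im[OF int[OF g(2)[OF n]]] odd[OF n] by simp
  qed
  ultimately show ?thesis by (simp add: complex_eq_iff)
qed

text \<open>Move both transforms from \<open>g\<close> to the test function. On the Gaussians and their multiples by \<open>x\<close> the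
  formula is explicit, and they suffice to identify bounded continuous functions.\<close>

theorem dunkl_inversion:
  assumes k: "k \<ge> - 1 / 2" and g: "g \<in> schwartz_space"
  shows "dunkl_transform k (dunkl_transform k g) (- x) = inversion_const k * g x"
proof -
  let ?M = "dunkl_measure k"
  let ?F = "dunkl_transform k"
  have intF: "integrable ?M (?F g)" by (rule dunkl_transform_integrable[OF k g])
  have intg: "integrable ?M g" by (rule schwartz_integrable[OF k g])
  define v where "v = (\<lambda>x. ?F (?F g) (- x))"
  have contv: "continuous_on UNIV v"
    unfolding v_def
    by (rule continuous_on_compose2[OF continuous_on_dunkl_transform[OF k intF]]) (auto intro!: continuous_intros)
  have [measurable]: "v \<in> borel_measurable borel" using contv by (rule borel_measurable_continuous_onI)
  have [measurable]: "g \<in> borel_measurable borel" by (rule schwartz_measurable[OF g])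
  obtain C where C: "\<And>x. norm (g x) \<le> C" using schwartz_bounded[OF g] by blast
  define D where "D = (LINT x|?M. norm (?F g x))"
  have D: "norm (v x) \<le> D" for x unfolding v_def D_def by (rule dunkl_transform_norm_le[OF k intF])
  have pair: "(LINT x|?M. v x * \<phi> x) = inversion_const k * (LINT x|?M. g x * \<phi> x)"
    if \<phi>: "\<phi> \<in> schwartz_space" and tw: "\<And>x. ?F (?F \<phi>) (- x) = inversion_const k * \<phi> x" for \<phi>
  proof -
    have [measurable]: "\<phi> \<in> borel_measurable borel" by (rule schwartz_measurable[OF \<phi>])
    let ?r = "\<lambda>x. \<phi> (- x)"
    have r: "?r \<in> schwartz_space" by (rule schwartz_reflect[OF \<phi>])
    have Fr: "?F ?r = (\<lambda>y. ?F \<phi> (- y))" by (rule ext) (rule dunkl_transform_reflect[OF k schwartz_measurable[OF \<phi>]])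
    have "(LINT x|?M. v x * \<phi> x) = (LINT x|?M. ?F (?F g) x * ?r x)"
    proof -
      have m: "(\<lambda>x. v x * \<phi> x) \<in> borel_measurable borel" by measurable
      show ?thesis using integral_dunkl_reflect[OF k m] by (simp add: v_def)
    qed
    also have "\<dots> = (LINT y|?M. ?F g y * ?F ?r y)"
      by (rule dunkl_transform_swap[OF k intF schwartz_integrable[OF k r]])
    also have "\<dots> = (LINT x|?M. g x * ?F (?F ?r) x)"
      by (rule dunkl_transform_swap[OF k intg dunkl_transform_integrable[OF k r]])
    also have "?F (?F ?r) = (\<lambda>x. inversion_const k * \<phi> x)"
      unfolding Fr using dunkl_transform_reflect[OF k dunkl_transform_measurable[OF k \<phi>]] tw by auto
    also have "(LINT x|?M. g x * (inversion_const k * \<phi> x)) = inversion_const k * (LINT x|?M. g x * \<phi> x)"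
      by (simp add: mult.left_commute)
    finally show ?thesis .
  qed
  have orth: "(LINT x|?M. (v x - inversion_const k * g x) * \<phi> x) = 0"
    if \<phi>: "\<phi> \<in> schwartz_space" and tw: "\<And>x. ?F (?F \<phi>) (- x) = inversion_const k * \<phi> x" for \<phi>
  proof -
    have "(LINT x|?M. (v x - inversion_const k * g x) * \<phi> x) = (LINT x|?M. v x * \<phi> x - inversion_const k * (g x * \<phi> x))"
      by (simp add: algebra_simps)
    also have "\<dots> = (LINT x|?M. v x * \<phi> x) - inversion_const k * (LINT x|?M. g x * \<phi> x)"
    proof -
      have "integrable ?M (\<lambda>x. v x * \<phi> x)"
        by (rule integrable_mult_bounded(2)[OF schwartz_integrable[OF k \<phi>] _ D]) measurable
      moreover have "integrable ?M (\<lambda>x. g x * \<phi> x)"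
        by (rule integrable_mult_bounded(2)[OF schwartz_integrable[OF k \<phi>] _ C]) measurable
      ultimately show ?thesis by (subst Bochner_Integration.integral_diff) auto
    qed
    also have "\<dots> = 0" using pair[OF \<phi> tw] by simp
    finally show ?thesis .
  qed
  have "v x - inversion_const k * g x = 0"
  proof (rule eq_0_of_gaussian_moments[where u = "\<lambda>x. v x - inversion_const k * g x", OF k])
    show "continuous_on UNIV (\<lambda>x. v x - inversion_const k * g x)"
      by (intro continuous_intros contv schwartz_continuous_on g)
    show "norm (v x - inversion_const k * g x) \<le> D + norm (inversion_const k) * C" for x
    proof -
      have "norm (v x - inversion_const k * g x) \<le> norm (v x) + norm (inversion_const k * g x)" by (rule norm_triangle_ineq4)
      also have "\<dots> \<le> D + norm (inversion_const k) * C"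
        using D[of x] C[of x] by (auto simp: norm_mult intro!: add_mono mult_left_mono)
      finally show ?thesis .
    qed
    fix n :: nat assume n: "n > 0"
    hence t: "real n > 0" by simp
    show "(LINT x|?M. (v x - inversion_const k * g x) * of_real (gaussian (real n) x)) = 0"
      using gaussian_schwartz[OF t] dunkl_transform_twice_gaussian[OF k t] by (intro orth) auto
    show "(LINT x|?M. (v x - inversion_const k * g x) * (of_real x * of_real (gaussian (real n) x))) = 0"
      using schwartz_mult_x[OF gaussian_schwartz[OF t]] dunkl_transform_twice_x_gaussian[OF k t] by (intro orth) auto
  qed
  thus ?thesis by (simp add: v_def)
qed

text \<open>The conjugated inversion formula writes \<open>cnj h\<close> as a transform, which is then moved to \<open>u\<close>.\<close>

lemma dunkl_plancherel:
  assumes k: "k \<ge> - 1 / 2" and u: "u \<in> schwartz_space" and h: "h \<in> schwartz_space"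
  shows "cnj (inversion_const k) * (LINT x|dunkl_measure k. u x * cnj (h x)) =
           (LINT y|dunkl_measure k. dunkl_transform k u y * cnj (dunkl_transform k h y))"
proof -
  let ?M = "dunkl_measure k"
  let ?F = "dunkl_transform k"
  have "cnj (inversion_const k) * cnj (h x) = ?F (\<lambda>y. cnj (?F h y)) x" for x
    using arg_cong[OF dunkl_inversion[OF k h, of x], of cnj] by (simp add: cnj_dunkl_transform[of k "?F h"])
  hence "(LINT x|?M. u x * ?F (\<lambda>y. cnj (?F h y)) x) = (LINT x|?M. u x * (cnj (inversion_const k) * cnj (h x)))"
    by simp
  also have "\<dots> = cnj (inversion_const k) * (LINT x|?M. u x * cnj (h x))"
    by (simp only: mult.left_commute[of _ "cnj (inversion_const k)"] integral_mult_right_zero)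
  finally show ?thesis
    using dunkl_transform_swap[OF k schwartz_integrable[OF k u], of "\<lambda>y. cnj (?F h y)"] dunkl_transform_integrable[OF k h]
    by simp
qed

section \<open>Iterates on band-limited functions\<close>

lemma dunkl_op_add:
  assumes "f \<in> schwartz_space" "g \<in> schwartz_space"
  shows "dunkl_op k (\<lambda>x. f x + g x) = (\<lambda>x. dunkl_op k f x + dunkl_op k g x)"
proof
  fix x
  have v: "vderiv (\<lambda>x. f x + g x) x = vderiv f x + vderiv g x" for x
    by (intro vector_derivative_at has_vector_derivative_add schwartz_derivative assms)
  show "dunkl_op k (\<lambda>x. f x + g x) x = dunkl_op k f x + dunkl_op k g x"
    by (simp add: dunkl_op_eq[OF schwartz_add[OF assms]] dunkl_op_eq[OF assms(1)] dunkl_op_eq[OF assms(2)]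
        odd_quotient_def v algebra_simps add_divide_distrib diff_divide_distrib)
qed

lemma dunkl_op_cmult:
  assumes "f \<in> schwartz_space"
  shows "dunkl_op k (\<lambda>x. c * f x) = (\<lambda>x. c * dunkl_op k f x)"
proof
  fix x
  have v: "vderiv (\<lambda>x. c * f x) x = c * vderiv f x" for x
    by (intro vector_derivative_at has_vector_derivative_mult_right schwartz_derivative assms)
  show "dunkl_op k (\<lambda>x. c * f x) x = c * dunkl_op k f x"
    by (simp add: dunkl_op_eq[OF schwartz_mult_const[OF assms]] dunkl_op_eq[OF assms]
        odd_quotient_def v algebra_simps diff_divide_distrib)
qed

lemma dunkl_op_reflect:
  assumes "f \<in> schwartz_space"
  shows "dunkl_op k (\<lambda>x. f (- x)) = (\<lambda>x. - 1 * dunkl_op k f (- x))"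
proof
  fix x
  have v: "vderiv (\<lambda>x. f (- x)) x = - vderiv f (- x)" for x
  proof (rule vector_derivative_at)
    have "((f \<circ> uminus) has_vector_derivative (-1) *\<^sub>R vderiv f (- x)) (at x)"
      by (intro vector_diff_chain_at schwartz_derivative[OF assms]) (auto intro!: derivative_eq_intros)
    thus "((\<lambda>x. f (- x)) has_vector_derivative - vderiv f (- x)) (at x)" by (simp add: o_def)
  qed
  have q: "odd_quotient (\<lambda>x. f (- x)) x = - odd_quotient f (- x)"
  proof (cases "x = 0")
    case False
    have "(a - b) / (2 * z) = - ((a - b) / (2 * (- z)))" for a b z :: complex by simp
    from this[of "f (- x)" "f x" "of_real x"] False show ?thesis
      by (simp add: odd_quotient_def)
  qed (simp add: odd_quotient_def v)
  show "dunkl_op k (\<lambda>x. f (- x)) x = - 1 * dunkl_op k f (- x)"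
    by (simp add: dunkl_op_eq[OF schwartz_reflect[OF assms]] dunkl_op_eq[OF assms] q v)
qed

lemma dunkl_op_mult_x:
  assumes "f \<in> schwartz_space"
  shows "dunkl_op k (\<lambda>x. of_real x * f x) = (\<lambda>x. of_real x * dunkl_op k f x + (f x + of_real (2 * k + 1) * f (- x)))"
proof
  fix x
  have v: "vderiv (\<lambda>x. of_real x * f x) x = of_real x * vderiv f x + f x" for x
    by (rule vector_derivative_at) (auto intro!: derivative_eq_intros schwartz_derivative assms)
  have q: "odd_quotient (\<lambda>x. of_real x * f x) x = of_real x * odd_quotient f x + f (- x)"
    by (cases "x = 0") (simp_all add: odd_quotient_def v field_simps)
  show "dunkl_op k (\<lambda>x. of_real x * f x) x = of_real x * dunkl_op k f x + (f x + of_real (2 * k + 1) * f (- x))"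
    unfolding dunkl_op_eq[OF schwartz_mult_x[OF assms]] dunkl_op_eq[OF assms] q v
    by (simp add: algebra_simps)
qed

lemma dunkl_iter_schwartz:
  "f \<in> schwartz_space \<Longrightarrow> (dunkl_op k ^^ n) f \<in> schwartz_space"
  by (induction n) (auto intro: dunkl_op_schwartz)

lemma dunkl_iter_add:
  assumes "f \<in> schwartz_space" "g \<in> schwartz_space"
  shows "(dunkl_op k ^^ n) (\<lambda>x. f x + g x) = (\<lambda>x. (dunkl_op k ^^ n) f x + (dunkl_op k ^^ n) g x)"
  by (induction n) (simp_all add: dunkl_op_add dunkl_iter_schwartz assms)

lemma dunkl_iter_cmult:
  assumes "f \<in> schwartz_space"
  shows "(dunkl_op k ^^ n) (\<lambda>x. c * f x) = (\<lambda>x. c * (dunkl_op k ^^ n) f x)"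
  by (induction n) (simp_all add: dunkl_op_cmult dunkl_iter_schwartz assms)

text \<open>The commutator of \<open>\<Lambda>\<close> with multiplication by \<open>x\<close> is \<open>1 + (2k + 1) R\<close>, where \<open>R\<close> is the reflection. Since
  \<open>R\<close> anticommutes with \<open>\<Lambda>\<close>, the \<open>n + 1\<close> reflection terms in the commutator with \<open>\<Lambda>\<^sup>n\<^sup>+\<^sup>1\<close> cancel in
  pairs, and at most one survives.\<close>

lemma dunkl_iter_mult_x:
  assumes "f \<in> schwartz_space"
  shows "(dunkl_op k ^^ Suc n) (\<lambda>x. of_real x * f x) x =
           of_real x * (dunkl_op k ^^ Suc n) f x + of_nat (Suc n) * (dunkl_op k ^^ n) f x
           + (if even n then of_real (2 * k + 1) * (dunkl_op k ^^ n) (\<lambda>x. f (- x)) x else 0)"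
  using assms
proof (induction n arbitrary: f)
  case 0
  show ?case by (simp add: dunkl_op_mult_x[OF 0])
next
  case (Suc n)
  let ?L = "dunkl_op k"
  let ?c = "complex_of_real (2 * k + 1)"
  have f: "f \<in> schwartz_space" by (rule Suc.prems)
  have Lf: "?L f \<in> schwartz_space" by (rule dunkl_op_schwartz[OF f])
  have fr: "(\<lambda>x. f (- x)) \<in> schwartz_space" by (rule schwartz_reflect[OF f])
  have reflect: "(?L ^^ n) (\<lambda>x. ?L f (- x)) x = - (?L ^^ Suc n) (\<lambda>x. f (- x)) x"
  proof -
    have "(\<lambda>x. ?L f (- x)) = (\<lambda>x. - 1 * ?L (\<lambda>x. f (- x)) x)"
      by (simp add: dunkl_op_reflect[OF f])
    thus ?thesis by (simp only: dunkl_iter_cmult[OF dunkl_op_schwartz[OF fr]] funpow_Suc_right o_def) simp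
  qed
  have "(?L ^^ Suc (Suc n)) (\<lambda>x. of_real x * f x) x = (?L ^^ Suc n) (\<lambda>x. of_real x * ?L f x + (f x + ?c * f (- x))) x"
    unfolding funpow_Suc_right[of "Suc n"] o_def dunkl_op_mult_x[OF f] ..
  also have "\<dots> = (?L ^^ Suc n) (\<lambda>x. of_real x * ?L f x) x + ((?L ^^ Suc n) f x + ?c * (?L ^^ Suc n) (\<lambda>x. f (- x)) x)"
    by (simp only: dunkl_iter_add schwartz_mult_x Lf schwartz_add f schwartz_mult_const fr dunkl_iter_cmult)
  also have "(?L ^^ Suc n) (\<lambda>x. of_real x * ?L f x) x = of_real x * (?L ^^ Suc n) (?L f) x + of_nat (Suc n) * (?L ^^ n) (?L f) x
           + (if even n then ?c * (?L ^^ n) (\<lambda>x. ?L f (- x)) x else 0)"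
    by (rule Suc.IH[OF Lf])
  also have "(?L ^^ Suc n) (?L f) = (?L ^^ Suc (Suc n)) f" unfolding funpow_Suc_right[of "Suc n"] by simp
  also have "(?L ^^ n) (?L f) = (?L ^^ Suc n) f" unfolding funpow_Suc_right by simp
  finally show ?case unfolding reflect by (simp add: algebra_simps)
qed

lemma dunkl_transform_iter:
  assumes k: "k \<ge> - 1 / 2" and g: "g \<in> schwartz_space"
  shows "dunkl_transform k ((dunkl_op k ^^ n) g) y = (\<i> * of_real y) ^ n * dunkl_transform k g y"
  by (induction n) (simp_all add: dunkl_transform_dunkl_op[OF k dunkl_iter_schwartz[OF g]])

definition band_limited :: "real \<Rightarrow> real \<Rightarrow> (real \<Rightarrow> complex) set" where
  "band_limited k s = {g \<in> schwartz_space. \<forall>y. s < \<bar>y\<bar> \<longrightarrow> dunkl_transform k g y = 0}"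

lemma band_limited_reflect:
  assumes k: "k \<ge> - 1 / 2" and g: "g \<in> band_limited k s"
  shows "(\<lambda>x. g (- x)) \<in> band_limited k s"
  using g dunkl_transform_reflect[OF k schwartz_measurable]
  by (auto simp: band_limited_def schwartz_reflect)

text \<open>The formula for \<open>F (x g)(y)\<close> involves \<open>F g\<close> only near \<open>y\<close> and \<open>- y\<close>.\<close>

lemma band_limited_mult_x:
  assumes k: "k \<ge> - 1 / 2" and g: "g \<in> band_limited k s" and s: "s \<ge> 0"
  shows "(\<lambda>x. of_real x * g x) \<in> band_limited k s"
proof -
  have gS: "g \<in> schwartz_space" and zero: "\<And>y. s < \<bar>y\<bar> \<Longrightarrow> dunkl_transform k g y = 0"
    using g by (auto simp: band_limited_def)
  have "dunkl_transform k (\<lambda>x. of_real x * g x) y = 0" if y: "s < \<bar>y\<bar>" for y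
  proof -
    have "(dunkl_transform k g has_vector_derivative 0) (at y)"
    proof (rule has_vector_derivative_transform_within_open[where f = "\<lambda>_. 0"])
      show "open {y. s < \<bar>y\<bar>}" by (intro open_Collect_less continuous_intros)
    qed (use y zero in auto)
    hence "vderiv (dunkl_transform k g) y = 0" by (rule vector_derivative_at)
    moreover have "y \<noteq> 0" using y s by auto
    ultimately show ?thesis
      using dunkl_transform_mult_x[OF k gS, of y] zero[of y] zero[of "- y"] y by simp
  qed
  thus ?thesis using gS by (simp add: band_limited_def schwartz_mult_x)
qed

text \<open>By inversion \<open>\<Lambda>\<^sup>n g\<close> is a transform of \<open>(i y)\<^sup>n F g(y)\<close>, whose modulus is at most \<open>s\<^sup>n \<bar>F g(y)\<bar>\<close>.\<close>

lemma band_limited_iter_bound: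
  assumes k: "k \<ge> - 1 / 2" and g: "g \<in> band_limited k s" and s: "s \<ge> 0"
  shows "\<exists>C. \<forall>n x. norm ((dunkl_op k ^^ n) g x) \<le> C * s ^ n"
proof -
  let ?M = "dunkl_measure k"
  have gS: "g \<in> schwartz_space" and zero: "\<And>y. s < \<bar>y\<bar> \<Longrightarrow> dunkl_transform k g y = 0"
    using g by (auto simp: band_limited_def)
  define I where "I = (LINT y|?M. norm (dunkl_transform k g y))"
  define \<kappa> where "\<kappa> = norm (inversion_const k)"
  have \<kappa>: "\<kappa> > 0" using inversion_const_neq_0[OF k] by (simp add: \<kappa>_def)
  have "norm ((dunkl_op k ^^ n) g x) \<le> (I / \<kappa>) * s ^ n" for n x
  proof -
    let ?u = "(dunkl_op k ^^ n) g"
    have u: "?u \<in> schwartz_space" by (rule dunkl_iter_schwartz[OF gS])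
    have "\<kappa> * norm (?u x) = norm (dunkl_transform k (dunkl_transform k ?u) (- x))"
      unfolding dunkl_inversion[OF k u] by (simp add: \<kappa>_def norm_mult)
    also have "\<dots> \<le> (LINT y|?M. norm (dunkl_transform k ?u y))"
      by (rule dunkl_transform_norm_le[OF k dunkl_transform_integrable[OF k u]])
    also have "\<dots> \<le> (LINT y|?M. s ^ n * norm (dunkl_transform k g y))"
    proof (rule Bochner_Integration.integral_mono)
      show "integrable ?M (\<lambda>y. norm (dunkl_transform k ?u y))"
        by (intro integrable_norm dunkl_transform_integrable k u)
      show "integrable ?M (\<lambda>y. s ^ n * norm (dunkl_transform k g y))"
        by (intro integrable_mult_right integrable_norm dunkl_transform_integrable k gS)
      fix y
      show "norm (dunkl_transform k ?u y) \<le> s ^ n * norm (dunkl_transform k g y)"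
      proof (cases "s < \<bar>y\<bar>")
        case False
        thus ?thesis unfolding dunkl_transform_iter[OF k gS]
          by (auto simp: norm_mult norm_power intro!: mult_right_mono power_mono)
      qed (simp add: dunkl_transform_iter[OF k gS] zero)
    qed
    also have "\<dots> = s ^ n * I" by (simp add: I_def)
    finally show ?thesis using \<kappa> by (simp add: field_simps)
  qed
  thus ?thesis by blast
qed

text \<open>Induction on the power of \<open>x\<close>: the commutator formula writes \<open>x \<Lambda>\<^sup>n g\<close> in terms of iterates applied to
  \<open>x g\<close>, \<open>g\<close> and the reflection of \<open>g\<close>, all band-limited with the same \<open>s\<close>. The coefficient \<open>n\<close> in that formula
  costs one power of \<open>n + 1\<close> per step.\<close>

lemma band_limited_iter_decay:
  assumes k: "k \<ge> - 1 / 2" and s: "s > 0" and g: "g \<in> band_limited k s"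
  shows "\<exists>C. \<forall>n x. \<bar>x\<bar> ^ m * norm ((dunkl_op k ^^ n) g x) \<le> C * (real n + 1) ^ m * s ^ n"
  using g
proof (induction m arbitrary: g)
  case 0
  thus ?case using band_limited_iter_bound[OF k 0] s by simp
next
  case (Suc m)
  let ?L = "dunkl_op k"
  have gS: "g \<in> schwartz_space" using Suc.prems by (simp add: band_limited_def)
  have xg: "(\<lambda>x. of_real x * g x) \<in> band_limited k s" using s by (intro band_limited_mult_x k Suc.prems) auto
  have rg: "(\<lambda>x. g (- x)) \<in> band_limited k s" by (intro band_limited_reflect k Suc.prems)
  obtain C1 where C1: "\<And>n x. \<bar>x\<bar> ^ m * norm ((?L ^^ n) (\<lambda>x. of_real x * g x) x) \<le> C1 * (real n + 1) ^ m * s ^ n"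
    using Suc.IH[OF xg] by blast
  obtain C2 where C2: "\<And>n x. \<bar>x\<bar> ^ m * norm ((?L ^^ n) g x) \<le> C2 * (real n + 1) ^ m * s ^ n"
    using Suc.IH[OF Suc.prems] by blast
  obtain C3 where C3: "\<And>n x. \<bar>x\<bar> ^ m * norm ((?L ^^ n) (\<lambda>x. g (- x)) x) \<le> C3 * (real n + 1) ^ m * s ^ n"
    using Suc.IH[OF rg] by blast
  obtain C0 where C0: "\<And>x. \<bar>x\<bar> ^ Suc m * norm (g x) \<le> C0" using schwartz_decay[OF gS] by blast
  define c where "c = \<bar>2 * k + 1\<bar>"
  define C where "C = \<bar>C0\<bar> + \<bar>C1\<bar> + \<bar>C2\<bar> / s + c * \<bar>C3\<bar> / s"
  have c0: "c \<ge> 0" by (simp add: c_def)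
  have Cnn: "\<bar>C1\<bar> + \<bar>C2\<bar> / s + c * \<bar>C3\<bar> / s \<le> C" "\<bar>C0\<bar> \<le> C"
    using s c0 by (auto simp: C_def)
  have "\<bar>x\<bar> ^ Suc m * norm ((?L ^^ n) g x) \<le> C * (real n + 1) ^ Suc m * s ^ n" for n x
  proof (cases n)
    case 0
    thus ?thesis using C0[of x] Cnn(2) by simp
  next
    case (Suc j)
    define P where "P = (real n + 1) ^ m"
    have P: "P \<ge> 0" "(real j + 1) ^ m \<le> P" by (auto simp: P_def Suc intro!: power_mono)
    let ?a = "(?L ^^ n) (\<lambda>x. of_real x * g x) x" and ?b = "(?L ^^ j) g x" and ?d = "(?L ^^ j) (\<lambda>x. g (- x)) x"
    have up: "\<bar>x\<bar> ^ m * norm ?a \<le> \<bar>C1\<bar> * P * s ^ n"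
    proof -
      have "C1 * P * s ^ n \<le> \<bar>C1\<bar> * P * s ^ n" using P s by (intro mult_right_mono) auto
      thus ?thesis using C1[of x n, folded P_def] by linarith
    qed
    have down: "\<bar>x\<bar> ^ m * norm z \<le> \<bar>D\<bar> * P * s ^ j" if "\<bar>x\<bar> ^ m * norm z \<le> D * (real j + 1) ^ m * s ^ j" for z :: complex and D
    proof -
      have "D * (real j + 1) ^ m * s ^ j \<le> \<bar>D\<bar> * P * s ^ j"
        using P s by (intro mult_right_mono mult_mono) auto
      thus ?thesis using that by linarith
    qed
    have "of_real x * (?L ^^ n) g x = ?a - (of_nat n * ?b + (if even j then of_real (2 * k + 1) * ?d else 0))"
      using dunkl_iter_mult_x[OF gS, where k = k and n = j and x = x] unfolding Suc by (simp add: algebra_simps)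
    hence "\<bar>x\<bar> * norm ((?L ^^ n) g x) = norm (?a - (of_nat n * ?b + (if even j then of_real (2 * k + 1) * ?d else 0)))"
      by (metis norm_mult norm_of_real)
    also have "\<dots> \<le> norm ?a + (norm (of_nat n * ?b) + norm (if even j then of_real (2 * k + 1) * ?d else 0))"
      by (intro norm_triangle_le_diff[THEN order_trans] norm_triangle_ineq4[THEN order_trans] add_mono norm_triangle_ineq order_refl)
    also have "\<dots> \<le> norm ?a + (real n * norm ?b + c * norm ?d)"
    proof -
      have "norm (if even j then complex_of_real (2 * k + 1) * ?d else 0) \<le> c * norm ?d"
        using c0 by (simp only: norm_mult norm_of_real c_def[symmetric] split: if_splits) simp
      thus ?thesis by (simp add: norm_mult)
    qed
    finally have "\<bar>x\<bar> ^ m * (\<bar>x\<bar> * norm ((?L ^^ n) g x)) \<le> \<bar>x\<bar> ^ m * (norm ?a + (real n * norm ?b + c * norm ?d))"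
      by (intro mult_left_mono) auto
    also have "\<dots> = \<bar>x\<bar> ^ m * norm ?a + real n * (\<bar>x\<bar> ^ m * norm ?b) + c * (\<bar>x\<bar> ^ m * norm ?d)"
      by (simp add: algebra_simps)
    also have "\<dots> \<le> \<bar>C1\<bar> * P * s ^ n + real n * (\<bar>C2\<bar> * P * s ^ j) + c * (\<bar>C3\<bar> * P * s ^ j)"
      using c0 by (intro add_mono mult_left_mono up down C2 C3) auto
    also have "\<dots> \<le> (\<bar>C1\<bar> * P * s ^ n + \<bar>C2\<bar> * P * s ^ j + c * (\<bar>C3\<bar> * P * s ^ j)) * (real n + 1)"
    proof -
      have nn: "0 \<le> \<bar>C1\<bar> * P * s ^ n" "0 \<le> \<bar>C2\<bar> * P * s ^ j" "0 \<le> c * (\<bar>C3\<bar> * P * s ^ j)"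
        using P s c0 by auto
      have "A + N * B + D \<le> (A + B + D) * (N + 1)" if "0 \<le> A" "0 \<le> B" "0 \<le> D" "0 \<le> N" for A B D N :: real
        using mult_nonneg_nonneg[OF that(1,4)] mult_nonneg_nonneg[OF that(3,4)] that by (simp add: algebra_simps)
      from this[OF nn] show ?thesis by simp
    qed
    also have "\<dots> = (\<bar>C1\<bar> + \<bar>C2\<bar> / s + c * \<bar>C3\<bar> / s) * (real n + 1) ^ Suc m * s ^ n"
      using s by (simp add: Suc P_def field_simps)
    also have "\<dots> \<le> C * (real n + 1) ^ Suc m * s ^ n"
      using Cnn(1) s by (intro mult_right_mono) auto
    finally show ?thesis by (simp add: mult_ac)
  qed
  thus ?case by blast
qed

lemma band_limited_iter_weighted:
  assumes k: "k \<ge> - 1 / 2" and s: "s > 0" and g: "g \<in> band_limited k s"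
  shows "\<exists>C. \<forall>n x. (1 + x\<^sup>2) ^ N * norm ((dunkl_op k ^^ n) g x) \<le> C * (real n + 1) ^ (2 * N) * s ^ n"
proof -
  obtain C1 where C1: "\<And>n x. \<bar>x\<bar> ^ 0 * norm ((dunkl_op k ^^ n) g x) \<le> C1 * (real n + 1) ^ 0 * s ^ n"
    using band_limited_iter_decay[OF k s g, of 0] by blast
  obtain C2 where C2: "\<And>n x. \<bar>x\<bar> ^ (2 * N) * norm ((dunkl_op k ^^ n) g x) \<le> C2 * (real n + 1) ^ (2 * N) * s ^ n"
    using band_limited_iter_decay[OF k s g, of "2 * N"] by blast
  have "(1 + x\<^sup>2) ^ N * norm ((dunkl_op k ^^ n) g x) \<le> 2 ^ N * (\<bar>C1\<bar> + C2) * (real n + 1) ^ (2 * N) * s ^ n" for n x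
  proof -
    let ?u = "norm ((dunkl_op k ^^ n) g x)"
    have e: "\<bar>x\<bar> ^ (2 * N) = (x\<^sup>2) ^ N" by (simp add: power_mult)
    have "(1 + x\<^sup>2) ^ N \<le> 2 ^ N * (1 + (x\<^sup>2) ^ N)"
    proof (cases "x\<^sup>2 \<le> 1")
      case True
      hence "(1 + x\<^sup>2) ^ N \<le> 2 ^ N" by (intro power_mono) auto
      also have "\<dots> \<le> 2 ^ N * (1 + (x\<^sup>2) ^ N)" by simp
      finally show ?thesis .
    next
      case False
      hence "(1 + x\<^sup>2) ^ N \<le> (2 * x\<^sup>2) ^ N" by (intro power_mono) auto
      also have "\<dots> \<le> 2 ^ N * (1 + (x\<^sup>2) ^ N)" by (simp add: power_mult_distrib)
      finally show ?thesis .
    qed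
    hence "(1 + x\<^sup>2) ^ N * ?u \<le> 2 ^ N * (1 + (x\<^sup>2) ^ N) * ?u" by (intro mult_right_mono) auto
    also have "\<dots> = 2 ^ N * (?u + \<bar>x\<bar> ^ (2 * N) * ?u)" unfolding e by (simp add: algebra_simps)
    also have "\<dots> \<le> 2 ^ N * (\<bar>C1\<bar> * (real n + 1) ^ (2 * N) * s ^ n + C2 * (real n + 1) ^ (2 * N) * s ^ n)"
    proof (intro mult_left_mono add_mono C2)
      have "?u \<le> C1 * s ^ n" using C1[of x n] by simp
      also have "\<dots> \<le> (\<bar>C1\<bar> * (real n + 1) ^ (2 * N)) * s ^ n"
      proof (rule mult_right_mono)
        have "\<bar>C1\<bar> * 1 \<le> \<bar>C1\<bar> * (real n + 1) ^ (2 * N)" by (intro mult_left_mono one_le_power) auto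
        thus "C1 \<le> \<bar>C1\<bar> * (real n + 1) ^ (2 * N)" by linarith
      qed (use s in auto)
      finally show "?u \<le> \<bar>C1\<bar> * (real n + 1) ^ (2 * N) * s ^ n" .
    qed auto
    also have "\<dots> = 2 ^ N * (\<bar>C1\<bar> + C2) * (real n + 1) ^ (2 * N) * s ^ n" by (simp add: algebra_simps)
    finally show ?thesis .
  qed
  thus ?thesis by blast
qed

section \<open>Growth of the norms of the iterates\<close>

lemma ennreal_powr_mono: "x \<le> y \<Longrightarrow> 0 \<le> r \<Longrightarrow> ennreal_powr x r \<le> ennreal_powr y r"
  by (auto simp: ennreal_powr_def top_unique less_top intro!: ennreal_leI powr_mono2 enn2real_mono)

lemma ennreal_powr_ennreal: "0 \<le> x \<Longrightarrow> ennreal_powr (ennreal x) r = ennreal (x powr r)"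
  by (simp add: ennreal_powr_def)

lemma enn2real_exponent_ge_1:
  assumes "1 \<le> p" "p \<noteq> top"
  shows "1 \<le> enn2real p"
  using enn2real_mono[OF assms(1)] assms(2) by (simp add: less_top)

text \<open>For finite \<open>p\<close>, \<open>\<bar>u\<bar>\<^sup>p \<le> A\<^sup>p \<rho>\<^sup>p \<le> A\<^sup>p \<rho>\<close> with the integrable weight \<open>\<rho> = (1 + x\<^sup>2)\<^sup>-\<^sup>N \<le> 1\<close>.\<close>

lemma Lp_norm_upper:
  assumes k: "k \<ge> - 1 / 2" and p: "1 \<le> p"
  shows "\<exists>K\<ge>0. \<forall>u A. u \<in> schwartz_space \<longrightarrow> (\<forall>x. (1 + x\<^sup>2) ^ decay_order k * norm (u x) \<le> A) \<longrightarrow> Lp_norm k p u \<le> ennreal (A * K)"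
proof (cases "p = top")
  case True
  have "Lp_norm k p u \<le> ennreal (A * 1)" if u: "u \<in> schwartz_space" and A: "\<And>x. (1 + x\<^sup>2) ^ decay_order k * norm (u x) \<le> A" for u A
  proof -
    have [measurable]: "u \<in> borel_measurable borel" by (rule schwartz_measurable[OF u])
    have "norm (u x) \<le> A" for x
    proof -
      have "1 * norm (u x) \<le> (1 + x\<^sup>2) ^ decay_order k * norm (u x)" by (intro mult_right_mono one_le_power) auto
      thus ?thesis using A[of x] by linarith
    qed
    hence "esssup (dunkl_measure k) (\<lambda>x. ennreal (norm (u x))) \<le> ennreal A"
      by (intro esssup_I AE_I2 ennreal_leI) auto
    thus ?thesis using True by (simp add: Lp_norm_def)
  qed
  thus ?thesis by (intro exI[of _ 1]) auto
next
  case False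
  define q where "q = enn2real p"
  have q: "q \<ge> 1" unfolding q_def by (rule enn2real_exponent_ge_1[OF p False])
  let ?\<rho> = "\<lambda>x::real. inverse ((1 + x\<^sup>2) ^ decay_order k)"
  define I where "I = (LINT x|dunkl_measure k. ?\<rho> x)"
  have I0: "I \<ge> 0" unfolding I_def by (intro Bochner_Integration.integral_nonneg) auto
  have "Lp_norm k p u \<le> ennreal (A * I powr (1 / q))" if u: "u \<in> schwartz_space" and A: "\<And>x. (1 + x\<^sup>2) ^ decay_order k * norm (u x) \<le> A" for u A
  proof -
    have "0 \<le> (1 + (0::real)\<^sup>2) ^ decay_order k * norm (u 0)" by simp
    hence A0: "A \<ge> 0" using A[of 0] by linarith
    have "norm (u x) powr q \<le> A powr q * ?\<rho> x" for x
    proof -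
      have pos: "(1 + x\<^sup>2) ^ decay_order k > 0" by (simp add: add_pos_nonneg)
      have le1: "?\<rho> x \<le> 1" by (simp add: inverse_le_1_iff one_le_power)
      have "norm (u x) \<le> A * ?\<rho> x" using A[of x] pos by (simp add: field_simps)
      hence "norm (u x) powr q \<le> (A * ?\<rho> x) powr q" using q by (intro powr_mono2) auto
      also have "\<dots> = A powr q * ?\<rho> x powr q" by (rule powr_mult)
      also have "\<dots> \<le> A powr q * ?\<rho> x powr 1"
        using powr_mono'[OF q _ le1] pos by (intro mult_left_mono) auto
      finally show ?thesis using pos by simp
    qed
    hence "(\<integral>\<^sup>+x. ennreal (norm (u x) powr q) \<partial>dunkl_measure k) \<le> (\<integral>\<^sup>+x. ennreal (A powr q * ?\<rho> x) \<partial>dunkl_measure k)"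
      by (intro nn_integral_mono ennreal_leI)
    also have "\<dots> = ennreal (LINT x|dunkl_measure k. A powr q * ?\<rho> x)"
      by (intro nn_integral_eq_integral integrable_mult_right integrable_decay k) auto
    also have "(LINT x|dunkl_measure k. A powr q * ?\<rho> x) = A powr q * I" by (simp add: I_def)
    finally have "ennreal_powr (\<integral>\<^sup>+x. ennreal (norm (u x) powr q) \<partial>dunkl_measure k) (1 / q) \<le> ennreal_powr (ennreal (A powr q * I)) (1 / q)"
      using q by (intro ennreal_powr_mono) auto
    also have "\<dots> = ennreal ((A powr q * I) powr (1 / q))" using I0 by (intro ennreal_powr_ennreal) auto
    also have "(A powr q * I) powr (1 / q) = A * I powr (1 / q)"
      using A0 I0 q by (subst powr_mult) (auto simp: powr_powr)
    finally show ?thesis using False by (simp add: Lp_norm_def q_def)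
  qed
  thus ?thesis by (intro exI[of _ "I powr (1 / q)"]) auto
qed

text \<open>A substitute for Hoelder's inequality with a worse constant. For finite \<open>p\<close> it rests on
  \<open>r t \<le> r\<^sup>p B + t\<close> for \<open>0 \<le> t \<le> B\<close> and \<open>r \<ge> 0\<close>, as one sees by distinguishing \<open>r \<le> 1\<close> and \<open>r > 1\<close>.
  This is applied with \<open>r = \<bar>u\<bar> / A\<close>, where \<open>A\<close> is the norm of \<open>u\<close>, and \<open>t = \<bar>h\<bar>\<close>.\<close>

lemma Lp_norm_lower:
  assumes k: "k \<ge> - 1 / 2" and p: "1 \<le> p" and h: "h \<in> schwartz_space"
  shows "\<exists>K>0. \<forall>u. u \<in> schwartz_space \<longrightarrow> ennreal (norm (LINT x|dunkl_measure k. u x * h x)) \<le> ennreal K * Lp_norm k p u"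
proof -
  let ?M = "dunkl_measure k"
  obtain B where B: "\<And>x. norm (h x) \<le> B" using schwartz_bounded[OF h] by blast
  have B0: "B \<ge> 0" using order_trans[OF norm_ge_zero B[of 0]] .
  define I where "I = (LINT x|?M. norm (h x))"
  have I0: "I \<ge> 0" unfolding I_def by (intro Bochner_Integration.integral_nonneg) auto
  have [measurable]: "h \<in> borel_measurable borel" by (rule schwartz_measurable[OF h])
  have I: "(\<integral>\<^sup>+x. ennreal (norm (h x)) \<partial>?M) = ennreal I"
    unfolding I_def by (intro nn_integral_eq_integral integrable_norm schwartz_integrable k h) auto
  define K where "K = B + I + 1"
  have K: "K > 0" using B0 I0 by (simp add: K_def)
  have "ennreal (norm (LINT x|?M. u x * h x)) \<le> ennreal K * Lp_norm k p u" if u: "u \<in> schwartz_space" for u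
  proof -
    have [measurable]: "u \<in> borel_measurable borel" by (rule schwartz_measurable[OF u])
    have le: "ennreal (norm (LINT x|?M. u x * h x)) \<le> (\<integral>\<^sup>+x. ennreal (norm (u x)) * ennreal (norm (h x)) \<partial>?M)"
    proof -
      have "integrable ?M (\<lambda>x. u x * h x)"
        by (rule integrable_mult_bounded(1)[OF schwartz_integrable[OF k u] _ B]) measurable
      from integral_norm_bound_ennreal[OF this] show ?thesis by (simp add: norm_mult ennreal_mult)
    qed
    show ?thesis
    proof (cases "p = top")
      case True
      let ?S = "esssup ?M (\<lambda>x. ennreal (norm (u x)))"
      have "(\<integral>\<^sup>+x. ennreal (norm (u x)) * ennreal (norm (h x)) \<partial>?M) \<le> (\<integral>\<^sup>+x. ?S * ennreal (norm (h x)) \<partial>?M)"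
      proof (rule nn_integral_mono_AE)
        have "AE x in ?M. ennreal (norm (u x)) \<le> ?S" by (rule esssup_AE)
        thus "AE x in ?M. ennreal (norm (u x)) * ennreal (norm (h x)) \<le> ?S * ennreal (norm (h x))"
          by eventually_elim (rule mult_right_mono, auto)
      qed
      also have "\<dots> = ?S * ennreal I" by (subst nn_integral_cmult) (auto simp: I)
      also have "\<dots> \<le> ?S * ennreal K" using B0 by (intro mult_left_mono ennreal_leI) (auto simp: K_def)
      finally show ?thesis using le True by (simp add: Lp_norm_def mult.commute)
    next
      case False
      define q where "q = enn2real p"
      have q: "q \<ge> 1" unfolding q_def by (rule enn2real_exponent_ge_1[OF p False])
      define T where "T = (\<integral>\<^sup>+x. ennreal (norm (u x) powr q) \<partial>?M)"
      have Lp: "Lp_norm k p u = ennreal_powr T (1 / q)" using False by (simp add: Lp_norm_def T_def q_def)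
      consider "T = top" | "T = 0" | a where "a > 0" "T = ennreal a"
        by (cases T) (auto simp: less_le)
      thus ?thesis
      proof cases
        case 1
        thus ?thesis using K by (simp add: Lp ennreal_powr_def ennreal_mult_top)
      next
        case 2
        hence "AE x in ?M. ennreal (norm (u x) powr q) = 0"
          unfolding T_def by (subst (asm) nn_integral_0_iff_AE) auto
        hence "AE x in ?M. u x * h x = 0" by eventually_elim (auto simp: ennreal_eq_0_iff)
        hence "(LINT x|?M. u x * h x) = (LINT x|?M. 0)" by (intro integral_cong_AE) auto
        thus ?thesis by simp
      next
        case (3 a)
        define A where "A = a powr (1 / q)"
        have A: "A > 0" using 3 by (simp add: A_def)
        have Aq: "A powr q = a" using 3 q by (simp add: A_def powr_powr)
        have pw: "norm (u x) * norm (h x) \<le> A * B / a * norm (u x) powr q + A * norm (h x)" for x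
        proof (cases "norm (u x) \<le> A")
          case True
          hence "norm (u x) * norm (h x) \<le> A * norm (h x)" by (intro mult_right_mono) auto
          moreover have "0 \<le> A * B / a * norm (u x) powr q" using A B0 3 by auto
          ultimately show ?thesis by linarith
        next
          case False
          define r where "r = norm (u x) / A"
          have r: "r \<ge> 1" using False A by (simp add: r_def)
          have "r powr 1 \<le> r powr q" using r q by (intro powr_mono) auto
          also have "r powr q = norm (u x) powr q / a" using A by (simp add: r_def powr_divide Aq)
          finally have "norm (u x) \<le> A * (norm (u x) powr q / a)" using A r by (simp add: r_def field_simps)
          hence "norm (u x) * norm (h x) \<le> (A * (norm (u x) powr q / a)) * B" using B[of x] A 3 by (intro mult_mono) auto
          moreover have "0 \<le> A * norm (h x)" using A by simp
          ultimately show ?thesis by (simp add: mult_ac)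
        qed
        have "(\<integral>\<^sup>+x. ennreal (norm (u x)) * ennreal (norm (h x)) \<partial>?M) \<le> (\<integral>\<^sup>+x. ennreal (A * B / a) * ennreal (norm (u x) powr q) + ennreal A * ennreal (norm (h x)) \<partial>?M)"
        proof (rule nn_integral_mono)
          fix x
          have "ennreal (norm (u x)) * ennreal (norm (h x)) = ennreal (norm (u x) * norm (h x))" by (simp add: ennreal_mult)
          also have "\<dots> \<le> ennreal (A * B / a * norm (u x) powr q + A * norm (h x))" using pw by (rule ennreal_leI)
          also have "\<dots> = ennreal (A * B / a) * ennreal (norm (u x) powr q) + ennreal A * ennreal (norm (h x))"
          proof -
            have nn: "0 \<le> A * B / a" "0 \<le> norm (u x) powr q" "0 \<le> A" "0 \<le> norm (h x)" using A B0 3 by auto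
            show ?thesis
              unfolding ennreal_mult[OF nn(1,2), symmetric] ennreal_mult[OF nn(3,4), symmetric]
              by (rule ennreal_plus) (use nn in \<open>blast intro: mult_nonneg_nonneg\<close>)+
          qed
          finally show "ennreal (norm (u x)) * ennreal (norm (h x)) \<le> ennreal (A * B / a) * ennreal (norm (u x) powr q) + ennreal A * ennreal (norm (h x))" .
        qed
        also have "\<dots> = ennreal (A * B / a) * T + ennreal A * ennreal I"
          by (simp add: nn_integral_add nn_integral_cmult I T_def)
        also have "\<dots> = ennreal (A * (B + I))"
          using A B0 I0 3 by (simp add: ennreal_mult[symmetric] ennreal_plus[symmetric] distrib_left del: ennreal_plus)
        also have "\<dots> \<le> ennreal (A * K)" using A by (intro ennreal_leI mult_left_mono) (auto simp: K_def)
        also have "\<dots> = ennreal K * Lp_norm k p u"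
          using A K 3 by (simp add: Lp ennreal_powr_ennreal A_def ennreal_mult mult.commute)
        finally show ?thesis using le by simp
      qed
    qed
  qed
  thus ?thesis using K by blast
qed

text \<open>Plancherel with \<open>\<Lambda>\<^sup>n g\<close> and \<open>\<Lambda>\<^sup>e g\<close>, where \<open>e = n mod 2\<close>: since \<open>n + e\<close> is even, the integrand on the
  transform side is a unimodular constant times \<open>\<bar>y\<bar>\<^sup>n\<^sup>+\<^sup>e \<bar>F g\<bar>\<^sup>2 \<ge> 0\<close>, without cancellation.\<close>

lemma iterate_lower_bound:
  assumes k: "k \<ge> - 1 / 2" and p: "1 \<le> p" and g: "g \<in> schwartz_space"
    and y0: "dunkl_transform k g y0 \<noteq> 0" and r: "0 < r" "r < \<bar>y0\<bar>"
  shows "\<exists>c>0. \<forall>n. ennreal (c * r ^ n) \<le> Lp_norm k p ((dunkl_op k ^^ n) g)"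
proof -
  let ?M = "dunkl_measure k"
  let ?F = "dunkl_transform k"
  let ?L = "dunkl_op k"
  \<comment> \<open>a continuous replacement for \<open>\<bar>F g\<bar>\<^sup>2\<close> restricted to \<open>\<bar>y\<bar> > r\<close>, which has positive integral by
    continuity\<close>
  define \<psi> where "\<psi> = (\<lambda>y. min 1 (max 0 (\<bar>y\<bar> - r)) * (norm (?F g y))\<^sup>2)"
  define J where "J = (LINT y|?M. \<psi> y)"
  have int: "integrable ?M (\<lambda>y. \<bar>y\<bar> ^ (m + e) * (norm (?F g y))\<^sup>2)" for m e
  proof -
    obtain C where C: "\<And>y. norm (?F ((?L ^^ e) g) y) \<le> C"
    proof -
      have "\<exists>C. \<forall>y. (1 + y\<^sup>2) ^ 0 * norm (?F ((?L ^^ e) g) y) \<le> C"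
        by (intro dunkl_transform_decay k dunkl_iter_schwartz g)
      thus ?thesis using that by auto
    qed
    have m: "?F g \<in> borel_measurable borel" by (rule dunkl_transform_measurable[OF k g])
    have "norm (\<bar>y\<bar> ^ (m + e) * (norm (?F g y))\<^sup>2) \<le> norm (C * norm (?F ((?L ^^ m) g) y))" for y
    proof -
      have "norm (\<bar>y\<bar> ^ (m + e) * (norm (?F g y))\<^sup>2) = norm (?F ((?L ^^ e) g) y) * norm (?F ((?L ^^ m) g) y)"
        by (simp add: dunkl_transform_iter[OF k g] norm_mult norm_power power_add power2_eq_square abs_mult mult_ac)
      also have "\<dots> \<le> C * norm (?F ((?L ^^ m) g) y)" by (intro mult_right_mono C) auto
      also have "\<dots> \<le> norm (C * norm (?F ((?L ^^ m) g) y))" by simp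
      finally show ?thesis .
    qed
    thus ?thesis
      using m by (intro Bochner_Integration.integrable_bound[OF integrable_mult_right[OF integrable_norm[OF dunkl_transform_integrable[OF k dunkl_iter_schwartz[OF g]]]], of _ C "m" ] AE_I2) auto
  qed
  have cont\<psi>: "continuous_on UNIV \<psi>"
    unfolding \<psi>_def by (intro continuous_intros continuous_on_dunkl_transform schwartz_integrable k g)
  have \<psi>0: "0 \<le> \<psi> y" for y by (simp add: \<psi>_def)
  have int\<psi>: "integrable ?M \<psi>"
  proof (rule Bochner_Integration.integrable_bound[OF int[of 0 0]])
    show "\<psi> \<in> borel_measurable ?M" using borel_measurable_continuous_onI[OF cont\<psi>] by simp
    show "AE y in ?M. norm (\<psi> y) \<le> norm (\<bar>y\<bar> ^ (0 + 0) * (norm (?F g y))\<^sup>2)"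
      by (intro AE_I2) (auto simp: \<psi>_def abs_mult intro!: mult_left_le_one_le)
  qed
  have "J \<noteq> 0"
  proof
    assume "J = 0"
    hence "\<psi> y0 = 0" unfolding J_def by (intro continuous_nonneg_integral_zero[OF k cont\<psi> \<psi>0 int\<psi>])
    thus False using r y0 by (auto simp: \<psi>_def min_def max_def split: if_splits)
  qed
  moreover have "J \<ge> 0" unfolding J_def using \<psi>0 by (intro Bochner_Integration.integral_nonneg) auto
  ultimately have J: "J > 0" by simp
  define h where "h = (\<lambda>e. (?L ^^ e) g)"
  have h: "h e \<in> schwartz_space" for e unfolding h_def by (rule dunkl_iter_schwartz[OF g])
  have ch: "(\<lambda>x. cnj (h e x)) \<in> schwartz_space" for e by (rule schwartz_cnj[OF h])
  define \<kappa> where "\<kappa> = norm (inversion_const k)"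
  have \<kappa>: "\<kappa> > 0" using inversion_const_neq_0[OF k] by (simp add: \<kappa>_def)
  have pair: "J * r ^ (m + e) \<le> \<kappa> * norm (LINT x|?M. (?L ^^ m) g x * cnj (h e x))" if me: "even (m + e)" for m e
  proof -
    let ?u = "(?L ^^ m) g"
    have "\<kappa> * norm (LINT x|?M. ?u x * cnj (h e x)) = norm (LINT y|?M. ?F ?u y * cnj (?F (h e) y))"
      unfolding dunkl_plancherel[OF k dunkl_iter_schwartz[OF g] h, symmetric] by (simp add: \<kappa>_def norm_mult)
    also have "(\<lambda>y. ?F ?u y * cnj (?F (h e) y)) = (\<lambda>y. (\<i> ^ m * (- \<i>) ^ e) * of_real (\<bar>y\<bar> ^ (m + e) * (norm (?F g y))\<^sup>2))"
    proof
      fix y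
      have "complex_of_real (\<bar>y\<bar> ^ (m + e)) = of_real y ^ m * of_real y ^ e"
        using power_even_abs[OF me, of y] by (simp only: power_add of_real_mult of_real_power)
      thus "?F ?u y * cnj (?F (h e) y) = (\<i> ^ m * (- \<i>) ^ e) * of_real (\<bar>y\<bar> ^ (m + e) * (norm (?F g y))\<^sup>2)"
        unfolding h_def dunkl_transform_iter[OF k g] of_real_mult complex_norm_square
        by (simp add: power_mult_distrib power_minus[of "\<i> * complex_of_real y"] power_minus[of \<i>] mult_ac)
    qed
    also have "norm (LINT y|?M. (\<i> ^ m * (- \<i>) ^ e) * complex_of_real (\<bar>y\<bar> ^ (m + e) * (norm (?F g y))\<^sup>2)) = norm (LINT y|?M. complex_of_real (\<bar>y\<bar> ^ (m + e) * (norm (?F g y))\<^sup>2))"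
      by (simp only: integral_mult_right_zero norm_mult norm_power norm_ii norm_minus_cancel power_one mult_1)
    also have "\<dots> = \<bar>LINT y|?M. \<bar>y\<bar> ^ (m + e) * (norm (?F g y))\<^sup>2\<bar>"
      by (simp only: integral_complex_of_real norm_of_real)
    also have "\<dots> \<ge> (LINT y|?M. r ^ (m + e) * \<psi> y)"
    proof -
      have "(LINT y|?M. r ^ (m + e) * \<psi> y) \<le> (LINT y|?M. \<bar>y\<bar> ^ (m + e) * (norm (?F g y))\<^sup>2)"
      proof (rule Bochner_Integration.integral_mono[OF integrable_mult_right[OF int\<psi>] int])
        fix y
        show "r ^ (m + e) * \<psi> y \<le> \<bar>y\<bar> ^ (m + e) * (norm (?F g y))\<^sup>2"
        proof (cases "\<bar>y\<bar> \<le> r")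
          case False
          have "\<psi> y \<le> (norm (?F g y))\<^sup>2" by (auto simp: \<psi>_def intro!: mult_left_le_one_le)
          thus ?thesis using False r \<psi>0 by (intro mult_mono power_mono) auto
        qed (auto simp: \<psi>_def)
      qed
      thus ?thesis by linarith
    qed
    finally show ?thesis by (simp add: J_def mult.commute)
  qed
  obtain K0 where K0: "K0 > 0" "\<And>u. u \<in> schwartz_space \<Longrightarrow> ennreal (norm (LINT x|?M. u x * cnj (h 0 x))) \<le> ennreal K0 * Lp_norm k p u"
    using Lp_norm_lower[OF k p ch[of 0]] by blast
  obtain K1 where K1: "K1 > 0" "\<And>u. u \<in> schwartz_space \<Longrightarrow> ennreal (norm (LINT x|?M. u x * cnj (h 1 x))) \<le> ennreal K1 * Lp_norm k p u"
    using Lp_norm_lower[OF k p ch[of 1]] by blast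
  define K where "K = max K0 K1"
  have K: "K > 0" using K0 by (simp add: K_def)
  define c where "c = J * min 1 r / (\<kappa> * K)"
  have c: "c > 0" using J r \<kappa> K by (simp add: c_def)
  have "ennreal (c * r ^ n) \<le> Lp_norm k p ((?L ^^ n) g)" for n
  proof -
    let ?u = "(?L ^^ n) g"
    define e where "e = n mod 2"
    have e: "e = 0 \<or> e = 1" "even (n + e)" unfolding e_def by (auto simp: even_iff_mod_2_eq_zero) presburger
    have u: "?u \<in> schwartz_space" by (rule dunkl_iter_schwartz[OF g])
    have "J * (min 1 r * r ^ n) \<le> J * r ^ (n + e)"
      using e(1) J r by (intro mult_left_mono) (auto simp: power_add mult.commute intro!: mult_right_mono)
    also have "\<dots> \<le> \<kappa> * norm (LINT x|?M. ?u x * cnj (h e x))" by (rule pair[OF e(2)])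
    finally have "c * r ^ n * K \<le> norm (LINT x|?M. ?u x * cnj (h e x))"
      using \<kappa> K by (simp add: c_def field_simps)
    hence "ennreal (c * r ^ n * K) \<le> ennreal (norm (LINT x|?M. ?u x * cnj (h e x)))" by (rule ennreal_leI)
    also have "\<dots> \<le> ennreal K * Lp_norm k p ?u"
    proof -
      have "ennreal K0 * Lp_norm k p ?u \<le> ennreal K * Lp_norm k p ?u" "ennreal K1 * Lp_norm k p ?u \<le> ennreal K * Lp_norm k p ?u"
        by (auto simp: K_def intro!: mult_right_mono ennreal_leI)
      thus ?thesis using e(1) K0(2)[OF u] K1(2)[OF u] by (auto intro: order_trans)
    qed
    finally have "ennreal K * ennreal (c * r ^ n) \<le> ennreal K * Lp_norm k p ?u"
      using K c r by (simp add: ennreal_mult[symmetric] mult.commute)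
    thus ?thesis using K by (subst (asm) ennreal_mult_le_mult_iff) auto
  qed
  thus ?thesis using c by blast
qed

text \<open>The order on \<open>[0, \<infinity>]\<close> is dense, so strictly on either side of the supremum there is room for a
  real \<open>r\<close> or \<open>s\<close>. The constants and the polynomial factor have \<open>n\<close>-th roots tending to \<open>1\<close>. On the upper side
  \<open>s\<close> is positive even if the supremum is \<open>0\<close>.\<close>

theorem dunkl_iterate_growth:
  assumes k: "k \<ge> - 1 / 2" and p: "1 \<le> p" and g: "g \<in> schwartz_space"
  shows "(\<lambda>n. ennreal_powr (Lp_norm k p ((dunkl_op k ^^ n) g)) (1 / real n))
           \<longlonglongrightarrow> (SUP y \<in> {y. dunkl_transform k g y \<noteq> 0}. ennreal \<bar>y\<bar>)"
    (is "?N \<longlonglongrightarrow> ?\<sigma>")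
proof (rule order_tendstoI)
  fix a assume "a < ?\<sigma>"
  then obtain y0 where y0: "dunkl_transform k g y0 \<noteq> 0" and ay: "a < ennreal \<bar>y0\<bar>"
    by (auto simp: less_SUP_iff)
  obtain b where b: "a < b" "b < ennreal \<bar>y0\<bar>" using dense[OF ay] by blast
  then obtain r where br: "b = ennreal r" and "0 \<le> r" by (cases b) auto
  have r: "0 < r" "r < \<bar>y0\<bar>"
    using b \<open>0 \<le> r\<close> unfolding br by (auto simp: ennreal_less_iff less_le)
  obtain c where c: "c > 0" "\<And>n. ennreal (c * r ^ n) \<le> Lp_norm k p ((dunkl_op k ^^ n) g)"
    using iterate_lower_bound[OF k p g y0 r] by blast
  have "(\<lambda>n. c powr (1 / real n) * r) \<longlonglongrightarrow> c powr 0 * r"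
    using c(1) by (intro tendsto_intros lim_1_over_n) auto
  hence "(\<lambda>n. ennreal (c powr (1 / real n) * r)) \<longlonglongrightarrow> ennreal r" using c(1) by (intro tendsto_ennrealI) simp
  hence "\<forall>\<^sub>F n in sequentially. a < ennreal (c powr (1 / real n) * r)"
    using b(1) unfolding br by (rule order_tendstoD)
  moreover have "\<forall>\<^sub>F n in sequentially. n > (0::nat)" by (rule eventually_gt_at_top)
  ultimately show "\<forall>\<^sub>F n in sequentially. a < ?N n"
  proof eventually_elim
    case (elim n)
    have "c powr (1 / real n) * r = (c * r ^ n) powr (1 / real n)"
      using c r elim(2) by (simp add: powr_mult powr_powr flip: powr_realpow)
    hence "ennreal (c powr (1 / real n) * r) = ennreal_powr (ennreal (c * r ^ n)) (1 / real n)"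
      using c r by (simp add: ennreal_powr_ennreal)
    also have "\<dots> \<le> ?N n" by (intro ennreal_powr_mono c) auto
    finally show ?case using elim(1) by (rule less_le_trans[rotated])
  qed
next
  fix a assume "?\<sigma> < a"
  then obtain b where b: "?\<sigma> < b" "b < a" using dense by blast
  then obtain s where bs: "b = ennreal s" and "0 \<le> s" by (cases b) (auto simp: less_top[symmetric])
  have s: "s > 0" using b(1) \<open>0 \<le> s\<close> unfolding bs by (cases "s = 0") auto
  have band: "g \<in> band_limited k s"
  proof -
    have "dunkl_transform k g y = 0" if "s < \<bar>y\<bar>" for y
    proof (rule ccontr)
      assume "dunkl_transform k g y \<noteq> 0"
      hence "ennreal \<bar>y\<bar> \<le> ?\<sigma>" by (intro SUP_upper) auto
      hence "ennreal \<bar>y\<bar> < ennreal s" using b(1) unfolding bs by (rule le_less_trans)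
      thus False using that s by (simp add: ennreal_less_iff)
    qed
    thus ?thesis using g by (simp add: band_limited_def)
  qed
  define m where "m = 2 * decay_order k"
  obtain C where C: "\<And>n x. (1 + x\<^sup>2) ^ decay_order k * norm ((dunkl_op k ^^ n) g x) \<le> C * (real n + 1) ^ m * s ^ n"
    using band_limited_iter_weighted[OF k s band, of "decay_order k"] unfolding m_def by blast
  obtain K where K: "K \<ge> 0" "\<And>u A. u \<in> schwartz_space \<Longrightarrow> (\<And>x. (1 + x\<^sup>2) ^ decay_order k * norm (u x) \<le> A) \<Longrightarrow> Lp_norm k p u \<le> ennreal (A * K)"
    using Lp_norm_upper[OF k p] by blast
  define D where "D = \<bar>C\<bar> * 2 ^ m * K + 1"
  have D: "D > 0" using K by (simp add: D_def add_nonneg_pos)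
  have le: "Lp_norm k p ((dunkl_op k ^^ n) g) \<le> ennreal (D * real n ^ m * s ^ n)" if n: "n > 0" for n
  proof -
    have "Lp_norm k p ((dunkl_op k ^^ n) g) \<le> ennreal (C * (real n + 1) ^ m * s ^ n * K)"
      by (intro K(2) dunkl_iter_schwartz g C)
    \<comment> \<open>trades \<open>n + 1\<close> for \<open>2n\<close> to use that the \<open>n\<close>-th root of \<open>n\<close> tends to \<open>1\<close>\<close>
    also have "C * (real n + 1) ^ m * s ^ n * K \<le> \<bar>C\<bar> * (2 * real n) ^ m * s ^ n * K"
      using n s K by (intro mult_right_mono mult_mono power_mono) auto
    also have "\<dots> = (\<bar>C\<bar> * 2 ^ m * K) * (real n ^ m * s ^ n)" by (simp add: power_mult_distrib mult_ac)
    also have "\<dots> \<le> D * (real n ^ m * s ^ n)"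
      using s by (intro mult_right_mono) (auto simp: D_def)
    finally show ?thesis by (simp add: mult.assoc ennreal_leI)
  qed
  have "(\<lambda>n. D powr (1 / real n) * root n (real n) ^ m * s) \<longlonglongrightarrow> D powr 0 * 1 ^ m * s"
    using D by (intro tendsto_intros lim_1_over_n LIMSEQ_root) auto
  hence "(\<lambda>n. ennreal (D powr (1 / real n) * root n (real n) ^ m * s)) \<longlonglongrightarrow> ennreal s"
    using D by (intro tendsto_ennrealI) simp
  hence "\<forall>\<^sub>F n in sequentially. ennreal (D powr (1 / real n) * root n (real n) ^ m * s) < a"
    using b(2) unfolding bs by (rule order_tendstoD)
  moreover have "\<forall>\<^sub>F n in sequentially. n > (0::nat)" by (rule eventually_gt_at_top)
  ultimately show "\<forall>\<^sub>F n in sequentially. ?N n < a"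
  proof eventually_elim
    case (elim n)
    have "?N n \<le> ennreal_powr (ennreal (D * real n ^ m * s ^ n)) (1 / real n)"
      using le[OF elim(2)] by (intro ennreal_powr_mono) auto
    also have "\<dots> = ennreal ((D * real n ^ m * s ^ n) powr (1 / real n))"
      using D s by (intro ennreal_powr_ennreal) auto
    also have "(D * real n ^ m * s ^ n) powr (1 / real n) = D powr (1 / real n) * root n (real n) ^ m * s"
    proof -
      have "(real n ^ m) powr (1 / real n) = root n (real n) ^ m"
        using elim(2) by (simp add: root_powr_inverse powr_powr mult.commute flip: powr_realpow)
      moreover have "(s ^ n) powr (1 / real n) = s"
        using s elim(2) by (simp add: powr_powr flip: powr_realpow)
      ultimately show ?thesis by (simp add: powr_mult)
    qed
    finally show ?case using elim(1) by (rule le_less_trans)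
  qed
qed

section \<open>Reduction of the linear canonical case\<close>

lemma dunkl_op_chirp:
  assumes "u \<in> schwartz_space"
  shows "dunkl_op k (\<lambda>x. chirp c x * u x) x = chirp c x * (dunkl_op k u x + 2 * \<i> * of_real c * (of_real x * u x))"
proof -
  have S: "(\<lambda>x. chirp c x * u x) \<in> schwartz_space"
    by (rule schwartz_chirp[OF assms])
  have v: "vderiv (\<lambda>x. chirp c x * u x) x = chirp c x * (vderiv u x + 2 * \<i> * of_real c * (of_real x * u x))" for x
    by (rule vector_derivative_at, rule has_vector_derivative_eq_rhs[OF has_vector_derivative_mult[OF chirp_deriv schwartz_derivative[OF assms]]])
       (simp add: algebra_simps)
  have q: "odd_quotient (\<lambda>x. chirp c x * u x) x = chirp c x * odd_quotient u x"
    unfolding odd_quotient_def v by (simp add: algebra_simps diff_divide_distrib)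
  show ?thesis unfolding dunkl_op_eq[OF S] dunkl_op_eq[OF assms] v q by (simp add: algebra_simps)
qed

lemma matrix_inv_2x2:
  fixes M :: "real^2^2"
  assumes "det M = 1"
  shows "matrix_inv M $ 1 $ 2 = - (M $ 1 $ 2)" "matrix_inv M $ 2 $ 2 = M $ 1 $ 1"
proof -
  define B :: "real^2^2" where "B = vector [vector [M $ 2 $ 2, - (M $ 1 $ 2)], vector [- (M $ 2 $ 1), M $ 1 $ 1]]"
  have d: "M $ 1 $ 1 * M $ 2 $ 2 - M $ 1 $ 2 * M $ 2 $ 1 = 1" using assms by (simp add: det_2)
  have "B ** M = mat 1" "M ** B = mat 1"
    using d by (auto simp: B_def vec_eq_iff matrix_matrix_mult_def sum_2 forall_2 vector_2 mat_def algebra_simps)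
  hence "M ** matrix_inv M = mat 1"
    unfolding matrix_inv_def by (rule_tac someI2[where a = B]) auto
  hence "B ** (M ** matrix_inv M) = B" by simp
  hence "matrix_inv M = B" using \<open>B ** M = mat 1\<close> by (simp add: matrix_mul_assoc)
  thus "matrix_inv M $ 1 $ 2 = - (M $ 1 $ 2)" "matrix_inv M $ 2 $ 2 = M $ 1 $ 1"
    by (simp_all add: B_def vector_2)
qed

text \<open>The inverse matrix has the entries \<open>-b\<close> and \<open>a\<close> in its second column, so its operator is
  \<open>\<Lambda> + i (a / b) x\<close>. The additional term is cancelled by the derivative of the chirp.\<close>

lemma lc_dunkl_iter:
  fixes M :: "real^2^2"
  assumes M: "det M = 1" "M $ 1 $ 2 \<noteq> 0" and f: "f \<in> schwartz_space"
  defines "c \<equiv> M $ 1 $ 1 / (2 * M $ 1 $ 2)"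
  shows "(lc_dunkl_op k (matrix_inv M) ^^ n) f = (\<lambda>x. chirp (- c) x * (dunkl_op k ^^ n) (\<lambda>x. chirp c x * f x) x)"
proof (induction n)
  case 0
  show ?case by (rule ext) (simp add: chirp_add chirp_def flip: mult.assoc exp_add)
next
  case (Suc n)
  let ?u = "(dunkl_op k ^^ n) (\<lambda>x. chirp c x * f x)"
  have "(\<lambda>x. chirp c x * f x) \<in> schwartz_space"
    by (rule schwartz_chirp[OF f])
  hence u: "?u \<in> schwartz_space" by (rule dunkl_iter_schwartz)
  show ?case
  proof
    fix x
    have "2 * c = M $ 1 $ 1 / M $ 1 $ 2" by (simp add: c_def)
    hence c2: "complex_of_real (M $ 1 $ 1 / M $ 1 $ 2) = 2 * of_real c" by (metis of_real_mult of_real_numeral)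
    have "(lc_dunkl_op k (matrix_inv M) ^^ Suc n) f x = lc_dunkl_op k (matrix_inv M) (\<lambda>x. chirp (- c) x * ?u x) x"
      by (simp add: Suc)
    also have "\<dots> = dunkl_op k (\<lambda>x. chirp (- c) x * ?u x) x + \<i> * of_real (M $ 1 $ 1 / M $ 1 $ 2) * of_real x * (chirp (- c) x * ?u x)"
      by (simp add: lc_dunkl_op_def matrix_inv_2x2[OF M(1)])
    also have "\<dots> = chirp (- c) x * dunkl_op k ?u x"
      unfolding dunkl_op_chirp[OF u] c2 by (simp add: algebra_simps)
    finally show "(lc_dunkl_op k (matrix_inv M) ^^ Suc n) f x = chirp (- c) x * (dunkl_op k ^^ Suc n) (\<lambda>x. chirp c x * f x) x"
      by simp
  qed
qed

lemma lc_dunkl_transform_eq: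
  fixes M :: "real^2^2"
  assumes M: "M $ 1 $ 2 \<noteq> 0"
  defines "c \<equiv> M $ 1 $ 1 / (2 * M $ 1 $ 2)"
  shows "lc_dunkl_transform k M f l = 1 / ((\<i> * of_real (M $ 1 $ 2)) powr of_real (k + 1))
           * (chirp (M $ 2 $ 2 / (2 * M $ 1 $ 2)) l * dunkl_transform k (\<lambda>x. chirp c x * f x) (l / M $ 1 $ 2))"
proof -
  let ?d = "M $ 2 $ 2 / (2 * M $ 1 $ 2)"
  have "lc_dunkl_kernel k M l x = chirp ?d l * (chirp c x * dunkl_exp k (- (l / M $ 1 $ 2 * x)))" for x
  proof -
    have "\<i> / 2 * complex_of_real (M $ 2 $ 2 / M $ 1 $ 2 * l\<^sup>2 + M $ 1 $ 1 / M $ 1 $ 2 * x\<^sup>2) = \<i> * of_real (?d * l\<^sup>2) + \<i> * of_real (c * x\<^sup>2)"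
      using M by (simp add: c_def field_simps)
    thus ?thesis
      by (simp only: lc_dunkl_kernel_def dunkl_kernel_eq chirp_def exp_add mult.assoc) simp
  qed
  hence "(LINT x|dunkl_measure k. f x * lc_dunkl_kernel k M l x) = (LINT x|dunkl_measure k. chirp ?d l * (chirp c x * f x * dunkl_exp k (- (l / M $ 1 $ 2 * x))))"
    by (simp add: mult_ac)
  thus ?thesis unfolding lc_dunkl_transform_def dunkl_transform_def by simp
qed

text \<open>The supremum over the support equals the supremum over the set where the transform is nonzero,
  because \<open>l \<mapsto> \<bar>l / b\<bar>\<close> is continuous.\<close>

lemma sigma_lc_eq:
  fixes M :: "real^2^2"
  assumes M: "M $ 1 $ 2 \<noteq> 0"
  defines "c \<equiv> M $ 1 $ 1 / (2 * M $ 1 $ 2)"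
  shows "sigma_lc k M f = (SUP y \<in> {y. dunkl_transform k (\<lambda>x. chirp c x * f x) y \<noteq> 0}. ennreal \<bar>y\<bar>)"
proof -
  let ?b = "M $ 1 $ 2"
  define A where "A = {l. lc_dunkl_transform k M f l \<noteq> 0}"
  have "chirp e l \<noteq> 0" for e l by (simp add: chirp_def)
  hence A: "A = {l. dunkl_transform k (\<lambda>x. chirp c x * f x) (l / ?b) \<noteq> 0}"
    using M by (simp add: A_def lc_dunkl_transform_eq c_def powr_def)
  define S where "S = (SUP l\<in>A. ennreal \<bar>l / ?b\<bar>)"
  have "A \<subseteq> {l. ennreal \<bar>l / ?b\<bar> \<le> S}" unfolding S_def by (auto intro: SUP_upper)
  moreover have "closed {l. ennreal \<bar>l / ?b\<bar> \<le> S}"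
    by (intro closed_Collect_le continuous_intros continuous_on_ennreal) (use M in auto)
  ultimately have "closure A \<subseteq> {l. ennreal \<bar>l / ?b\<bar> \<le> S}" by (rule closure_minimal)
  hence "(SUP l\<in>closure A. ennreal \<bar>l / ?b\<bar>) \<le> S" by (intro SUP_least) auto
  moreover have "S \<le> (SUP l\<in>closure A. ennreal \<bar>l / ?b\<bar>)"
    unfolding S_def by (rule SUP_subset_mono) (auto simp: closure_subset[THEN subsetD])
  ultimately have "sigma_lc k M f = S" by (simp add: sigma_lc_def supp_def A_def)
  also have "S = (SUP y \<in> (\<lambda>l. l / ?b) ` A. ennreal \<bar>y\<bar>)" by (simp add: S_def image_image)
  also have "(\<lambda>l. l / ?b) ` A = {y. dunkl_transform k (\<lambda>x. chirp c x * f x) y \<noteq> 0}"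
  proof -
    have "y = (y * ?b) / ?b" for y using M by simp
    thus ?thesis unfolding A by (auto intro!: image_eqI[where x = "_ * ?b"])
  qed
  finally show ?thesis .
qed

theorem theorem5p1:
  fixes k :: real and M :: "real^2^2" and p :: ennreal and f :: "real \<Rightarrow> complex"
  assumes "k \<ge> - 1 / 2"
    and "det M = 1"
    and "M $ 1 $ 2 \<noteq> 0"
    and "1 \<le> p"
    and "f \<in> schwartz_space"
  shows "(\<lambda>n. ennreal_powr (Lp_norm k p ((lc_dunkl_op k (matrix_inv M) ^^ n) f)) (1 / real n))
           \<longlonglongrightarrow> sigma_lc k M f"
proof -
  define c where "c = M $ 1 $ 1 / (2 * M $ 1 $ 2)"
  define g where "g = (\<lambda>x. chirp c x * f x)"
  have g: "g \<in> schwartz_space"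
    unfolding g_def by (rule schwartz_chirp[OF assms(5)])
  have "Lp_norm k p ((lc_dunkl_op k (matrix_inv M) ^^ n) f) = Lp_norm k p ((dunkl_op k ^^ n) g)" for n
    unfolding lc_dunkl_iter[OF assms(2,3,5)] Lp_norm_def norm_mult norm_chirp mult_1 g_def c_def ..
  thus ?thesis
    using dunkl_iterate_growth[OF assms(1,4) g] sigma_lc_eq[OF assms(3)]
    by (simp add: g_def c_def)
qed

end
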